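(* Let $\mathcal{A}$ be any class of structures. The following three conditions are equivalent: (a) $\mathcal{A}$ is $\mathrm{td}$-pliable; (b) $\mathcal{A}$ is $\mathrm{tw}$-pliable; (c) $\mathcal{A}$ is $\mathrm{Hadwiger}$-pliable. If, moreover, the structures in $\mathcal{A}$ have bounded signatures, then conditions (a)–(c) are also equivalent to each of the following: (d) $\mathcal{A}$ is $\mathrm{size}$-pliable; (e) $\mathcal{A}$ is $\mathrm{cc}$-pliable.
   Context: A signature $\sigma$ is a finite set of function symbols $f$, each with an arity $\mathrm{ar}(f)$. A $\sigma$-structure $\mathbb{A}$ consists of a finite domain $A$ and, for each $f\in\sigma$, a function $f^{\mathbb{A}}\colon A^{\mathrm{ar}(f)}\to\mathbb{Q}_{\ge 0}$. For $\sigma$-structures $\mathbb{A},\mathbb{C}$ and a map $h\colon A\to C$, $\mathrm{val}(h)=\sum_{f\in\sigma,\ \mathbf{x}\in A^{\mathrm{ar}(f)}} f^{\mathbb{A}}(\mathbf{x})\, f^{\mathbb{C}}(h(\mathbf{x}))$, and $\mathrm{opt}(\mathbb{A},\mathbb{C})$ is the maximum of $\mathrm{val}(h)$ over all maps $h\colon A\to C$. The opt-distance between two $\sigma$-structures is $\mathrm{d}_{\mathrm{opt}}(\mathbb{A},\mathbb{B})=\sup_{\mathbb{C}} |\ln \mathrm{opt}(\mathbb{A},\mathbb{C})-\ln \mathrm{opt}(\mathbb{B},\mathbb{C})|$ (with $\ln 0=-\infty$ and $|\ln 0-\ln 0|=0$). The Gaifman graph of $\mathbb{A}$ has vertex set $A$,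 with $u,v$ adjacent iff they both appear in some tuple $\mathbf{x}$ with $f^{\mathbb{A}}(\mathbf{x})>0$ for some $f\in\sigma$. Graph parameters are applied to structures via their Gaifman graphs: $\mathrm{size}$ = number of vertices, $\mathrm{cc}$ = maximum size of a connected component, $\mathrm{td}$ = treedepth, $\mathrm{tw}$ = treewidth, $\mathrm{Hadwiger}$ = largest $k$ such that $K_k$ is a minor. For a parameter $p$, a class $\mathcal{A}$ of structures is $p$-pliable if for every $\varepsilon>0$ there is $k=k(\varepsilon)$ such that every $\sigma$-structure $\mathbb{A}\in\mathcal{A}$ has a $\sigma$-structure $\mathbb{B}$ (same signature) with $p(\mathbb{B})\le k$ and $\mathrm{d}_{\mathrm{opt}}(\mathbb{A},\mathbb{B})\le\varepsilon$. "Bounded signatures" means the signatures of structures in $\mathcal{A}$ have bounded number of symbols and bounded arity. *)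

theory Defs
  imports Complex_Main "HOL-Library.FuncSet" "HOL-Library.Extended_Real"
begin

section \<open>Valued structures\<close>

text \<open>A signature is a finite partial map from symbol names (nat) to arities.
  A structure has a finite nonempty domain, a signature, and an interpretation
  assigning to each symbol and tuple (list of the symbol's arity) a nonnegative
  rational weight; the interpretation is zero outside its intended range.\<close>

record 'a struc =
  univ   :: "'a set"
  sigma  :: "nat \<rightharpoonup> nat"
  interp :: "nat \<Rightarrow> 'a list \<Rightarrow> real"

definition tuples :: "'a set \<Rightarrow> nat \<Rightarrow> 'a list set" where
  "tuples D n = {xs. set xs \<subseteq> D \<and> length xs = n}"

definition struc_wf :: "('a, 'b) struc_scheme \<Rightarrow> bool" where
  "struc_wf S \<longleftrightarrow> finite (univ S) \<and> univ S \<noteq> {} \<and> finite (dom (sigma S)) \<and>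
     (\<forall>f x. interp S f x \<ge> 0 \<and> interp S f x \<in> \<rat>) \<and>
     (\<forall>f x. interp S f x \<noteq> 0 \<longrightarrow>
        f \<in> dom (sigma S) \<and> x \<in> tuples (univ S) (the (sigma S f)))"

definition val :: "'a struc \<Rightarrow> 'c struc \<Rightarrow> ('a \<Rightarrow> 'c) \<Rightarrow> real" where
  "val A C h = (\<Sum>f\<in>dom (sigma A). \<Sum>x\<in>tuples (univ A) (the (sigma A f)).
                   interp A f x * interp C f (map h x))"

definition opt :: "'a struc \<Rightarrow> 'c struc \<Rightarrow> real" where
  "opt A C = Max (val A C ` (univ A \<rightarrow>\<^sub>E univ C))"

definition ln_ext :: "real \<Rightarrow> ereal" where
  "ln_ext x = (if x = 0 then -\<infinity> else ereal (ln x))"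

definition log_gap :: "real \<Rightarrow> real \<Rightarrow> ereal" where
  "log_gap a b = (if a = 0 \<and> b = 0 then 0 else \<bar>ln_ext a - ln_ext b\<bar>)"

text \<open>opt-distance: supremum over all (finite, nonempty) structures C of the same
  signature; every such C is isomorphic to one with domain in nat.\<close>
definition d_opt :: "'a struc \<Rightarrow> 'b struc \<Rightarrow> ereal" where
  "d_opt A B = (SUP C \<in> {C :: nat struc. struc_wf C \<and> sigma C = sigma A}.
                   log_gap (opt A C) (opt B C))"

section \<open>Gaifman graph and graph parameters\<close>

definition gaif_adj :: "'a struc \<Rightarrow> 'a \<Rightarrow> 'a \<Rightarrow> bool" where
  "gaif_adj S u v \<longleftrightarrow> u \<noteq> v \<and>
     (\<exists>f\<in>dom (sigma S). \<exists>x\<in>tuples (univ S) (the (sigma S f)).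
        interp S f x > 0 \<and> u \<in> set x \<and> v \<in> set x)"

text \<open>Graphs: a finite vertex set V with a symmetric irreflexive adjacency E.\<close>

definition edges_in :: "'a set \<Rightarrow> ('a \<Rightarrow> 'a \<Rightarrow> bool) \<Rightarrow> ('a \<times> 'a) set" where
  "edges_in S E = {(x, y). x \<in> S \<and> y \<in> S \<and> E x y}"

definition connected_set :: "('a \<Rightarrow> 'a \<Rightarrow> bool) \<Rightarrow> 'a set \<Rightarrow> bool" where
  "connected_set E S \<longleftrightarrow> S \<noteq> {} \<and> (\<forall>x\<in>S. \<forall>y\<in>S. (x, y) \<in> (edges_in S E)\<^sup>*)"

definition component :: "'a set \<Rightarrow> ('a \<Rightarrow> 'a \<Rightarrow> bool) \<Rightarrow> 'a \<Rightarrow> 'a set" where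
  "component V E v = {w \<in> V. (v, w) \<in> (edges_in V E)\<^sup>*}"

definition gsize :: "'a set \<Rightarrow> ('a \<Rightarrow> 'a \<Rightarrow> bool) \<Rightarrow> nat" where
  "gsize V E = card V"

definition gcc :: "'a set \<Rightarrow> ('a \<Rightarrow> 'a \<Rightarrow> bool) \<Rightarrow> nat" where
  "gcc V E = Max ((\<lambda>v. card (component V E v)) ` V)"

text \<open>Treedepth: minimum height of a rooted forest on V (given as a tree order:
  a partial order whose down-sets are chains) whose closure contains every edge.\<close>
definition treedepth :: "'a set \<Rightarrow> ('a \<Rightarrow> 'a \<Rightarrow> bool) \<Rightarrow> nat" where
  "treedepth V E = (LEAST k. \<exists>le :: 'a \<Rightarrow> 'a \<Rightarrow> bool.
      (\<forall>u v. le u v \<longrightarrow> u \<in> V \<and> v \<in> V) \<and>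
      (\<forall>v\<in>V. le v v) \<and>
      (\<forall>u v. le u v \<and> le v u \<longrightarrow> u = v) \<and>
      (\<forall>u v w. le u v \<and> le v w \<longrightarrow> le u w) \<and>
      (\<forall>v\<in>V. \<forall>a b. le a v \<and> le b v \<longrightarrow> le a b \<or> le b a) \<and>
      (\<forall>u\<in>V. \<forall>v\<in>V. E u v \<longrightarrow> le u v \<or> le v u) \<and>
      (\<forall>v\<in>V. card {u. le u v} \<le> k))"

text \<open>Trees on a finite nonempty node set I \<subseteq> nat: connected with |I|-1 edges.\<close>
definition is_tree :: "nat set \<Rightarrow> (nat \<Rightarrow> nat \<Rightarrow> bool) \<Rightarrow> bool" where
  "is_tree I F \<longleftrightarrow> finite I \<and> (\<forall>i j. F i j \<longrightarrow> i \<in> I \<and> j \<in> I \<and> i \<noteq> j \<and> F j i) \<and>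
     connected_set F I \<and> card {{i, j} | i j. F i j} = card I - 1"

definition tree_decomp ::
  "'a set \<Rightarrow> ('a \<Rightarrow> 'a \<Rightarrow> bool) \<Rightarrow> nat set \<Rightarrow> (nat \<Rightarrow> nat \<Rightarrow> bool) \<Rightarrow> (nat \<Rightarrow> 'a set) \<Rightarrow> bool" where
  "tree_decomp V E I F X \<longleftrightarrow> is_tree I F \<and> (\<forall>i\<in>I. X i \<subseteq> V) \<and>
     (\<forall>v\<in>V. \<exists>i\<in>I. v \<in> X i) \<and>
     (\<forall>u\<in>V. \<forall>v\<in>V. E u v \<longrightarrow> (\<exists>i\<in>I. u \<in> X i \<and> v \<in> X i)) \<and>
     (\<forall>v\<in>V. connected_set F {i \<in> I. v \<in> X i})"

definition treewidth :: "'a set \<Rightarrow> ('a \<Rightarrow> 'a \<Rightarrow> bool) \<Rightarrow> nat" where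
  "treewidth V E = (LEAST k. \<exists>I F X. tree_decomp V E I F X \<and> (\<forall>i\<in>I. card (X i) \<le> k + 1))"

text \<open>Hadwiger number: largest k such that K_k is a minor, i.e. there are k pairwise
  disjoint nonempty connected branch sets, pairwise joined by an edge.\<close>
definition hadwiger :: "'a set \<Rightarrow> ('a \<Rightarrow> 'a \<Rightarrow> bool) \<Rightarrow> nat" where
  "hadwiger V E = (GREATEST k. \<exists>Bs :: nat \<Rightarrow> 'a set.
      (\<forall>i<k. Bs i \<subseteq> V \<and> connected_set E (Bs i)) \<and>
      (\<forall>i<k. \<forall>j<k. i \<noteq> j \<longrightarrow> Bs i \<inter> Bs j = {} \<and> (\<exists>u\<in>Bs i. \<exists>w\<in>Bs j. E u w)))"

section \<open>Pliability\<close>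

definition pliable :: "(nat set \<Rightarrow> (nat \<Rightarrow> nat \<Rightarrow> bool) \<Rightarrow> nat) \<Rightarrow> 'a struc set \<Rightarrow> bool" where
  "pliable p \<A> \<longleftrightarrow> (\<forall>\<epsilon>>0. \<exists>k. \<forall>A\<in>\<A>. \<exists>B :: nat struc.
      struc_wf B \<and> sigma B = sigma A \<and> p (univ B) (gaif_adj B) \<le> k \<and> d_opt A B \<le> ereal \<epsilon>)"

definition bounded_signatures :: "'a struc set \<Rightarrow> bool" where
  "bounded_signatures \<A> \<longleftrightarrow> (\<exists>m r. \<forall>A\<in>\<A>.
      card (dom (sigma A)) \<le> m \<and> (\<forall>f n. sigma A f = Some n \<longrightarrow> n \<le> r))"

end

theory Submission
  imports Defs "HOL-Library.Nat_Bijection"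
begin

text \<open>
  Since the Hadwiger number is at most the treewidth plus one and the treewidth is at most the
  treedepth, the first part reduces to approximating structures without a large clique minor by
  structures of bounded treedepth. The graph-theoretic core is that such graphs are fractionally
  treedepth-fragile: one can sample a vertex set that contains each vertex with small probability and
  whose deletion leaves bounded treedepth. Averaging over weighted copies of the structure with the
  sampled vertices deleted then gives the approximation. Fragility is proved in the style of
  Dvorak's Baker game, without the minor structure theorem. By induction on \<open>s\<close> one treats graphs
  without a \<open>K\<^sub>s\<close>-model all of whose branch sets meet all members of a family \<open>\<N>\<close>, until every
  component misses a member of \<open>\<N>\<close>. Let \<open>S\<close> be a union of geodesics from a vertex \<open>x\<close> to the members
  of \<open>\<N>\<close>. Deleting a random residue class of the layers around \<open>x\<close> leaves pieces in which \<open>S\<close> has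
  boundedly many vertices; these are put on top of the elimination forest. Then one deletes a random
  residue class of the layers around \<open>S\<close>; the remaining layers are removed one at a time, because the
  ball below a layer is an additional branch set.

  For bounded signatures, a structure with an elimination forest of bounded height is folded from the
  leaves upwards. Sibling subtrees are rounded, relative to the total weight of each pattern (symbol
  together with the depths of the entries), to boundedly many shapes, and siblings of equal shape,
  whose weights are proportional, are merged. The rounding error is small since mapping each vertex
  according to its depth shows that the optimum is at least the contribution of every single pattern.
\<close>

section \<open>Forest orders and fractional fragility\<close>

text \<open>One structure must serve every target at once, so neither construction may look at the
  target. Copies work because weights are nonnegative: deleting vertices never raises a value, and
  the loss is controlled tuple by tuple. Arities are unbounded in the first part, but the entries of
  a tuple of positive weight form a clique, so a Hadwiger number at most \<open>k\<close> leaves at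
  most \<open>k\<close> distinct entries, and a set that hits each vertex with probability
  \<open>\<eta>\<close> spares the tuple with probability at least \<open>1 - k * \<eta>\<close>.
  The models are rooted because the ball below a layer joins a model only if it touches all branch
  sets; the layer becomes a new root set. Fragility of sets missing a root set is a hypothesis of
  the induction, with its own probability and depth: this is how one layer hands over to the next
  ones. In the second part, relating the rounding error to the optimum costs a factor equal to the
  number of patterns. This is where the number of symbols and the arity enter, besides the number of
  shapes.\<close>

definition forest_order :: "'a set \<Rightarrow> ('a \<Rightarrow> 'a \<Rightarrow> bool) \<Rightarrow> nat \<Rightarrow> ('a \<Rightarrow> 'a \<Rightarrow> bool) \<Rightarrow> bool" where
  "forest_order V E k le \<longleftrightarrow>
      (\<forall>u v. le u v \<longrightarrow> u \<in> V \<and> v \<in> V) \<and>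
      (\<forall>v\<in>V. le v v) \<and>
      (\<forall>u v. le u v \<and> le v u \<longrightarrow> u = v) \<and>
      (\<forall>u v w. le u v \<and> le v w \<longrightarrow> le u w) \<and>
      (\<forall>v\<in>V. \<forall>a b. le a v \<and> le b v \<longrightarrow> le a b \<or> le b a) \<and>
      (\<forall>u\<in>V. \<forall>v\<in>V. E u v \<longrightarrow> le u v \<or> le v u) \<and>
      (\<forall>v\<in>V. card {u. le u v} \<le> k)"

lemma forest_orderD:
  assumes "forest_order V E k le"
  shows "le u v \<Longrightarrow> u \<in> V" "le u v \<Longrightarrow> v \<in> V" "v \<in> V \<Longrightarrow> le v v"
    "le u v \<Longrightarrow> le v u \<Longrightarrow> u = v" "le u v \<Longrightarrow> le v w \<Longrightarrow> le u w"
    "le a v \<Longrightarrow> le b v \<Longrightarrow> le a b \<or> le b a"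
    "u \<in> V \<Longrightarrow> v \<in> V \<Longrightarrow> E u v \<Longrightarrow> le u v \<or> le v u" "v \<in> V \<Longrightarrow> card {u. le u v} \<le> k"
proof -
  note d = assms[unfolded forest_order_def]
  show "le u v \<Longrightarrow> u \<in> V" "le u v \<Longrightarrow> v \<in> V" "v \<in> V \<Longrightarrow> le v v" using d by blast+
  show "le u v \<Longrightarrow> le v u \<Longrightarrow> u = v" using d by blast
  show "le u v \<Longrightarrow> le v w \<Longrightarrow> le u w" using conjunct1[OF conjunct2[OF conjunct2[OF conjunct2[OF d]]]] by metis
  show "le a v \<Longrightarrow> le b v \<Longrightarrow> le a b \<or> le b a" using d by metis
  show "u \<in> V \<Longrightarrow> v \<in> V \<Longrightarrow> E u v \<Longrightarrow> le u v \<or> le v u" using d by metis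
  show "v \<in> V \<Longrightarrow> card {u. le u v} \<le> k" using d by metis
qed

text \<open>The size of the down-set plays the role of depth. Its strict growth along chains is used
  to find parents and minimal elements, and later to colour the entries of a tuple
  injectively.\<close>

lemma forest_order_card_less:
  assumes fo: "forest_order V E k le" and "finite V" "le u v" "u \<noteq> v"
  shows "card {w. le w u} < card {w. le w v}"
proof (rule psubset_card_mono)
  note ord = forest_orderD[OF fo]
  show "finite {w. le w v}" by (rule finite_subset[OF _ assms(2)]) (use ord(1) in auto)
  have "v \<in> {w. le w v}" using ord(2,3) assms(3) by simp
  moreover have "v \<notin> {w. le w u}" using ord(4) assms by auto
  moreover have "{w. le w u} \<subseteq> {w. le w v}" using ord(5) assms(3) by auto
  ultimately show "{w. le w u} \<subset> {w. le w v}" by blast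
qed

text \<open>Used in place of \<open>treedepth\<close>, since witnesses are easier to combine than a
  \<open>LEAST\<close>; on finite vertex sets the two agree by
  \<open>treedepth_le_iff\<close>.\<close>

definition td_le :: "('a \<Rightarrow> 'a \<Rightarrow> bool) \<Rightarrow> nat \<Rightarrow> 'a set \<Rightarrow> bool" where
  "td_le E k V \<longleftrightarrow> (\<exists>le. forest_order V E k le)"

lemma treedepth_eq_Least: "treedepth V E = (LEAST k. td_le E k V)"
  unfolding treedepth_def td_le_def forest_order_def ..

lemma td_le_mono:
  assumes "td_le E k V" "k \<le> k'"
  shows "td_le E k' V"
proof -
  obtain le where "forest_order V E k le" using assms(1) td_le_def by blast
  then have "forest_order V E k' le" unfolding forest_order_def
    by (elim conjE, intro conjI) (assumption, assumption, assumption, assumption, assumption, assumption,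
      metis le_trans assms(2))
  then show ?thesis using td_le_def by blast
qed

lemma td_le_subset:
  assumes "td_le E k V" "V' \<subseteq> V" "finite V"
  shows "td_le E k V'"
proof -
  obtain le where le: "forest_order V E k le" using assms(1) td_le_def by blast
  define le' where "le' = (\<lambda>u v. le u v \<and> u \<in> V' \<and> v \<in> V')"
  have *: "card {u. le' u v} \<le> k" if "v \<in> V'" for v
  proof -
    have "{u. le u v} \<subseteq> V" using forest_orderD(1)[OF le] by blast
    then have "finite {u. le u v}" using assms(3) finite_subset by blast
    then have "card {u. le' u v} \<le> card {u. le u v}" by (rule card_mono) (auto simp: le'_def)
    also have "\<dots> \<le> k" using forest_orderD(8)[OF le, of v] that assms(2) by blast
    finally show ?thesis .
  qed
  have "forest_order V' E k le'"
    unfolding forest_order_def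
  proof (intro conjI allI ballI impI)
    fix v assume "v \<in> V'" then show "le' v v" using forest_orderD(3)[OF le] assms(2) by (auto simp: le'_def)
  next
    fix u v assume "u \<in> V'" "v \<in> V'" "E u v"
    then show "le' u v \<or> le' v u" using forest_orderD(7)[OF le, of u v] assms(2) by (auto simp: le'_def)
  next
    fix u v w assume "le' u v \<and> le' v w"
    then show "le' u w" using forest_orderD(5)[OF le, of u v w] by (auto simp: le'_def)
  next
    fix v a b assume "v \<in> V'" "le' a v \<and> le' b v"
    then show "le' a b \<or> le' b a" using forest_orderD(6)[OF le, of a v b] by (auto simp: le'_def)
  next
    fix u v assume "le' u v \<and> le' v u"
    then show "u = v" using forest_orderD(4)[OF le, of u v] by (auto simp: le'_def)
  qed (use * in \<open>auto simp: le'_def\<close>)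
  then show ?thesis using td_le_def by blast
qed

text \<open>The orders on the classes are placed side by side. The label \<open>part\<close> is
  arbitrary: components, blocks of layers and the copies of a structure are all separated this
  way.\<close>

lemma td_le_parts:
  assumes parts: "\<And>q. td_le E k {v \<in> V. part v = q}"
    and edge: "\<And>u v. u \<in> V \<Longrightarrow> v \<in> V \<Longrightarrow> E u v \<Longrightarrow> part u = part v"
  shows "td_le E k V"
proof -
  have "\<forall>q. \<exists>le. forest_order {v \<in> V. part v = q} E k le" using parts td_le_def by blast
  then obtain le where le: "\<And>q. forest_order {v \<in> V. part v = q} E k (le q)" by metis
  define le' where "le' = (\<lambda>u v. le (part v) u v)"
  have same: "part u = part v \<and> u \<in> V \<and> v \<in> V" if "le' u v" for u v
    using forest_orderD(1,2)[OF le[of "part v"]] that unfolding le'_def by blast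
  have "forest_order V E k le'" unfolding forest_order_def
  proof (intro conjI allI ballI impI)
    fix u v assume "le' u v" then show "u \<in> V" "v \<in> V" using same by auto
  next
    fix v assume "v \<in> V" then show "le' v v" using forest_orderD(3)[OF le[of "part v"]] by (auto simp: le'_def)
  next
    fix u v assume a: "le' u v \<and> le' v u"
    then have "part u = part v" using same by auto
    then show "u = v" using forest_orderD(4)[OF le[of "part v"]] a by (auto simp: le'_def)
  next
    fix u v w assume a: "le' u v \<and> le' v w"
    then have "part u = part v" "part v = part w" using same by auto
    then show "le' u w" using forest_orderD(5)[OF le[of "part w"], of u v w] a by (auto simp: le'_def)
  next
    fix v a b assume "v \<in> V" and a: "le' a v \<and> le' b v"
    then have "part a = part v" "part b = part v" using same by auto
    then show "le' a b \<or> le' b a" using forest_orderD(6)[OF le[of "part v"], of a v b] a by (auto simp: le'_def)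
  next
    fix u v assume "u \<in> V" "v \<in> V" "E u v"
    then show "le' u v \<or> le' v u"
      using forest_orderD(7)[OF le[of "part v"], of u v] edge[of u v] by (auto simp: le'_def)
  next
    fix v assume "v \<in> V"
    then show "card {u. le' u v} \<le> k" using forest_orderD(8)[OF le[of "part v"]] by (auto simp: le'_def)
  qed
  then show ?thesis using td_le_def by blast
qed

text \<open>\<open>r\<close> is put below all other vertices as a common root, so its edges are
  covered whatever they are.\<close>

lemma td_le_Suc:
  assumes "td_le E k (V - {r})" "finite V"
  shows "td_le E (Suc k) V"
proof (cases "r \<in> V")
  case False
  then show ?thesis using assms td_le_mono[of E k V "Suc k"] by simp
next
  case True
  obtain le where le: "forest_order (V - {r}) E k le" using assms(1) td_le_def by blast
  define le' where "le' = (\<lambda>u v. le u v \<or> (u = r \<and> v \<in> V))"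
  have sub: "u \<in> V - {r} \<and> v \<in> V - {r}" if "le u v" for u v
    using forest_orderD(1,2)[OF le that] by simp
  have "card {u. le' u v} \<le> Suc k" if "v \<in> V" for v
  proof (cases "v = r")
    case True
    then have "{u. le' u v} = {r}" using sub \<open>r \<in> V\<close> by (auto simp: le'_def)
    then show ?thesis by simp
  next
    case False
    then have "{u. le' u v} = insert r {u. le u v}" using that by (auto simp: le'_def)
    moreover have "card {u. le u v} \<le> k" using forest_orderD(8)[OF le, of v] that False by simp
    ultimately show ?thesis by (metis Suc_le_mono card_insert_le_m1 diff_Suc_1 zero_less_Suc)
  qed
  then have "forest_order V E (Suc k) le'"
    unfolding forest_order_def
  proof (intro conjI allI ballI impI)
    fix u v w assume "le' u v \<and> le' v w"
    then show "le' u w" using sub[of u v] sub[of v w] forest_orderD(5)[OF le, of u v w] by (auto simp: le'_def)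
  next
    fix u v assume "u \<in> V" "v \<in> V" "E u v"
    then show "le' u v \<or> le' v u"
      using forest_orderD(7)[OF le, of u v] by (cases "u = r \<or> v = r") (auto simp: le'_def)
  next
    fix v a b assume "v \<in> V" "le' a v \<and> le' b v"
    then show "le' a b \<or> le' b a" using sub[of a v] sub[of b v] True forest_orderD(6)[OF le, of a v b]
      by (auto simp: le'_def)
  next
    fix v assume "v \<in> V"
    then show "le' v v" using forest_orderD(3)[OF le] by (cases "v = r") (auto simp: le'_def)
  next
    fix u v assume "le' u v \<and> le' v u"
    then show "u = v" using sub[of u v] sub[of v u] forest_orderD(4)[OF le, of u v] by (auto simp: le'_def)
  qed (use sub True in \<open>auto simp: le'_def\<close>)
  then show ?thesis using td_le_def by blast
qed

text \<open>An index below \<open>l * n\<close> encodes an independent pair of a uniform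
  \<open>e mod l\<close> and a uniform \<open>e div l\<close>: a product of two uniform
  distributions.\<close>

lemma card_filter_mod_div:
  fixes l n :: nat
  assumes "l > 0"
  shows "card {e. e < l * n \<and> Q (e mod l) (e div l)} = (\<Sum>a<l. card {i. i < n \<and> Q a i})"
proof -
  have "bij_betw (\<lambda>(a, i). a + l * i) (SIGMA a:{..<l}. {i. i < n \<and> Q a i})
          {e. e < l * n \<and> Q (e mod l) (e div l)}"
  proof (rule bij_betw_byWitness[where f' = "\<lambda>e. (e mod l, e div l)"])
    show "(\<lambda>(a, i). a + l * i) ` (SIGMA a:{..<l}. {i. i < n \<and> Q a i})
            \<subseteq> {e. e < l * n \<and> Q (e mod l) (e div l)}"
    proof clarsimp
      fix a i assume "a < l" "i < n"
      then have "a + l * i < l * Suc i" by simp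
      also have "\<dots> \<le> l * n" using \<open>i < n\<close> by (intro mult_le_mono2) simp
      finally show "a + l * i < l * n" .
    qed
    show "(\<lambda>e. (e mod l, e div l)) ` {e. e < l * n \<and> Q (e mod l) (e div l)}
            \<subseteq> (SIGMA a:{..<l}. {i. i < n \<and> Q a i})"
      using assms by (auto simp: less_mult_imp_div_less mult.commute)
  qed (use assms in auto)
  then have "card {e. e < l * n \<and> Q (e mod l) (e div l)} = card (SIGMA a:{..<l}. {i. i < n \<and> Q a i})"
    by (simp add: bij_betw_same_card)
  then show ?thesis by simp
qed

text \<open>Fractional treedepth-fragility. The random deletion set is a uniform choice from a
  finite list \<open>X 0, ..., X (n - 1)\<close>, repetitions allowed, so probabilities are counts
  and the later averages have rational weights.\<close>

definition frag :: "('a \<Rightarrow> 'a \<Rightarrow> bool) \<Rightarrow> real \<Rightarrow> nat \<Rightarrow> 'a set \<Rightarrow> bool" where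
  "frag E \<epsilon> d U \<longleftrightarrow> (\<exists>n>0. \<exists>X :: nat \<Rightarrow> 'a set. (\<forall>i<n. td_le E d (U - X i)) \<and>
     (\<forall>v\<in>U. real (card {i. i < n \<and> v \<in> X i}) \<le> \<epsilon> * real n))"

lemma fragI:
  assumes "n > 0" "\<And>i. i < n \<Longrightarrow> td_le E d (U - X i)"
    and "\<And>v. v \<in> U \<Longrightarrow> real (card {i. i < n \<and> v \<in> X i}) \<le> \<epsilon> * real n"
  shows "frag E \<epsilon> d U"
  unfolding frag_def by (intro exI[of _ n] conjI exI[of _ X]) (use assms in auto)

lemma frag_mono:
  assumes "frag E \<epsilon> d U" "\<epsilon> \<le> \<epsilon>'" "d \<le> d'"
  shows "frag E \<epsilon>' d' U"
proof -
  obtain n X where "n > 0" "\<And>i. i < n \<Longrightarrow> td_le E d (U - X i)"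
    and c: "\<And>v. v \<in> U \<Longrightarrow> real (card {i. i < n \<and> v \<in> X i}) \<le> \<epsilon> * real n"
    using assms(1) unfolding frag_def by blast
  moreover have "real (card {i. i < n \<and> v \<in> X i}) \<le> \<epsilon>' * real n" if "v \<in> U" for v
    using c[OF that] mult_right_mono[OF assms(2), of "real n"] by linarith
  ultimately show ?thesis by (intro fragI[of n _ _ _ X]) (auto intro: td_le_mono[OF _ assms(3)])
qed

lemma frag_subset:
  assumes "frag E \<epsilon> d U" "U' \<subseteq> U" "finite U"
  shows "frag E \<epsilon> d U'"
proof -
  obtain n X where "n > 0" and t: "\<And>i. i < n \<Longrightarrow> td_le E d (U - X i)"
    and c: "\<And>v. v \<in> U \<Longrightarrow> real (card {i. i < n \<and> v \<in> X i}) \<le> \<epsilon> * real n"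
    using assms(1) unfolding frag_def by blast
  moreover have "td_le E d (U' - X i)" if "i < n" for i
    by (rule td_le_subset[OF t[OF that]]) (use assms in auto)
  ultimately show ?thesis using assms(2) by (intro fragI[of n _ _ _ X]) auto
qed

lemma td_le_empty: "td_le E k {}"
  unfolding td_le_def forest_order_def by (rule exI[of _ "\<lambda>_ _. False"]) auto

lemma frag_empty: "frag E \<epsilon> d {}"
  unfolding frag_def by (rule exI[of _ 1]) (auto intro: td_le_empty)

text \<open>Distributions with different sample sizes are brought to the common size
  \<open>prod n J\<close> by repeating each list periodically, which keeps all frequencies.\<close>

lemma frag_common:
  assumes "finite J" "\<And>q. q \<in> J \<Longrightarrow> frag E \<epsilon> d (P q)"
  shows "\<exists>n>0. \<exists>X :: 'b \<Rightarrow> nat \<Rightarrow> 'a set. \<forall>q\<in>J. (\<forall>i<n. td_le E d (P q - X q i)) \<and>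
     (\<forall>v\<in>P q. real (card {i. i < n \<and> v \<in> X q i}) \<le> \<epsilon> * real n)"
proof -
  have "\<forall>q\<in>J. \<exists>z. fst z > 0 \<and> (\<forall>i<fst z. td_le E d (P q - snd z i)) \<and>
     (\<forall>v\<in>P q. real (card {i. i < fst z \<and> v \<in> snd z i}) \<le> \<epsilon> * real (fst z))"
  proof
    fix q assume "q \<in> J"
    from assms(2)[OF this] obtain n X where "n > 0" "\<forall>i<n. td_le E d (P q - X i)"
      "\<forall>v\<in>P q. real (card {i. i < n \<and> v \<in> X i}) \<le> \<epsilon> * real n" unfolding frag_def by blast
    then show "\<exists>z. fst z > 0 \<and> (\<forall>i<fst z. td_le E d (P q - snd z i)) \<and>
     (\<forall>v\<in>P q. real (card {i. i < fst z \<and> v \<in> snd z i}) \<le> \<epsilon> * real (fst z))"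
      by (intro exI[of _ "(n, X)"]) simp
  qed
  from bchoice[OF this] obtain z where z: "\<forall>q\<in>J. fst (z q) > 0 \<and> (\<forall>i<fst (z q). td_le E d (P q - snd (z q) i)) \<and>
     (\<forall>v\<in>P q. real (card {i. i < fst (z q) \<and> v \<in> snd (z q) i}) \<le> \<epsilon> * real (fst (z q)))" ..
  define n where "n = (\<lambda>q. fst (z q))"
  define X where "X = (\<lambda>q. snd (z q))"
  have n0: "\<And>q. q \<in> J \<Longrightarrow> n q > 0"
    and td: "\<And>q i. q \<in> J \<Longrightarrow> i < n q \<Longrightarrow> td_le E d (P q - X q i)"
    and c: "\<And>q v. q \<in> J \<Longrightarrow> v \<in> P q \<Longrightarrow> real (card {i. i < n q \<and> v \<in> X q i}) \<le> \<epsilon> * real (n q)"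
    using z by (auto simp: n_def X_def)
  define N where "N = prod n J"
  have "N > 0" using n0 assms(1) by (simp add: N_def)
  moreover have "(\<forall>i<N. td_le E d (P q - X q (i mod n q))) \<and>
     (\<forall>v\<in>P q. real (card {i. i < N \<and> v \<in> X q (i mod n q)}) \<le> \<epsilon> * real N)" if q: "q \<in> J" for q
  proof (intro conjI allI impI ballI)
    fix i show "td_le E d (P q - X q (i mod n q))" using td[OF q] n0[OF q] by simp
  next
    fix v assume v: "v \<in> P q"
    define k where "k = prod n (J - {q})"
    have N: "N = n q * k" unfolding N_def k_def by (rule prod.remove[OF assms(1) q])
    have "card {i. i < n q * k \<and> v \<in> X q (i mod n q)} = (\<Sum>a<n q. card {i. i < k \<and> v \<in> X q a})"
      by (rule card_filter_mod_div[OF n0[OF q], where Q = "\<lambda>a i. v \<in> X q a"])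
    also have "\<dots> = (\<Sum>a<n q. if v \<in> X q a then k else 0)" by (intro sum.cong) auto
    also have "\<dots> = k * card {i. i < n q \<and> v \<in> X q i}"
      by (simp add: sum.If_cases Int_def)
    finally have "real (card {i. i < N \<and> v \<in> X q (i mod n q)}) = real k * real (card {i. i < n q \<and> v \<in> X q i})"
      by (simp add: N)
    also have "\<dots> \<le> real k * (\<epsilon> * real (n q))" by (rule mult_left_mono[OF c[OF q v]]) simp
    finally show "real (card {i. i < N \<and> v \<in> X q (i mod n q)}) \<le> \<epsilon> * real N" by (simp add: N mult_ac)
  qed
  ultimately show ?thesis by (intro exI[of _ N] conjI exI[of _ "\<lambda>q i. X q (i mod n q)"]) auto
qed

text \<open>Only the probability of each single vertex is bounded, so the samples of different
  classes may be correlated arbitrarily; all classes use the same index.\<close>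

lemma frag_parts:
  assumes "finite U" and parts: "\<And>q. frag E \<epsilon> d {v \<in> U. part v = q}"
    and edge: "\<And>u v. u \<in> U \<Longrightarrow> v \<in> U \<Longrightarrow> E u v \<Longrightarrow> part u = part v"
  shows "frag E \<epsilon> d U"
proof -
  have "finite (part ` U)" using assms(1) by simp
  from frag_common[OF this, of E \<epsilon> d "\<lambda>q. {v \<in> U. part v = q}", OF parts]
  obtain n and X :: "'b \<Rightarrow> nat \<Rightarrow> 'a set" where n: "n > 0"
    and X: "\<forall>q\<in>part ` U. (\<forall>i<n. td_le E d ({v \<in> U. part v = q} - X q i)) \<and>
      (\<forall>v\<in>{v \<in> U. part v = q}. real (card {i. i < n \<and> v \<in> X q i}) \<le> \<epsilon> * real n)" by blast
  have td: "td_le E d ({v \<in> U. part v = q} - X q i)" if "q \<in> part ` U" "i < n" for q i using X that by blast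
  have c: "real (card {i. i < n \<and> v \<in> X q i}) \<le> \<epsilon> * real n" if "q \<in> part ` U" "v \<in> U" "part v = q" for q v
    using bspec[OF X that(1)] that by simp
  define Y where "Y = (\<lambda>i. {v. v \<in> X (part v) i})"
  have "td_le E d (U - Y i)" if "i < n" for i
  proof (rule td_le_parts[where part = part])
    fix q
    have eq: "{v \<in> U - Y i. part v = q} = {v \<in> U. part v = q} - X q i" by (auto simp: Y_def)
    show "td_le E d {v \<in> U - Y i. part v = q}"
    proof (cases "q \<in> part ` U")
      case True then show ?thesis unfolding eq by (rule td[OF _ that])
    next
      case False then have "{v \<in> U - Y i. part v = q} = {}" by auto
      then show ?thesis by (simp only: td_le_empty)
    qed
  qed (use edge in auto)
  moreover have "real (card {i. i < n \<and> v \<in> Y i}) \<le> \<epsilon> * real n" if "v \<in> U" for v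
    using c[of "part v" v] that by (simp add: Y_def)
  ultimately show ?thesis by (rule fragI[OF n])
qed

text \<open>\<open>r\<close> is removed from every sampled set and made a root instead: it costs one
  unit of depth and no probability.\<close>

lemma frag_delete_vertex:
  assumes "frag E \<epsilon> d (U - {r})" "finite U" "\<epsilon> \<ge> 0"
  shows "frag E \<epsilon> (Suc d) U"
proof -
  obtain n X where n: "n > 0" and t: "\<And>i. i < n \<Longrightarrow> td_le E d (U - {r} - X i)"
    and c: "\<And>v. v \<in> U - {r} \<Longrightarrow> real (card {i. i < n \<and> v \<in> X i}) \<le> \<epsilon> * real n"
    using assms(1) unfolding frag_def by blast
  have "td_le E (Suc d) (U - (X i - {r}))" if "i < n" for i
  proof (rule td_le_Suc[where r = r])
    have "U - (X i - {r}) - {r} = U - {r} - X i" by auto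
    then show "td_le E d (U - (X i - {r}) - {r})" using t[OF that] by simp
  qed (use assms in auto)
  moreover have "real (card {i. i < n \<and> v \<in> X i - {r}}) \<le> \<epsilon> * real n" if "v \<in> U" for v
    using c[of v] that assms(3) by (cases "v = r") auto
  ultimately show ?thesis by (rule fragI[OF n])
qed

lemma frag_delete_set:
  assumes "finite S" "frag E \<epsilon> d (U - S)" "finite U" "\<epsilon> \<ge> 0"
  shows "frag E \<epsilon> (d + card S) U"
  using assms
proof (induction S arbitrary: U rule: finite_induct)
  case empty then show ?case by simp
next
  case (insert r S)
  have "frag E \<epsilon> (d + card S) (U - {r})"
    by (rule insert.IH) (use insert.prems in \<open>auto simp: Diff_insert2 [symmetric]\<close>)
  then have "frag E \<epsilon> (Suc (d + card S)) U" by (rule frag_delete_vertex) (use insert.prems in auto)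
  then show ?case using insert.hyps by simp
qed

text \<open>A random residue class of levels modulo \<open>l\<close> is deleted. Each vertex is hit
  with probability at most \<open>1 / l\<close>, and since edges change the level by at most one,
  the rest splits into blocks of fewer than \<open>l\<close> consecutive levels.\<close>

lemma frag_layering:
  assumes U: "finite U" and l: "l > 0" and \<epsilon>: "\<epsilon> \<ge> 0"
    and lip: "\<And>u v. u \<in> U \<Longrightarrow> v \<in> U \<Longrightarrow> E u v \<Longrightarrow> lam u \<le> Suc (lam v) \<and> lam v \<le> Suc (lam u)"
    and pieces: "\<And>j. frag E \<epsilon> d {v \<in> U. j \<le> lam v \<and> lam v < j + l}"
  shows "frag E (\<epsilon> + 1 / real l) d U"
proof -
  define bad where "bad = (\<lambda>a v. (lam v + a) mod l = 0)"
  have fr: "frag E \<epsilon> d {v \<in> U. \<not> bad a v}" for a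
  proof (rule frag_parts[where part = "\<lambda>v. (lam v + a) div l"])
    fix q
    \<comment> \<open>The subtraction is truncated: for \<open>q * l < a\<close> the block starts at
      level 0 and is shorter, so it still fits into the window.\<close>
    have "{v \<in> {v \<in> U. \<not> bad a v}. (lam v + a) div l = q} \<subseteq> {v \<in> U. q * l - a \<le> lam v \<and> lam v < (q * l - a) + l}"
    proof (rule subsetI)
      fix v assume v: "v \<in> {v \<in> {v \<in> U. \<not> bad a v}. (lam v + a) div l = q}"
      then have "q * l + (lam v + a) mod l = lam v + a" by (auto simp: div_mult_mod_eq)
      moreover have "(lam v + a) mod l < l" using l by simp
      ultimately have "q * l \<le> lam v + a" "lam v < q * l - a + l" by linarith+
      then show "v \<in> {v \<in> U. q * l - a \<le> lam v \<and> lam v < (q * l - a) + l}" using v by auto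
    qed
    then show "frag E \<epsilon> d {v \<in> {v \<in> U. \<not> bad a v}. (lam v + a) div l = q}"
      by (rule frag_subset[OF pieces]) (use U in auto)
  next
    \<comment> \<open>Consecutive levels lie in different blocks only if the upper one, after the
      shift by \<open>a\<close>, is 0 modulo \<open>l\<close>, that is, bad.\<close>
    have aux: "(x + a) div l = (y + a) div l" if "x \<le> y" "y \<le> Suc x" "(y + a) mod l \<noteq> 0" for x y
    proof (cases "x = y")
      case False
      then have "y + a = Suc (x + a)" using that by simp
      then show ?thesis using that(3) by (metis div_Suc)
    qed simp
    fix u v assume "u \<in> {v \<in> U. \<not> bad a v}" "v \<in> {v \<in> U. \<not> bad a v}" "E u v"
    then have "(lam u + a) mod l \<noteq> 0" "(lam v + a) mod l \<noteq> 0" "lam u \<le> Suc (lam v)" "lam v \<le> Suc (lam u)"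
      using lip[of u v] unfolding bad_def by blast+
    then show "(lam u + a) div l = (lam v + a) div l"
      using aux[of "lam u" "lam v"] aux[of "lam v" "lam u", symmetric] by (metis linear)
  qed (use U in auto)
  from frag_common[OF finite_lessThan[of l], of E \<epsilon> d "\<lambda>a. {v \<in> U. \<not> bad a v}", OF fr]
  obtain n X where n: "n > 0"
    and X: "\<forall>a\<in>{..<l}. (\<forall>i<n. td_le E d ({v \<in> U. \<not> bad a v} - X a i)) \<and>
      (\<forall>v\<in>{v \<in> U. \<not> bad a v}. real (card {i. i < n \<and> v \<in> X a i}) \<le> \<epsilon> * real n)" by blast
  have td: "td_le E d ({v \<in> U. \<not> bad a v} - X a i)" if "a < l" "i < n" for a i using X that by blast
  have c: "real (card {i. i < n \<and> v \<in> X a i}) \<le> \<epsilon> * real n" if "a < l" "v \<in> U" "\<not> bad a v" for a v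
    using bspec[OF X, of a] that by simp
  define Y where "Y = (\<lambda>a i. {v. bad a v} \<union> X a i)"
  have "td_le E d (U - Y (e mod l) (e div l))" if "e < l * n" for e
  proof -
    have "U - Y (e mod l) (e div l) = {v \<in> U. \<not> bad (e mod l) v} - X (e mod l) (e div l)"
      by (auto simp: Y_def)
    moreover have "e mod l < l" "e div l < n" using that l by (auto simp: less_mult_imp_div_less mult.commute)
    ultimately show ?thesis using td by simp
  qed
  moreover have "real (card {e. e < l * n \<and> v \<in> Y (e mod l) (e div l)}) \<le> (\<epsilon> + 1 / real l) * real (l * n)"
    if v: "v \<in> U" for v
  proof -
    \<comment> \<open>Two shifts below \<open>l\<close> that make the same level bad are congruent
      modulo \<open>l\<close>, hence equal. So summing over the shifts costs \<open>n\<close> once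
      and \<open>\<epsilon> * n\<close> for each shift.\<close>
    have one: "card {a. a < l \<and> bad a v} \<le> 1"
    proof -
      have "a = b" if "a < l" "b < l" "bad a v" "bad b v" for a b
      proof -
        have "(int (lam v) + int a) mod int l = (int (lam v) + int b) mod int l"
          using that(3,4) by (simp add: bad_def flip: of_nat_add of_nat_mod)
        then have "int a mod int l = int b mod int l"
          by (metis add_diff_cancel_left' mod_diff_left_eq)
        then show ?thesis using that(1,2) by simp
      qed
      moreover have "finite {a. a < l \<and> bad a v}" by simp
      ultimately show ?thesis unfolding One_nat_def by (subst card_le_Suc0_iff_eq) blast+
    qed
    have "card {e. e < l * n \<and> v \<in> Y (e mod l) (e div l)} = (\<Sum>a<l. card {i. i < n \<and> v \<in> Y a i})"
      by (rule card_filter_mod_div[OF l, where Q = "\<lambda>a i. v \<in> Y a i"])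
    then have "real (card {e. e < l * n \<and> v \<in> Y (e mod l) (e div l)}) = (\<Sum>a<l. real (card {i. i < n \<and> v \<in> Y a i}))"
      by simp
    also have "\<dots> \<le> (\<Sum>a<l. (if bad a v then real n else 0) + \<epsilon> * real n)"
    proof (rule sum_mono)
      fix a assume "a \<in> {..<l}"
      then show "real (card {i. i < n \<and> v \<in> Y a i}) \<le> (if bad a v then real n else 0) + \<epsilon> * real n"
        using c[of a v] v \<epsilon> by (auto simp: Y_def)
    qed
    also have "\<dots> = real (card {a. a < l \<and> bad a v}) * real n + real l * (\<epsilon> * real n)"
      by (simp add: sum.distrib sum.If_cases Int_def)
    also have "\<dots> \<le> 1 * real n + real l * (\<epsilon> * real n)"
      by (intro add_right_mono mult_right_mono) (use one in auto)
    also have "\<dots> = (\<epsilon> + 1 / real l) * real (l * n)" using l by (simp add: field_simps)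
    finally show ?thesis .
  qed
  moreover have "l * n > 0" using l n by simp
  ultimately show ?thesis by (intro fragI[of "l * n" _ _ _ "\<lambda>e. Y (e mod l) (e div l)"]) auto
qed

section \<open>Breadth-first layers and rooted clique models\<close>

lemma connected_setI:
  assumes "r \<in> S" "\<And>x. x \<in> S \<Longrightarrow> (x, r) \<in> (edges_in S E)\<^sup>*" and sym: "symp E"
  shows "connected_set E S"
proof -
  have "sym (edges_in S E)" using sympD[OF sym] by (auto simp: sym_def edges_in_def)
  then have s: "sym ((edges_in S E)\<^sup>*)" by (rule sym_rtrancl)
  have "(x, y) \<in> (edges_in S E)\<^sup>*" if "x \<in> S" "y \<in> S" for x y
    using assms(2)[OF that(1)] assms(2)[OF that(2)] s by (meson rtrancl_trans symD)
  then show ?thesis using assms(1) by (auto simp: connected_set_def)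
qed

lemma edges_in_mono: "S \<subseteq> S' \<Longrightarrow> edges_in S E \<subseteq> edges_in S' E"
  by (auto simp: edges_in_def)

lemma connected_set_reach:
  assumes "connected_set E S" "x \<in> S" "y \<in> S" "S \<subseteq> S'"
  shows "(x, y) \<in> (edges_in S' E)\<^sup>*"
  using assms(1-3) rtrancl_mono[OF edges_in_mono[OF assms(4), of E]] unfolding connected_set_def by blast

lemma connected_set_union_at:
  assumes "\<And>S. S \<in> \<S> \<Longrightarrow> connected_set E S \<and> r \<in> S" "\<S> \<noteq> {}" "symp E"
  shows "connected_set E (\<Union>\<S>)"
proof (rule connected_setI[of r])
  fix x assume "x \<in> \<Union>\<S>"
  then obtain S where "S \<in> \<S>" "x \<in> S" by blast
  then show "(x, r) \<in> (edges_in (\<Union>\<S>) E)\<^sup>*" using assms(1) by (intro connected_set_reach[of E S]) auto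
qed (use assms in auto)

lemma connected_set_insert:
  assumes "connected_set E S" "u \<in> S" "E u v" "symp E"
  shows "connected_set E (insert v S)"
proof (rule connected_setI[of u])
  fix x assume "x \<in> insert v S"
  then show "(x, u) \<in> (edges_in (insert v S) E)\<^sup>*"
  proof
    assume "x = v"
    then have "(x, u) \<in> edges_in (insert v S) E" using assms sympD[OF assms(4)] by (auto simp: edges_in_def)
    then show ?thesis by blast
  next
    assume "x \<in> S" then show ?thesis using assms by (intro connected_set_reach[of E S]) auto
  qed
qed (use assms in auto)

section \<open>Distances from a vertex set\<close>

primrec bfs_ball :: "('a \<Rightarrow> 'a \<Rightarrow> bool) \<Rightarrow> 'a set \<Rightarrow> 'a set \<Rightarrow> nat \<Rightarrow> 'a set" where
  "bfs_ball E U S 0 = S"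
| "bfs_ball E U S (Suc n) = bfs_ball E U S n \<union> {v \<in> U. \<exists>u\<in>bfs_ball E U S n. E u v}"

definition bfs_dist :: "('a \<Rightarrow> 'a \<Rightarrow> bool) \<Rightarrow> 'a set \<Rightarrow> 'a set \<Rightarrow> 'a \<Rightarrow> nat" where
  "bfs_dist E U S v = (LEAST n. v \<in> bfs_ball E U S n)"

lemma bfs_ball_mono: "m \<le> n \<Longrightarrow> bfs_ball E U S m \<subseteq> bfs_ball E U S n"
  by (rule lift_Suc_mono_le[of "bfs_ball E U S"]) auto

lemma bfs_ball_subset: "S \<subseteq> U \<Longrightarrow> bfs_ball E U S n \<subseteq> U"
  by (induction n) auto

lemma bfs_dist_le: "v \<in> bfs_ball E U S n \<Longrightarrow> bfs_dist E U S v \<le> n"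
  unfolding bfs_dist_def by (rule Least_le)

locale bfs =
  fixes E :: "'a \<Rightarrow> 'a \<Rightarrow> bool" and U S :: "'a set"
  assumes sym: "symp E" and conn: "connected_set E U"
    and SU: "S \<subseteq> U" and Sne: "S \<noteq> {}"
begin

lemma ex_ball: assumes "v \<in> U" shows "\<exists>n. v \<in> bfs_ball E U S n"
proof -
  obtain s where s: "s \<in> S" using Sne by blast
  have "(s, v) \<in> (edges_in U E)\<^sup>*" using conn assms s SU by (auto simp: connected_set_def)
  then show ?thesis
  proof (induction rule: rtrancl_induct)
    case base show ?case using s by (intro exI[of _ 0]) simp
  next
    case (step y z)
    then obtain n where "y \<in> bfs_ball E U S n" by blast
    then have "z \<in> bfs_ball E U S (Suc n)" using step(2) by (auto simp: edges_in_def)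
    then show ?case by blast
  qed
qed

lemma mem_ball_iff: "v \<in> U \<Longrightarrow> v \<in> bfs_ball E U S n \<longleftrightarrow> bfs_dist E U S v \<le> n"
proof
  assume "v \<in> U" "bfs_dist E U S v \<le> n"
  moreover have "v \<in> bfs_ball E U S (bfs_dist E U S v)"
    unfolding bfs_dist_def using ex_ball[OF \<open>v \<in> U\<close>] by (rule LeastI_ex)
  ultimately show "v \<in> bfs_ball E U S n" by (blast intro: subsetD[OF bfs_ball_mono])
qed (rule bfs_dist_le)

lemma dist_zero_iff: "v \<in> U \<Longrightarrow> bfs_dist E U S v = 0 \<longleftrightarrow> v \<in> S"
  using mem_ball_iff[of v 0] by simp

lemma dist_source: "v \<in> S \<Longrightarrow> bfs_dist E U S v = 0"
  using dist_zero_iff[of v] SU by auto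

lemma dist_lipschitz: "u \<in> U \<Longrightarrow> v \<in> U \<Longrightarrow> E u v \<Longrightarrow> bfs_dist E U S v \<le> Suc (bfs_dist E U S u)"
  using mem_ball_iff[of u "bfs_dist E U S u"] mem_ball_iff[of v "Suc (bfs_dist E U S u)"] by auto

lemma dist_pred:
  assumes "v \<in> U" "bfs_dist E U S v = Suc n"
  obtains u where "u \<in> U" "E u v" "bfs_dist E U S u = n"
proof -
  have "v \<in> bfs_ball E U S (Suc n)" "v \<notin> bfs_ball E U S n"
    using assms mem_ball_iff[OF assms(1)] by (simp_all del: bfs_ball.simps)
  then obtain u where u: "u \<in> bfs_ball E U S n" "E u v" by auto
  then have "u \<in> U" using bfs_ball_subset[OF SU] by blast
  moreover have "bfs_dist E U S u \<le> n" using u mem_ball_iff \<open>u \<in> U\<close> by blast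
  moreover have "Suc n \<le> Suc (bfs_dist E U S u)" using dist_lipschitz[of u v] \<open>u \<in> U\<close> assms u by auto
  ultimately show ?thesis using that u by auto
qed

lemma connected_ball: assumes "connected_set E S" shows "connected_set E {v \<in> U. bfs_dist E U S v \<le> n}"
proof (induction n)
  case 0
  have "{v \<in> U. bfs_dist E U S v \<le> 0} = S" using dist_zero_iff SU by auto
  then show ?case using assms by simp
next
  case (Suc n)
  let ?B = "\<lambda>n. {v \<in> U. bfs_dist E U S v \<le> n}"
  obtain s where s: "s \<in> S" using Sne by blast
  have sB: "s \<in> ?B n" for n using dist_source[OF s] s SU by auto
  show ?case
  proof (rule connected_setI[OF sB])
    fix x assume x: "x \<in> ?B (Suc n)"
    show "(x, s) \<in> (edges_in (?B (Suc n)) E)\<^sup>*"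
    proof (cases "x \<in> ?B n")
      case True
      then show ?thesis by (intro connected_set_reach[OF Suc True sB]) auto
    next
      case False
      then have "bfs_dist E U S x = Suc n" using x by auto
      then obtain u where u: "u \<in> U" "E u x" "bfs_dist E U S u = n" using dist_pred x by blast
      then have "u \<in> ?B n" by simp
      then have "(u, s) \<in> (edges_in (?B (Suc n)) E)\<^sup>*"
        by (intro connected_set_reach[OF Suc _ sB]) auto
      moreover have "(x, u) \<in> edges_in (?B (Suc n)) E" using u x sympD[OF sym] by (auto simp: edges_in_def)
      ultimately show ?thesis by (rule converse_rtrancl_into_rtrancl[rotated])
    qed
  qed (rule sym)
qed

text \<open>A shortest path is kept only as a connected vertex set with at most one vertex at each
  distance, since what matters later is how few of its vertices a window of layers contains.\<close>

lemma ex_geodesic: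
  assumes "S = {r}" "y \<in> U"
  shows "\<exists>P. P \<subseteq> U \<and> connected_set E P \<and> r \<in> P \<and> y \<in> P \<and> inj_on (bfs_dist E U S) P"
proof -
  have "\<exists>P. P \<subseteq> U \<and> connected_set E P \<and> r \<in> P \<and> y \<in> P \<and> inj_on (bfs_dist E U S) P \<and>
      (\<forall>v\<in>P. bfs_dist E U S v \<le> n)" if "y \<in> U" "bfs_dist E U S y = n" for y n
    using that
  proof (induction n arbitrary: y)
    case 0
    then have "y = r" using dist_zero_iff assms(1) by auto
    moreover have "connected_set E {r}" by (auto simp: connected_set_def)
    ultimately show ?case using 0 by (intro exI[of _ "{r}"]) auto
  next
    case (Suc n)
    obtain u where u: "u \<in> U" "E u y" "bfs_dist E U S u = n" using dist_pred Suc.prems by blast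
    obtain P where P: "P \<subseteq> U" "connected_set E P" "r \<in> P" "u \<in> P" "inj_on (bfs_dist E U S) P"
      "\<forall>v\<in>P. bfs_dist E U S v \<le> n" using Suc.IH[OF u(1,3)] by blast
    have "connected_set E (insert y P)" by (rule connected_set_insert[OF P(2,4) u(2) sym])
    moreover have "inj_on (bfs_dist E U S) (insert y P)"
      using P(5,6) Suc.prems by (auto simp: inj_on_insert)
    ultimately show ?case using P Suc.prems by (intro exI[of _ "insert y P"]) (auto intro: le_SucI)
  qed
  then show ?thesis using assms(2) by blast
qed

end

section \<open>Rooted clique models\<close>

definition clique_model :: "('a \<Rightarrow> 'a \<Rightarrow> bool) \<Rightarrow> nat \<Rightarrow> 'a set \<Rightarrow> 'a set set \<Rightarrow> bool" where
  "clique_model E s U \<N> \<longleftrightarrow> (\<exists>Bs :: nat \<Rightarrow> 'a set.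
     (\<forall>i<s. Bs i \<subseteq> U \<and> connected_set E (Bs i) \<and> (\<forall>N\<in>\<N>. Bs i \<inter> N \<noteq> {})) \<and>
     (\<forall>i<s. \<forall>j<s. i \<noteq> j \<longrightarrow> Bs i \<inter> Bs j = {} \<and> (\<exists>u\<in>Bs i. \<exists>w\<in>Bs j. E u w)))"

lemma clique_model_mono:
  assumes "clique_model E s U \<N>" "U \<subseteq> U'"
  shows "clique_model E s U' \<N>"
proof -
  obtain Bs where "(\<forall>i<s. Bs i \<subseteq> U \<and> connected_set E (Bs i) \<and> (\<forall>N\<in>\<N>. Bs i \<inter> N \<noteq> {})) \<and>
     (\<forall>i<s. \<forall>j<s. i \<noteq> j \<longrightarrow> Bs i \<inter> Bs j = {} \<and> (\<exists>u\<in>Bs i. \<exists>w\<in>Bs j. E u w))"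
    using assms(1) unfolding clique_model_def by blast
  then show ?thesis unfolding clique_model_def using assms(2)
    by (intro exI[of _ Bs]) (simp, blast)
qed

text \<open>\<open>B\<close> is the additional branch set. The old branch sets meet \<open>L\<close>
  inside \<open>Z\<close>, and every vertex there has a neighbour in \<open>B\<close>, which
  provides all the new adjacencies; the roots in \<open>\<N>\<close> are met by \<open>B\<close>
  itself.\<close>

lemma clique_model_Suc:
  assumes "clique_model E s Z (insert L \<N>)" "Z \<subseteq> U" "B \<subseteq> U" "connected_set E B" "Z \<inter> B = {}"
    and N: "\<And>N. N \<in> \<N> \<Longrightarrow> B \<inter> N \<noteq> {}" and L: "\<And>v. v \<in> Z \<inter> L \<Longrightarrow> \<exists>u\<in>B. E u v"
    and sym: "symp E"
  shows "clique_model E (Suc s) U \<N>"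
proof -
  obtain Bs where 12: "(\<forall>i<s. Bs i \<subseteq> Z \<and> connected_set E (Bs i) \<and> (\<forall>N\<in>insert L \<N>. Bs i \<inter> N \<noteq> {})) \<and>
     (\<forall>i<s. \<forall>j<s. i \<noteq> j \<longrightarrow> Bs i \<inter> Bs j = {} \<and> (\<exists>u\<in>Bs i. \<exists>w\<in>Bs j. E u w))"
    using assms(1) unfolding clique_model_def by blast
  have 1: "\<And>i. i < s \<Longrightarrow> Bs i \<subseteq> Z \<and> connected_set E (Bs i) \<and> (\<forall>N\<in>insert L \<N>. Bs i \<inter> N \<noteq> {})"
    and 2: "\<And>i j. i < s \<Longrightarrow> j < s \<Longrightarrow> i \<noteq> j \<Longrightarrow> Bs i \<inter> Bs j = {} \<and> (\<exists>u\<in>Bs i. \<exists>w\<in>Bs j. E u w)"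
    using 12 by simp_all
  have adj: "\<exists>u\<in>B. \<exists>v\<in>Bs i. E u v" if i: "i < s" for i
  proof -
    obtain v where "v \<in> Bs i" "v \<in> L" "v \<in> Z" using 1[OF i] by blast
    then show ?thesis using L[of v] by blast
  qed
  let ?B = "Bs(s := B)"
  have "?B i \<subseteq> U \<and> connected_set E (?B i) \<and> (\<forall>N\<in>\<N>. ?B i \<inter> N \<noteq> {})" if "i < Suc s" for i
    using 1[of i] that assms N by (cases "i = s") auto
  moreover have "?B i \<inter> ?B j = {} \<and> (\<exists>u\<in>?B i. \<exists>w\<in>?B j. E u w)" if ij: "i < Suc s" "j < Suc s" "i \<noteq> j" for i j
  proof -
    consider "i < s" "j < s" | "i = s" "j < s" | "i < s" "j = s" using ij by linarith
    then show ?thesis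
    proof cases
      case c: 1 then show ?thesis using 2[of i j] ij by simp
    next
      case c: 2 then show ?thesis using adj[of j] 1[of j] assms(5) by auto
    next
      case c: 3 
      then have "B \<inter> Bs i = {}" using 1[of i] assms(5) by auto
      moreover have "\<exists>u\<in>Bs i. \<exists>w\<in>B. E u w" using adj[of i] c sympD[OF sym] by blast
      ultimately show ?thesis using c by auto
    qed
  qed
  ultimately show ?thesis unfolding clique_model_def by (intro exI[of _ ?B]) blast
qed

section \<open>Connected components as vertex classes\<close>

lemma component_refl: "v \<in> V \<Longrightarrow> v \<in> component V E v"
  by (simp add: component_def)

lemma component_eq:
  assumes sym: "symp E" and "w \<in> component V E v"
  shows "component V E w = component V E v"
proof -
  have "sym (edges_in V E)" using sympD[OF sym] by (auto simp: sym_def edges_in_def)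
  then have s: "sym ((edges_in V E)\<^sup>*)" by (rule sym_rtrancl)
  have vw: "(v, w) \<in> (edges_in V E)\<^sup>*" using assms(2) by (simp add: component_def)
  then have wv: "(w, v) \<in> (edges_in V E)\<^sup>*" using s by (meson symD)
  show ?thesis unfolding component_def using rtrancl_trans[OF vw] rtrancl_trans[OF wv] by blast
qed

lemma component_edge:
  assumes sym: "symp E" and "u \<in> V" "v \<in> V" "E u v"
  shows "component V E u = component V E v"
proof -
  have "(u, v) \<in> edges_in V E" using assms by (auto simp: edges_in_def)
  then have "v \<in> component V E u" using assms by (auto simp: component_def)
  from component_eq[OF sym this] show ?thesis by simp
qed

lemma component_fiber:
  assumes sym: "symp E" and "r \<in> V"
  shows "{v \<in> V. component V E v = component V E r} = component V E r"
proof -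
  have "v \<in> component V E r" if "v \<in> V" "component V E v = component V E r" for v
    using component_refl[OF that(1), of E] that(2) by simp
  moreover have "component V E v = component V E r" if "v \<in> component V E r" for v
    by (rule component_eq[OF sym that])
  moreover have "component V E r \<subseteq> V" by (auto simp: component_def)
  ultimately show ?thesis by blast
qed

lemma connected_component:
  assumes sym: "symp E" and "r \<in> V"
  shows "connected_set E (component V E r)"
proof -
  let ?C = "component V E r"
  have "(r, x) \<in> (edges_in ?C E)\<^sup>*" if "(r, x) \<in> (edges_in V E)\<^sup>*" for x
    using that
  proof (induction rule: rtrancl_induct)
    case (step y z)
    then have "(r, z) \<in> (edges_in V E)\<^sup>*" by simp
    then have "(y, z) \<in> edges_in ?C E" using step(1,2) by (auto simp: component_def edges_in_def)
    then show ?case using step(3) by simp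
  qed simp
  then have *: "(r, x) \<in> (edges_in ?C E)\<^sup>*" if "x \<in> ?C" for x using that by (simp add: component_def)
  have "sym (edges_in ?C E)" using sympD[OF sym] by (auto simp: sym_def edges_in_def)
  then have s: "sym ((edges_in ?C E)\<^sup>*)" by (rule sym_rtrancl)
  show ?thesis
    by (rule connected_setI[OF component_refl[OF assms(2)]]) (use * s sym in \<open>auto dest: symD\<close>)
qed

text \<open>The claim proved by induction on \<open>s\<close>: \<open>\<epsilon>0\<close> and
  \<open>d0\<close> are what sets missing a root set are already known to cost,
  \<open>\<epsilon>\<close> is the probability that may be spent in addition. The depth
  \<open>d\<close> is uniform in \<open>U\<close> and \<open>\<N>\<close>.\<close>

definition rooted_bound ::
  "('a \<Rightarrow> 'a \<Rightarrow> bool) \<Rightarrow> nat \<Rightarrow> nat \<Rightarrow> real \<Rightarrow> real \<Rightarrow> nat \<Rightarrow> nat \<Rightarrow> bool" where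
  "rooted_bound E s m \<epsilon> \<epsilon>0 d0 d \<longleftrightarrow> (\<forall>U \<N>. finite U \<longrightarrow> finite \<N> \<longrightarrow> card \<N> \<le> m \<longrightarrow>
     \<not> clique_model E s U \<N> \<longrightarrow> (\<forall>C\<subseteq>U. (\<exists>N\<in>\<N>. C \<inter> N = {}) \<longrightarrow> frag E \<epsilon>0 d0 C) \<longrightarrow>
     frag E (\<epsilon>0 + \<epsilon>) d U)"

lemma rooted_boundD:
  assumes "rooted_bound E s m \<epsilon> \<epsilon>0 d0 d" "finite U" "finite \<N>" "card \<N> \<le> m" "\<not> clique_model E s U \<N>"
    "\<And>C N. C \<subseteq> U \<Longrightarrow> N \<in> \<N> \<Longrightarrow> C \<inter> N = {} \<Longrightarrow> frag E \<epsilon>0 d0 C"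
  shows "frag E (\<epsilon>0 + \<epsilon>) d U"
  using assms unfolding rooted_bound_def by blast

text \<open>The ball of radius \<open>i - 1\<close> around \<open>S\<close> is one more branch set for every clique model that is
  rooted in the \<open>i\<close>-th layer; hence the layers can be destroyed one after the other.\<close>

lemma (in bfs) frag_layers:
  assumes U: "finite U" and S: "connected_set E S"
    and \<N>: "finite \<N>" "card \<N> \<le> m" "\<And>N. N \<in> \<N> \<Longrightarrow> S \<inter> N \<noteq> {}"
    and nomodel: "\<not> clique_model E (Suc s) U \<N>"
    and small: "\<And>C N. C \<subseteq> U \<Longrightarrow> N \<in> \<N> \<Longrightarrow> C \<inter> N = {} \<Longrightarrow> frag E \<epsilon>0 d0 C"
    and \<delta>: "\<delta> \<ge> 0"
    and D: "\<And>n. rooted_bound E s (Suc m) \<delta> (\<epsilon>0 + real n * \<delta>) (max d0 (D n)) (D (Suc n))"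
    and "i \<ge> 1" "Z \<subseteq> {v \<in> U. i \<le> bfs_dist E U S v \<and> bfs_dist E U S v < i + n}"
  shows "frag E (\<epsilon>0 + real n * \<delta>) (D n) Z"
  using assms(10,11)
proof (induction n arbitrary: i Z)
  case 0
  then have "Z = {}" by auto
  then show ?case by (simp only: frag_empty)
next
  case (Suc n)
  let ?dist = "bfs_dist E U S"
  let ?L = "{v \<in> U. ?dist v = i}"
  let ?B = "{v \<in> U. ?dist v \<le> i - 1}"
  have "frag E ((\<epsilon>0 + real n * \<delta>) + \<delta>) (D (Suc n)) Z"
  proof (rule rooted_boundD[OF D])
    have "Z \<subseteq> U" using Suc.prems(2) by auto
    then show "finite Z" using U finite_subset by blast
    show "finite (insert ?L \<N>)" using \<N> by simp
    show "card (insert ?L \<N>) \<le> Suc m" using \<N> by (simp add: card_insert_if)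
    show "\<not> clique_model E s Z (insert ?L \<N>)"
    proof
      assume "clique_model E s Z (insert ?L \<N>)"
      then have "clique_model E (Suc s) U \<N>"
      proof (rule clique_model_Suc[where B = ?B])
        show "Z \<subseteq> U" "?B \<subseteq> U" using Suc.prems by auto
        show "connected_set E ?B" by (rule connected_ball[OF S])
        show "Z \<inter> ?B = {}" using Suc.prems by fastforce
        show "?B \<inter> N \<noteq> {}" if "N \<in> \<N>" for N
        proof -
          have "S \<subseteq> ?B" using dist_source SU by auto
          then show ?thesis using \<N>(3)[OF that] by blast
        qed
        show "\<exists>u\<in>?B. E u v" if "v \<in> Z \<inter> ?L" for v
        proof -
          have "v \<in> U" "?dist v = Suc (i - 1)" using that Suc.prems by auto
          then obtain u where "u \<in> U" "E u v" "?dist u = i - 1" by (rule dist_pred)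
          then show ?thesis by auto
        qed
      qed (rule sym)
      then show False using nomodel by simp
    qed
    fix C N assume C: "C \<subseteq> Z" "N \<in> insert ?L \<N>" "C \<inter> N = {}"
    \<comment> \<open>\<open>C\<close> misses an old root set or the new one. In the first case the
      hypothesis applies with depth \<open>d0\<close>; in the second \<open>C\<close> avoids the
      lowest layer of the window and lies in a window of \<open>n\<close> layers, with depth
      \<open>D n\<close>. Hence the maximum.\<close>
    show "frag E (\<epsilon>0 + real n * \<delta>) (max d0 (D n)) C"
    proof (cases "N \<in> \<N>")
      case True
      have "frag E \<epsilon>0 d0 C" by (rule small[OF _ True C(3)]) (use C Suc.prems in auto)
      then show ?thesis by (rule frag_mono) (use \<delta> in auto)
    next
      case False
      then have N: "N = ?L" using C by simp
      have "C \<subseteq> {v \<in> U. Suc i \<le> ?dist v \<and> ?dist v < Suc i + n}"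
      proof
        fix v assume "v \<in> C"
        then have "v \<in> U" "i \<le> ?dist v" "?dist v < i + Suc n" "?dist v \<noteq> i"
          using C Suc.prems N by auto
        then show "v \<in> {v \<in> U. Suc i \<le> ?dist v \<and> ?dist v < Suc i + n}" by simp
      qed
      then have "frag E (\<epsilon>0 + real n * \<delta>) (D n) C" by (intro Suc.IH[of "Suc i"]) auto
      then show ?thesis by (rule frag_mono) auto
    qed
  qed
  then show ?case by (simp add: algebra_simps)
qed

text \<open>The terms of the bound: \<open>1 / real l\<close> for each of the two layerings, around
  \<open>x\<close> and around \<open>S\<close>; \<open>real l * \<delta>\<close> for clearing a
  window of \<open>l\<close> layers around \<open>S\<close> one layer at a time; depth
  \<open>Suc m * l\<close> for the vertices of \<open>S\<close> in a window around \<open>x\<close>,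
  as \<open>S\<close> is a union of at most \<open>Suc m\<close> geodesics. Distances are always
  taken in \<open>U\<close>.\<close>

lemma frag_connected:
  fixes E :: "'a \<Rightarrow> 'a \<Rightarrow> bool"
  assumes sym: "symp E" and U: "finite U" "connected_set E U"
    and \<N>: "finite \<N>" "card \<N> \<le> m"
    and nomodel: "\<not> clique_model E (Suc s) U \<N>"
    and small: "\<And>C N. C \<subseteq> U \<Longrightarrow> N \<in> \<N> \<Longrightarrow> C \<inter> N = {} \<Longrightarrow> frag E \<epsilon>0 d0 C"
    and \<delta>: "\<delta> \<ge> 0" and \<epsilon>0: "\<epsilon>0 \<ge> 0" and l: "l > 0"
    and D: "\<And>n. rooted_bound E s (Suc m) \<delta> (\<epsilon>0 + real n * \<delta>) (max d0 (D n)) (D (Suc n))"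
  shows "frag E (\<epsilon>0 + real l * \<delta> + 1 / real l + 1 / real l) (max d0 (D l + Suc m * l)) U"
proof (cases "\<exists>N\<in>\<N>. U \<inter> N = {}")
  case True
  then have "frag E \<epsilon>0 d0 U" using small by blast
  then show ?thesis by (rule frag_mono) (use \<delta> in auto)
next
  case False
  obtain x where x: "x \<in> U" using U(2) by (auto simp: connected_set_def)
  interpret X: bfs E U "{x}" by unfold_locales (use sym U x in auto)
  let ?dx = "bfs_dist E U {x}"
  have "\<forall>N\<in>\<N>. \<exists>P. P \<subseteq> U \<and> connected_set E P \<and> x \<in> P \<and> P \<inter> N \<noteq> {} \<and> inj_on ?dx P"
  proof
    fix N assume "N \<in> \<N>"
    then obtain y where y: "y \<in> U" "y \<in> N" using False by blast
    from X.ex_geodesic[OF refl y(1)] y(2)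
    show "\<exists>P. P \<subseteq> U \<and> connected_set E P \<and> x \<in> P \<and> P \<inter> N \<noteq> {} \<and> inj_on ?dx P" by blast
  qed
  from bchoice[OF this] obtain P where P:
    "\<forall>N\<in>\<N>. P N \<subseteq> U \<and> connected_set E (P N) \<and> x \<in> P N \<and> P N \<inter> N \<noteq> {} \<and> inj_on ?dx (P N)" ..
  \<comment> \<open>The singleton keeps \<open>S\<close> nonempty when there are no root
    sets.\<close>
  define \<P> where "\<P> = insert {x} (P ` \<N>)"
  define S where "S = \<Union>\<P>"
  have \<P>: "Q \<subseteq> U \<and> connected_set E Q \<and> x \<in> Q \<and> inj_on ?dx Q" if "Q \<in> \<P>" for Q
    using that P x by (auto simp: \<P>_def connected_set_def)
  have S: "connected_set E S" unfolding S_def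
    by (rule connected_set_union_at[of _ _ x]) (use \<P> sym in \<open>auto simp: \<P>_def\<close>)
  have SU: "S \<subseteq> U" using \<P> by (auto simp: S_def)
  have SN: "S \<inter> N \<noteq> {}" if "N \<in> \<N>" for N using P that by (auto simp: S_def \<P>_def)
  interpret Y: bfs E U S by unfold_locales (use sym U S SU in \<open>auto simp: connected_set_def\<close>)
  let ?dS = "bfs_dist E U S"
  have card\<P>: "finite \<P>" "card \<P> \<le> Suc m"
    using \<N> card_image_le[OF \<N>(1), of P] by (auto simp: \<P>_def card_insert_if)
  show ?thesis
  proof (rule frag_mono[OF frag_layering[where lam = ?dx and l = l]])
    fix j
    let ?W = "{v \<in> U. j \<le> ?dx v \<and> ?dx v < j + l}"
    have "card (S \<inter> ?W) \<le> Suc m * l"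
    proof -
      have "card (Q \<inter> ?W) \<le> l" if "Q \<in> \<P>" for Q
      proof -
        have "inj_on ?dx (Q \<inter> ?W)" using \<P>[OF that] by (auto intro: inj_on_subset)
        moreover have "?dx ` (Q \<inter> ?W) \<subseteq> {j..<j + l}" by auto
        ultimately have "card (Q \<inter> ?W) \<le> card {j..<j + l}" by (rule card_inj_on_le) simp
        then show ?thesis by simp
      qed
      then have "(\<Sum>Q\<in>\<P>. card (Q \<inter> ?W)) \<le> card \<P> * l" using sum_bounded_above[of \<P> "\<lambda>Q. card (Q \<inter> ?W)" l] by simp
      moreover have "S \<inter> ?W = (\<Union>Q\<in>\<P>. Q \<inter> ?W)" by (auto simp: S_def)
      moreover have "card (\<Union>Q\<in>\<P>. Q \<inter> ?W) \<le> (\<Sum>Q\<in>\<P>. card (Q \<inter> ?W))" by (rule card_UN_le[OF card\<P>(1)])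
      moreover have "card \<P> * l \<le> Suc m * l" using card\<P>(2) by (rule mult_le_mono1)
      ultimately show ?thesis by (metis (no_types, lifting) le_trans)
    qed
    moreover have "frag E (\<epsilon>0 + real l * \<delta> + 1 / real l) (D l + card (S \<inter> ?W)) ?W"
    proof (rule frag_delete_set)
      show "frag E (\<epsilon>0 + real l * \<delta> + 1 / real l) (D l) (?W - S \<inter> ?W)"
      proof (rule frag_layering[where lam = ?dS])
        fix j'
        show "frag E (\<epsilon>0 + real l * \<delta>) (D l) {v \<in> ?W - S \<inter> ?W. j' \<le> ?dS v \<and> ?dS v < j' + l}"
        proof (rule Y.frag_layers[OF U(1) S \<N> SN nomodel small \<delta> D])
          \<comment> \<open>Distance 0 means membership in \<open>S\<close>, which has been removed,
            so windows may be taken to start at layer 1, where there is a ball strictly below the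
            layer.\<close>
          show "1 \<le> max 1 j'" by simp
          show "{v \<in> ?W - S \<inter> ?W. j' \<le> ?dS v \<and> ?dS v < j' + l}
            \<subseteq> {v \<in> U. max 1 j' \<le> ?dS v \<and> ?dS v < max 1 j' + l}"
          proof
            fix v assume v: "v \<in> {v \<in> ?W - S \<inter> ?W. j' \<le> ?dS v \<and> ?dS v < j' + l}"
            then have "?dS v \<noteq> 0" using Y.dist_zero_iff by auto
            then show "v \<in> {v \<in> U. max 1 j' \<le> ?dS v \<and> ?dS v < max 1 j' + l}" using v by auto
          qed
        qed
      qed (use U l \<epsilon>0 \<delta> Y.dist_lipschitz sympD[OF sym] in auto)
    qed (use U SU finite_subset[OF SU] \<epsilon>0 \<delta> in auto)
    ultimately show "frag E (\<epsilon>0 + real l * \<delta> + 1 / real l) (D l + Suc m * l) ?W"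
      by (elim frag_mono) auto
  qed (use U l \<epsilon>0 \<delta> X.dist_lipschitz sympD[OF sym] in auto)
qed

text \<open>The depth is chosen before the graph; this uniformity is what makes the final bound
  depend on \<open>\<epsilon>\<close> and the Hadwiger number only. The induction adds root sets and
  raises the costs already paid, so \<open>m\<close>, \<open>\<epsilon>\<close>,
  \<open>\<epsilon>0\<close> and \<open>d0\<close> are generalised.\<close>

lemma ex_rooted_bound:
  assumes "\<epsilon> > 0" "\<epsilon>0 \<ge> 0"
  shows "\<exists>d. \<forall>E :: 'a \<Rightarrow> 'a \<Rightarrow> bool. symp E \<longrightarrow> rooted_bound E s m \<epsilon> \<epsilon>0 d0 d"
  using assms
proof (induction s arbitrary: m \<epsilon> \<epsilon>0 d0)
  case 0
  \<comment> \<open>The model with no branch sets always exists, so the claim is vacuous.\<close>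
  have "clique_model E 0 U \<N>" for E :: "'a \<Rightarrow> 'a \<Rightarrow> bool" and U \<N> by (simp add: clique_model_def)
  then show ?case by (simp add: rooted_bound_def)
next
  case (Suc s)
  \<comment> \<open>Two layerings cost at most \<open>\<epsilon> / 4\<close> each, and
    \<open>l\<close> steps of size \<open>\<delta> = \<epsilon> / (2 * l)\<close> cost
    \<open>\<epsilon> / 2\<close>.\<close>
  obtain l :: nat where l: "real l \<ge> 4 / \<epsilon>" using real_arch_simple by blast
  have l0: "l > 0" using l Suc.prems(1) by (metis divide_pos_pos gr0I of_nat_0 not_le zero_less_numeral)
  define \<delta> where "\<delta> = \<epsilon> / (2 * real l)"
  have \<delta>: "\<delta> > 0" using Suc.prems l0 by (simp add: \<delta>_def)
  have "\<exists>d. \<forall>E :: 'a \<Rightarrow> 'a \<Rightarrow> bool. symp E \<longrightarrow>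
      rooted_bound E s (Suc m) \<delta> (\<epsilon>0 + real n * \<delta>) d' d" for n d'
    by (rule Suc.IH) (use \<delta> Suc.prems in auto)
  then obtain F where F: "\<And>n d' (E :: 'a \<Rightarrow> 'a \<Rightarrow> bool). symp E \<Longrightarrow>
      rooted_bound E s (Suc m) \<delta> (\<epsilon>0 + real n * \<delta>) d' (F n d')" by metis
  \<comment> \<open>\<open>D n\<close> is the depth for a window of \<open>n\<close> layers: 0 for
    an empty window, and then the bound for \<open>s\<close>, applied to the larger of
    \<open>d0\<close> and the depth reached so far.\<close>
  define D where "D = rec_nat 0 (\<lambda>n d. F n (max d0 d))"
  have D: "D (Suc n) = F n (max d0 (D n))" for n by (simp add: D_def)
  let ?d = "max d0 (D l + Suc m * l)"
  have eps: "\<epsilon>0 + real l * \<delta> + 1 / real l + 1 / real l \<le> \<epsilon>0 + \<epsilon>"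
  proof -
    have "real l * \<delta> = \<epsilon> / 2" using l0 by (simp add: \<delta>_def)
    moreover have "1 / real l \<le> \<epsilon> / 4" using l l0 Suc.prems(1) by (simp add: field_simps)
    ultimately show ?thesis by linarith
  qed
  have "rooted_bound E (Suc s) m \<epsilon> \<epsilon>0 d0 ?d" if symE: "symp E" for E :: "'a \<Rightarrow> 'a \<Rightarrow> bool"
    unfolding rooted_bound_def
  proof (intro allI impI)
    fix U :: "'a set" and \<N>
    assume U: "finite U" and \<N>: "finite \<N>" "card \<N> \<le> m" and nm: "\<not> clique_model E (Suc s) U \<N>"
      and small: "\<forall>C\<subseteq>U. (\<exists>N\<in>\<N>. C \<inter> N = {}) \<longrightarrow> frag E \<epsilon>0 d0 C"
    have sym: "symp E" using symE .
    show "frag E (\<epsilon>0 + \<epsilon>) ?d U"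
    proof (rule frag_parts[where part = "component U E"])
      fix q
      show "frag E (\<epsilon>0 + \<epsilon>) ?d {v \<in> U. component U E v = q}"
      proof (cases "\<exists>r\<in>U. component U E r = q")
        case False
        then have "{v \<in> U. component U E v = q} = {}" by blast
        then show ?thesis by (simp only: frag_empty)
      next
        case True
        then obtain r where r: "r \<in> U" "q = component U E r" by blast
        have eq: "{v \<in> U. component U E v = q} = component U E r"
          unfolding r(2) by (rule component_fiber[OF sym r(1)])
        have sub: "component U E r \<subseteq> U" by (auto simp: component_def)
        show ?thesis unfolding eq
        proof (rule frag_mono[OF frag_connected[OF sym _ _ \<N>, where l = l and \<delta> = \<delta> and D = D] eps order_refl])
          show "finite (component U E r)" using sub U finite_subset by blast
          show "connected_set E (component U E r)" by (rule connected_component[OF sym r(1)])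
          show "\<not> clique_model E (Suc s) (component U E r) \<N>" using nm clique_model_mono[OF _ sub] by blast
          show "rooted_bound E s (Suc m) \<delta> (\<epsilon>0 + real n * \<delta>) (max d0 (D n)) (D (Suc n))" for n
            unfolding D using F[OF symE] by blast
          show "frag E \<epsilon>0 d0 C" if "C \<subseteq> component U E r" "N \<in> \<N>" "C \<inter> N = {}" for C N
            using small sub that by (meson subset_trans)
        qed (use \<delta> Suc.prems l0 in auto)
      qed
    next
      fix u v assume "u \<in> U" "v \<in> U" "E u v"
      then show "component U E u = component U E v" using component_edge[OF sym] by blast
    qed (rule U)
  qed
  then show ?case by blast
qed

text \<open>The induction is started with no root sets: the hypothesis on sets missing a root set is
  then vacuous, and the excluded model is an ordinary one.\<close>

theorem minor_free_frag:
  assumes "\<epsilon> > 0"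
  shows "\<exists>d. \<forall>(E :: 'a \<Rightarrow> 'a \<Rightarrow> bool) U. symp E \<longrightarrow> finite U \<longrightarrow>
    \<not> clique_model E s U {} \<longrightarrow> frag E \<epsilon> d U"
proof -
  obtain d where d: "\<And>E :: 'a \<Rightarrow> 'a \<Rightarrow> bool. symp E \<Longrightarrow> rooted_bound E s 0 \<epsilon> 0 0 d"
    using ex_rooted_bound[OF assms order_refl, of s 0 0] by blast
  have "frag E \<epsilon> d U" if "symp E" "finite U" "\<not> clique_model E s U {}"
    for E :: "'a \<Rightarrow> 'a \<Rightarrow> bool" and U
    using rooted_boundD[OF d[OF that(1)], of U "{}"] that by simp
  then show ?thesis by blast
qed

section \<open>Treedepth, treewidth and the Hadwiger number\<close>

lemma td_le_card: "finite V \<Longrightarrow> td_le E (card V) V"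
proof (induction rule: finite_induct)
  case empty show ?case by (rule td_le_empty)
next
  case (insert r V)
  have "td_le E (Suc (card V)) (insert r V)"
    by (rule td_le_Suc[where r = r]) (use insert in auto)
  then show ?case using insert by simp
qed

lemma treedepth_le_iff:
  assumes "finite V"
  shows "treedepth V E \<le> k \<longleftrightarrow> td_le E k V"
proof
  assume "treedepth V E \<le> k"
  moreover have "td_le E (treedepth V E) V" unfolding treedepth_eq_Least
    using td_le_card[OF assms] by (rule LeastI)
  ultimately show "td_le E k V" by (rule td_le_mono[rotated])
next
  assume "td_le E k V" then show "treedepth V E \<le> k" unfolding treedepth_eq_Least by (rule Least_le)
qed

lemma connected_set_descent:
  fixes m :: "'a \<Rightarrow> nat"
  assumes "a \<in> A" "\<And>x. x \<in> A \<Longrightarrow> x \<noteq> a \<Longrightarrow> \<exists>y\<in>A. E x y \<and> m y < m x" and sym: "symp E"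
  shows "connected_set E A"
proof (rule connected_setI[OF assms(1) _ sym])
  fix x assume "x \<in> A"
  then show "(x, a) \<in> (edges_in A E)\<^sup>*"
  proof (induction "m x" arbitrary: x rule: less_induct)
    case less
    show ?case
    proof (cases "x = a")
      case False
      then obtain y where y: "y \<in> A" "E x y" "m y < m x" using assms(2) less by blast
      then have "(x, y) \<in> edges_in A E" using less by (auto simp: edges_in_def)
      then show ?thesis using less.hyps[OF y(3,1)] by (rule converse_rtrancl_into_rtrancl)
    qed simp
  qed
qed

text \<open>The bag of a vertex is its down-set. The tree is the forest of covering pairs with an
  added node \<open>r\<close> of empty bag, which joins the roots and also handles an empty
  \<open>V\<close>.\<close>

lemma ex_tree_decomp:
  fixes V :: "nat set"
  assumes "finite V" "td_le E k V"
  shows "\<exists>I F X. tree_decomp V E I F X \<and> (\<forall>i\<in>I. card (X i) \<le> k + 1)"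
proof -
  obtain le where le: "forest_order V E k le" using assms(2) td_le_def by blast
  note ord = forest_orderD[OF le]
  obtain r where r: "r \<notin> V" using assms(1) ex_new_if_finite[of V] infinite_UNIV_nat by blast
  define ht where "ht = (\<lambda>v. card {u. le u v})"
  have finD: "finite {u. le u v}" for v by (rule finite_subset[OF _ assms(1)]) (use ord(1) in auto)
  have ht_less: "ht u < ht v" if "le u v" "u \<noteq> v" for u v
    unfolding ht_def by (rule forest_order_card_less[OF le assms(1) that])
  \<comment> \<open>The strict predecessors of \<open>v\<close> form a chain; its greatest element
    is the parent, and \<open>r\<close> is the parent of the minimal vertices.\<close>
  define pred where "pred = (\<lambda>v. {u. le u v \<and> u \<noteq> v})"
  have "\<exists>p. if pred v = {} then p = r else p \<in> pred v \<and> (\<forall>u\<in>pred v. le u p)" for v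
  proof (cases "pred v = {}")
    case False
    have "finite (pred v)" unfolding pred_def by (rule finite_subset[OF _ finD[of v]]) auto
    then have "Max (ht ` pred v) \<in> ht ` pred v" by (intro Max_in) (use False in auto)
    then obtain p where p1: "p \<in> pred v" "ht p = Max (ht ` pred v)" by auto
    have p: "p \<in> pred v" "\<And>u. u \<in> pred v \<Longrightarrow> ht u \<le> ht p"
      unfolding p1(2) using p1(1) \<open>finite (pred v)\<close> by auto
    have "le u p" if u: "u \<in> pred v" for u
    proof -
      have "le u p \<or> le p u" using ord(6)[of u v p] u p(1) by (auto simp: pred_def)
      moreover have "u = p" if "le p u" using ht_less[OF that] p(2)[OF u] by fastforce
      ultimately show ?thesis by blast
    qed
    then show ?thesis using p(1) False by auto
  qed simp
  then obtain par where par: "\<And>v. if pred v = {} then par v = r else par v \<in> pred v \<and> (\<forall>u\<in>pred v. le u (par v))"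
    by metis
  have par_V: "par v \<in> pred v" if "par v \<in> V" for v using par[of v] that r by (auto split: if_splits)
  have par_cases: "par v = r \<or> par v \<in> pred v" for v using par[of v] by (auto split: if_splits)
  have predV: "pred v \<subseteq> V" for v using ord(1) by (auto simp: pred_def)
  define I where "I = insert r V"
  define F where "F = (\<lambda>i j. (i \<in> V \<and> j = par i) \<or> (j \<in> V \<and> i = par j))"
  define X where "X = (\<lambda>i. {u. le u i})"
  have symF: "symp F" by (auto simp: F_def intro: sympI)
  have par_ne: "par v \<noteq> v" if "v \<in> V" for v using par_cases[of v] r that by (auto simp: pred_def)
  have par_I: "par v \<in> I" for v using par_cases[of v] predV by (auto simp: I_def)
  have "X r = {}" using ord(2) r by (auto simp: X_def)
  \<comment> \<open>Each vertex contributes the edge to its parent, and distinct vertices contribute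
    distinct edges; this gives the edge count that \<open>is_tree\<close> asks for.\<close>
  have inj: "inj_on (\<lambda>v. {v, par v}) V"
  proof (rule inj_onI, rule ccontr)
    fix v w assume vw: "v \<in> V" "w \<in> V" "{v, par v} = {w, par w}" "v \<noteq> w"
    then have "v = par w" "w = par v" by (auto simp: doubleton_eq_iff)
    then have "v \<in> pred w" "w \<in> pred v" using par_V vw by metis+
    then have "le v w" "le w v" by (auto simp: pred_def)
    then show False using ord(4) vw by blast
  qed
  have "{{i, j} |i j. F i j} = (\<lambda>v. {v, par v}) ` V" by (auto simp: F_def)
  then have "card {{i, j} |i j. F i j} = card V" using card_image[OF inj] by simp
  moreover have "card I - 1 = card V" using r assms(1) by (simp add: I_def)
  moreover have "connected_set F I"
  proof (rule connected_set_descent[where a = r and m = "\<lambda>v. if v = r then 0 else Suc (ht v)"])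
    fix x assume x: "x \<in> I" "x \<noteq> r"
    then have "F x (par x)" by (auto simp: F_def I_def)
    moreover have "par x = r \<or> ht (par x) < ht x" using par_cases[of x] ht_less by (auto simp: pred_def)
    ultimately show "\<exists>y\<in>I. F x y \<and> (if y = r then 0 else Suc (ht y)) < (if x = r then 0 else Suc (ht x))"
      using x par_I[of x] by (intro bexI[of _ "par x"]) auto
  qed (use symF in \<open>auto simp: I_def\<close>)
  moreover have "i \<in> I \<and> j \<in> I \<and> i \<noteq> j \<and> F j i" if "F i j" for i j
    using that par_ne[of i] par_ne[of j] par_I[of i] par_I[of j] unfolding F_def I_def by auto
  moreover have "finite I" using assms(1) by (simp add: I_def)
  ultimately have "is_tree I F" unfolding is_tree_def by simp
  moreover have "connected_set F {i \<in> I. v \<in> X i}" if v: "v \<in> V" for v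
  proof (rule connected_set_descent[where a = v and m = ht])
    show "v \<in> {i \<in> I. v \<in> X i}" using ord(3) v by (auto simp: I_def X_def)
    fix x assume x: "x \<in> {i \<in> I. v \<in> X i}" "x \<noteq> v"
    then have vx: "le v x" "x \<in> V" using ord(2) by (auto simp: X_def)
    then have "v \<in> pred x" using x by (auto simp: pred_def)
    then have p: "par x \<in> pred x" "le v (par x)" using par[of x] by (auto split: if_splits)
    then show "\<exists>y\<in>{i \<in> I. v \<in> X i}. F x y \<and> ht y < ht x"
      using vx ht_less[of "par x" x] par_I[of x] by (intro bexI[of _ "par x"]) (auto simp: F_def X_def pred_def)
  qed (rule symF)
  moreover have "X i \<subseteq> V" for i using ord(1) by (auto simp: X_def)
  moreover have "\<exists>i\<in>I. v \<in> X i" if "v \<in> V" for v using ord(3) that by (auto simp: X_def I_def)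
  moreover have "\<exists>i\<in>I. u \<in> X i \<and> v \<in> X i" if "u \<in> V" "v \<in> V" "E u v" for u v
    using ord(3)[of u] ord(3)[of v] ord(7)[of u v] that by (auto simp: X_def I_def)
  ultimately have "tree_decomp V E I F X" unfolding tree_decomp_def by blast
  moreover have "card (X i) \<le> k + 1" if "i \<in> I" for i
    using that \<open>X r = {}\<close> ord(8)[of i] by (auto simp: I_def X_def)
  ultimately show ?thesis by blast
qed

lemma treewidth_le:
  fixes V :: "nat set"
  assumes "finite V" "td_le E k V"
  shows "treewidth V E \<le> k"
  unfolding treewidth_def using ex_tree_decomp[OF assms] by (rule Least_le)

lemma treewidth_witness:
  fixes V :: "nat set"
  assumes "finite V"
  obtains I F X where "tree_decomp V E I F X" "\<And>i. i \<in> I \<Longrightarrow> card (X i) \<le> treewidth V E + 1"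
proof -
  have "\<exists>k I F X. tree_decomp V E I F X \<and> (\<forall>i\<in>I. card (X i) \<le> k + 1)"
    using ex_tree_decomp[OF assms td_le_card[OF assms]] by blast
  then have "\<exists>I F X. tree_decomp V E I F X \<and> (\<forall>i\<in>I. card (X i) \<le> treewidth V E + 1)"
    unfolding treewidth_def by (rule LeastI_ex)
  then show ?thesis using that by blast
qed

text \<open>Trees are given by an edge count instead of acyclicity. A breadth-first search from
  \<open>r\<close> yields one parent edge for each of the other nodes; these are
  \<open>card I - 1\<close> distinct edges, hence all of them.\<close>

lemma tree_parent:
  assumes "is_tree I F"
  shows "\<exists>r par (d :: nat \<Rightarrow> nat). r \<in> I \<and> (\<forall>i\<in>I. i \<noteq> r \<longrightarrow> d i = Suc (d (par i))) \<and>
    (\<forall>i j. F i j \<longrightarrow> (i \<noteq> r \<and> j = par i) \<or> (j \<noteq> r \<and> i = par j))"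
proof -
  have I: "finite I" and F: "\<And>i j. F i j \<Longrightarrow> i \<in> I \<and> j \<in> I \<and> i \<noteq> j \<and> F j i"
    and conn: "connected_set F I" and ce: "card {{i, j} |i j. F i j} = card I - 1"
    using assms unfolding is_tree_def by blast+
  obtain r where r: "r \<in> I" using conn by (auto simp: connected_set_def)
  interpret bfs F I "{r}" by unfold_locales (use F conn r in \<open>auto intro: sympI\<close>)
  define d where "d = bfs_dist F I {r}"
  have "\<exists>p. i \<in> I \<and> i \<noteq> r \<longrightarrow> F p i \<and> d i = Suc (d p)" for i
  proof (cases "i \<in> I \<and> i \<noteq> r")
    case True
    then have "d i \<noteq> 0" using dist_zero_iff[of i] by (auto simp: d_def)
    then obtain n where n: "d i = Suc n" using not0_implies_Suc by blast
    obtain u where "F u i" "d u = n" using dist_pred[of i n] True n unfolding d_def by blast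
    then show ?thesis using n by auto
  qed auto
  then obtain par where par: "\<And>i. i \<in> I \<Longrightarrow> i \<noteq> r \<Longrightarrow> F (par i) i \<and> d i = Suc (d (par i))" by metis
  have inj: "inj_on (\<lambda>i. {i, par i}) (I - {r})"
  proof (rule inj_onI, rule ccontr)
    fix v w assume vw: "v \<in> I - {r}" "w \<in> I - {r}" "{v, par v} = {w, par w}" "v \<noteq> w"
    then have "v = par w" "w = par v" by (auto simp: doubleton_eq_iff)
    then show False using par[of v] par[of w] vw by simp
  qed
  have sub: "(\<lambda>i. {i, par i}) ` (I - {r}) \<subseteq> {{i, j} |i j. F i j}"
  proof
    fix e assume "e \<in> (\<lambda>i. {i, par i}) ` (I - {r})"
    then obtain i where "i \<in> I - {r}" "e = {i, par i}" by blast
    then show "e \<in> {{i, j} |i j. F i j}" using par[of i] F by blast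
  qed
  have "{{i, j} |i j. F i j} \<subseteq> Pow I" using F by blast
  then have fin: "finite {{i, j} |i j. F i j}" by (rule finite_subset) (simp add: I)
  have ceq: "card ((\<lambda>i. {i, par i}) ` (I - {r})) = card {{i, j} |i j. F i j}"
    using card_image[OF inj] ce r I by simp
  have eq: "(\<lambda>i. {i, par i}) ` (I - {r}) = {{i, j} |i j. F i j}"
    by (rule card_subset_eq[OF fin sub ceq])
  have "(i \<noteq> r \<and> j = par i) \<or> (j \<noteq> r \<and> i = par j)" if ij: "F i j" for i j
  proof -
    have "{i, j} \<in> (\<lambda>i. {i, par i}) ` (I - {r})" unfolding eq using ij by blast
    then obtain v where "v \<in> I - {r}" "{i, j} = {v, par v}" by blast
    then show ?thesis by (auto simp: doubleton_eq_iff)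
  qed
  then show ?thesis using r par by (intro exI[of _ r] exI[of _ par] exI[of _ d]) auto
qed

text \<open>The Helly property of subtrees. Among the top nodes of the subtrees a deepest one,
  \<open>t\<close>, is common to all: another subtree meets the part below \<open>t\<close> and has
  its own top no deeper than \<open>t\<close>, so on the way there it has to pass through
  \<open>t\<close>.\<close>

lemma tree_helly:
  fixes k :: nat
  assumes tree: "is_tree I F" and k: "k > 0"
    and T: "\<And>i. i < k \<Longrightarrow> T i \<subseteq> I \<and> connected_set F (T i)"
    and meet: "\<And>i j. i < k \<Longrightarrow> j < k \<Longrightarrow> T i \<inter> T j \<noteq> {}"
  shows "\<exists>t. \<forall>i<k. t \<in> T i"
proof -
  obtain r par and d :: "nat \<Rightarrow> nat" where rpd: "r \<in> I \<and> (\<forall>i\<in>I. i \<noteq> r \<longrightarrow> d i = Suc (d (par i))) \<and>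
    (\<forall>i j. F i j \<longrightarrow> (i \<noteq> r \<and> j = par i) \<or> (j \<noteq> r \<and> i = par j))"
    using tree_parent[OF tree] by (elim exE)
  have par: "d i = Suc (d (par i))" if "i \<in> I" "i \<noteq> r" for i using rpd that by blast
  have edge: "(i \<noteq> r \<and> j = par i) \<or> (j \<noteq> r \<and> i = par j)" if "F i j" for i j using rpd that by blast
  have fin: "finite I" using tree by (simp add: is_tree_def)
  define \<mu> where "\<mu> = (\<lambda>i. Min (d ` T i))"
  have finT: "finite (T i)" "T i \<noteq> {}" if "i < k" for i
    using T[OF that] fin finite_subset by (auto simp: connected_set_def)
  have "Max (\<mu> ` {..<k}) \<in> \<mu> ` {..<k}" by (rule Max_in) (use k in auto)
  then obtain m where m: "m < k" "\<mu> m = Max (\<mu> ` {..<k})" by auto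
  have mx: "\<mu> i \<le> \<mu> m" if "i < k" for i unfolding m(2) by (rule Max_ge) (use that in auto)
  have "Min (d ` T m) \<in> d ` T m" by (rule Min_in) (use finT[OF m(1)] in auto)
  then obtain t where t: "t \<in> T m" "d t = \<mu> m" by (auto simp: \<mu>_def)
  \<comment> \<open>\<open>A y\<close> says that \<open>y\<close> lies in the subtree hanging from
    \<open>t\<close>: going up from \<open>y\<close> to the depth of \<open>t\<close> ends in
    \<open>t\<close>.\<close>
  define A where "A = (\<lambda>y. d y \<ge> \<mu> m \<and> (par ^^ (d y - \<mu> m)) y = t)"
  \<comment> \<open>This subtree can be left only from \<open>t\<close> to its parent, a move that
    \<open>ok\<close> excludes.\<close>
  have A_step: "A z" if yz: "(y, z) \<in> edges_in (T j) F" and j: "j < k" and A: "A y"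
    and ok: "d y > \<mu> m \<or> d z \<ge> \<mu> m" for y z j
  proof -
    have "y \<in> I" "z \<in> I" "F y z" using yz T[OF j] by (auto simp: edges_in_def)
    consider "y \<noteq> r" "z = par y" | "z \<noteq> r" "y = par z" using edge[OF \<open>F y z\<close>] by blast
    then show ?thesis
    proof cases
      case 1
      then have dy: "d y = Suc (d z)" using par[OF \<open>y \<in> I\<close>] by simp
      then have "d z \<ge> \<mu> m" using ok by auto
      then have "d y - \<mu> m = Suc (d z - \<mu> m)" using dy by simp
      then have "(par ^^ (d z - \<mu> m)) z = t" using A 1 by (simp add: A_def funpow_swap1)
      then show ?thesis using \<open>d z \<ge> \<mu> m\<close> by (simp add: A_def)
    next
      case 2
      then have dz: "d z = Suc (d y)" using par[OF \<open>z \<in> I\<close>] by simp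
      then have "d z - \<mu> m = Suc (d y - \<mu> m)" using A by (simp add: A_def Suc_diff_le)
      then have "(par ^^ (d z - \<mu> m)) z = t" using A 2 by (simp add: A_def funpow_swap1)
      then show ?thesis using dz A by (simp add: A_def)
    qed
  qed
  have dge: "d z \<ge> \<mu> i" if "i < k" "z \<in> T i" for z i
    unfolding \<mu>_def by (rule Min_le) (use finT[OF that(1)] that in auto)
  have all_A: "A z" if "z \<in> T m" for z
  proof -
    have "(t, z) \<in> (edges_in (T m) F)\<^sup>*" using T[OF m(1)] t that by (auto simp: connected_set_def)
    then show ?thesis
    proof (induction rule: rtrancl_induct)
      case base show ?case using t by (simp add: A_def)
    next
      case (step y z)
      have "z \<in> T m" using step(2) by (auto simp: edges_in_def)
      then show ?case using A_step[OF step(2) m(1) step(3)] dge[OF m(1)] by blast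
    qed
  qed
  have "t \<in> T j" if j: "j < k" for j
  proof (rule ccontr)
    assume nt: "t \<notin> T j"
    obtain z where z: "z \<in> T m" "z \<in> T j" using meet[OF m(1) j] by blast
    have "Min (d ` T j) \<in> d ` T j" by (rule Min_in) (use finT[OF j] in auto)
    then obtain x where x: "x \<in> T j" "d x = \<mu> j" by (auto simp: \<mu>_def)
    have "(z, x) \<in> (edges_in (T j) F)\<^sup>*" using T[OF j] z x by (auto simp: connected_set_def)
    then have "A x"
    proof (induction rule: rtrancl_induct)
      case base show ?case by (rule all_A[OF z(1)])
    next
      case (step y z)
      have "y \<in> T j" using step(2) by (auto simp: edges_in_def)
      then have "d y \<noteq> \<mu> m" using step(3) nt by (auto simp: A_def)
      then have "d y > \<mu> m" using step(3) by (simp add: A_def)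
      then show ?case using A_step[OF step(2) j step(3)] by blast
    qed
    then have "x = t" using x mx[OF j] by (simp add: A_def)
    then show False using x nt by blast
  qed
  then show ?thesis by blast
qed

section \<open>Hadwiger number and treewidth\<close>

lemma hadwiger_eq_Greatest: "hadwiger V E = (GREATEST k. clique_model E k V {})"
  unfolding hadwiger_def clique_model_def by simp

text \<open>The bags meeting a branch set form a subtree, and the subtrees of adjacent branch sets
  share a node. By the Helly property one bag meets all \<open>k\<close> disjoint branch sets. The
  bound also guarantees that the \<open>GREATEST\<close> in \<open>hadwiger\<close> is
  attained.\<close>

lemma clique_model_le_treewidth:
  fixes V :: "nat set"
  assumes V: "finite V" and model: "clique_model E k V {}"
  shows "k \<le> treewidth V E + 1"
proof (cases "k = 0")
  case False
  obtain I F X where td: "tree_decomp V E I F X" and w: "\<And>i. i \<in> I \<Longrightarrow> card (X i) \<le> treewidth V E + 1"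
    using treewidth_witness[OF V] by blast
  have tree: "is_tree I F" and XV: "\<And>i. i \<in> I \<Longrightarrow> X i \<subseteq> V" and cov: "\<And>v. v \<in> V \<Longrightarrow> \<exists>i\<in>I. v \<in> X i"
    and ed: "\<And>u v. u \<in> V \<Longrightarrow> v \<in> V \<Longrightarrow> E u v \<Longrightarrow> \<exists>i\<in>I. u \<in> X i \<and> v \<in> X i"
    and con: "\<And>v. v \<in> V \<Longrightarrow> connected_set F {i \<in> I. v \<in> X i}"
    using td unfolding tree_decomp_def by blast+
  have symF: "symp F" using tree unfolding is_tree_def by (blast intro: sympI)
  obtain Bs where "(\<forall>i<k. Bs i \<subseteq> V \<and> connected_set E (Bs i)) \<and>
     (\<forall>i<k. \<forall>j<k. i \<noteq> j \<longrightarrow> Bs i \<inter> Bs j = {} \<and> (\<exists>u\<in>Bs i. \<exists>w\<in>Bs j. E u w))"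
    using model unfolding clique_model_def by auto
  then have Bs: "\<And>i. i < k \<Longrightarrow> Bs i \<subseteq> V \<and> connected_set E (Bs i)"
    and dis: "\<And>i j. i < k \<Longrightarrow> j < k \<Longrightarrow> i \<noteq> j \<Longrightarrow> Bs i \<inter> Bs j = {} \<and> (\<exists>u\<in>Bs i. \<exists>w\<in>Bs j. E u w)"
    by simp_all
  define T where "T = (\<lambda>i. {t \<in> I. X t \<inter> Bs i \<noteq> {}})"
  have T: "T i \<subseteq> I \<and> connected_set F (T i)" if i: "i < k" for i
  proof
    show "T i \<subseteq> I" by (auto simp: T_def)
    obtain b where b: "b \<in> Bs i" using Bs[OF i] by (auto simp: connected_set_def)
    then obtain t0 where t0: "t0 \<in> I" "b \<in> X t0" using cov Bs[OF i] by blast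
    have bags: "(s, t) \<in> (edges_in (T i) F)\<^sup>*" if "z \<in> Bs i" "s \<in> I" "t \<in> I" "z \<in> X s" "z \<in> X t" for z s t
      by (rule connected_set_reach[OF con[of z]]) (use that Bs[OF i] in \<open>auto simp: T_def\<close>)
    \<comment> \<open>Induction along a path of the branch set: consecutive vertices share a bag,
      and the bags of each single vertex are connected.\<close>
    have key: "\<forall>t\<in>I. z \<in> X t \<longrightarrow> (t, t0) \<in> (edges_in (T i) F)\<^sup>*" if "(b, z) \<in> (edges_in (Bs i) E)\<^sup>*" for z
      using that
    proof (induction rule: rtrancl_induct)
      case base show ?case using bags[of b] b t0 by blast
    next
      case (step y z)
      then have yz: "y \<in> Bs i" "z \<in> Bs i" "E y z" by (auto simp: edges_in_def)
      then obtain t1 where t1: "t1 \<in> I" "y \<in> X t1" "z \<in> X t1" using ed[of y z] Bs[OF i] by blast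
      then have "(t1, t0) \<in> (edges_in (T i) F)\<^sup>*" using step(3) by blast
      then show ?case using bags[of z _ t1] yz t1 by (meson rtrancl_trans)
    qed
    show "connected_set F (T i)"
    proof (rule connected_setI[of t0])
      show "t0 \<in> T i" using t0 b by (auto simp: T_def)
      fix t assume "t \<in> T i"
      then obtain z where z: "z \<in> Bs i" "t \<in> I" "z \<in> X t" by (auto simp: T_def)
      then have "(b, z) \<in> (edges_in (Bs i) E)\<^sup>*" using Bs[OF i] b by (auto simp: connected_set_def)
      then show "(t, t0) \<in> (edges_in (T i) F)\<^sup>*" using key z by blast
    qed (rule symF)
  qed
  have meet: "T i \<inter> T j \<noteq> {}" if ij: "i < k" "j < k" for i j
  proof (cases "i = j")
    case True then show ?thesis using T[OF ij(1)] by (auto simp: connected_set_def)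
  next
    case False
    then obtain u w where uw: "u \<in> Bs i" "w \<in> Bs j" "E u w" using dis[OF ij] by blast
    then obtain t where "t \<in> I" "u \<in> X t" "w \<in> X t" using ed[of u w] Bs ij by blast
    then have "t \<in> T i \<inter> T j" using uw by (auto simp: T_def)
    then show ?thesis by blast
  qed
  have k0: "k > 0" using False by simp
  have "\<exists>t. \<forall>i<k. t \<in> T i" by (rule tree_helly[OF tree k0 T meet])
  then obtain t where t: "\<And>i. i < k \<Longrightarrow> t \<in> T i" by blast
  have tI: "t \<in> I" using t[of 0] False by (auto simp: T_def)
  have "\<forall>i\<in>{..<k}. \<exists>x. x \<in> X t \<inter> Bs i" using t by (auto simp: T_def)
  then obtain f where f: "\<forall>i\<in>{..<k}. f i \<in> X t \<inter> Bs i" using bchoice by metis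
  have "inj_on f {..<k}"
  proof (rule inj_onI, rule ccontr)
    fix i j assume ij: "i \<in> {..<k}" "j \<in> {..<k}" "f i = f j" "i \<noteq> j"
    then have "f i \<in> Bs i" "f i \<in> Bs j" using bspec[OF f, of i] bspec[OF f, of j] by auto
    then show False using dis[of i j] ij by auto
  qed
  moreover have "f ` {..<k} \<subseteq> X t" using f by auto
  moreover have "finite (X t)" using XV[OF tI] V finite_subset by blast
  ultimately have "card {..<k} \<le> card (X t)" by (rule card_inj_on_le)
  then show ?thesis using w[OF tI] by simp
qed simp

lemma hadwiger_le_treewidth:
  fixes V :: "nat set"
  assumes "finite V"
  shows "hadwiger V E \<le> treewidth V E + 1"
proof -
  have "clique_model E 0 V {}" by (simp add: clique_model_def)
  then have "clique_model E (hadwiger V E) V {}" unfolding hadwiger_eq_Greatest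
    using clique_model_le_treewidth[OF assms] by (rule GreatestI_nat)
  then show ?thesis by (rule clique_model_le_treewidth[OF assms])
qed

lemma no_clique_model:
  fixes V :: "nat set"
  assumes "finite V" "hadwiger V E < k"
  shows "\<not> clique_model E k V {}"
proof
  assume "clique_model E k V {}"
  then have "k \<le> hadwiger V E" unfolding hadwiger_eq_Greatest
    using clique_model_le_treewidth[OF assms(1)] by (rule Greatest_le_nat)
  then show False using assms(2) by simp
qed

lemma gcc_le_gsize: "finite V \<Longrightarrow> V \<noteq> {} \<Longrightarrow> gcc V E \<le> gsize V E"
  unfolding gcc_def gsize_def by (auto simp: component_def intro!: card_mono)

text \<open>A single component needs no more levels than it has vertices, and the components are put
  side by side.\<close>

lemma td_le_gcc:
  assumes V: "finite V" and sym: "symp E"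
  shows "td_le E (gcc V E) V"
proof (rule td_le_parts[where part = "component V E"])
  fix q
  show "td_le E (gcc V E) {v \<in> V. component V E v = q}"
  proof (cases "\<exists>r\<in>V. component V E r = q")
    case False
    then have "{v \<in> V. component V E v = q} = {}" by blast
    then show ?thesis by (simp only: td_le_empty)
  next
    case True
    then obtain r where r: "r \<in> V" "q = component V E r" by blast
    have eq: "{v \<in> V. component V E v = q} = component V E r"
      unfolding r(2) by (rule component_fiber[OF sym r(1)])
    have "finite (component V E r)" using V by (simp add: component_def)
    then have "td_le E (card (component V E r)) (component V E r)" by (rule td_le_card)
    moreover have "card (component V E r) \<le> gcc V E" unfolding gcc_def
      by (rule Max_ge) (use V r in auto)
    ultimately show ?thesis unfolding eq by (rule td_le_mono)
  qed
qed (use component_edge[OF sym] in blast)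

section \<open>The opt-distance\<close>

text \<open>From here on the distance is handled multiplicatively. The two inequalities cover the
  conventions for \<open>ln 0\<close> too: if one side vanishes, so does the other.\<close>

lemma log_gap_le_iff:
  assumes "a \<ge> 0" "b \<ge> 0" "\<epsilon> \<ge> 0"
  shows "log_gap a b \<le> ereal \<epsilon> \<longleftrightarrow> a \<le> exp \<epsilon> * b \<and> b \<le> exp \<epsilon> * a"
proof (cases "a > 0 \<and> b > 0")
  case True
  have "(x \<le> exp \<epsilon> * y) = (ln x - ln y \<le> \<epsilon>)" if "x > 0" "y > 0" for x y :: real
  proof -
    have "(x \<le> exp \<epsilon> * y) = (ln x \<le> ln (exp \<epsilon> * y))" using that by simp
    also have "ln (exp \<epsilon> * y) = \<epsilon> + ln y" using that by (simp add: ln_mult)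
    finally show ?thesis by linarith
  qed
  then show ?thesis using True by (auto simp: log_gap_def ln_ext_def)
next
  case False
  then consider "a = 0" "b = 0" | "a = 0" "b > 0" | "a > 0" "b = 0" using assms by linarith
  then show ?thesis using assms(3) by cases (auto simp: log_gap_def ln_ext_def)
qed

lemma tuples_finite: "finite D \<Longrightarrow> finite (tuples D n)"
  unfolding tuples_def by (rule finite_lists_length_eq)

lemma struc_wfD:
  assumes "struc_wf A"
  shows "finite (univ A)" "univ A \<noteq> {}" "finite (dom (sigma A))" "interp A f x \<ge> 0" "interp A f x \<in> \<rat>"
    "interp A f x \<noteq> 0 \<Longrightarrow> f \<in> dom (sigma A)" "interp A f x \<noteq> 0 \<Longrightarrow> x \<in> tuples (univ A) (the (sigma A f))"
  using assms unfolding struc_wf_def by blast+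

lemma val_cong: "(\<And>a. a \<in> univ A \<Longrightarrow> h a = h' a) \<Longrightarrow> val A C h = val A C h'"
  unfolding val_def by (intro sum.cong refl arg_cong2[of _ _ _ _ "(*)"] arg_cong[of _ _ "interp C _"] map_cong)
    (auto simp: tuples_def)

lemma val_le_opt:
  assumes "struc_wf A" "struc_wf C" "h \<in> univ A \<rightarrow> univ C"
  shows "val A C h \<le> opt A C"
proof -
  have "val A C h = val A C (restrict h (univ A))" by (rule val_cong) simp
  also have "\<dots> \<le> opt A C" unfolding opt_def
  proof (rule Max_ge)
    show "finite (val A C ` (univ A \<rightarrow>\<^sub>E univ C))"
      using struc_wfD(1)[OF assms(1)] struc_wfD(1)[OF assms(2)] by (intro finite_imageI finite_PiE) auto
  qed (use assms(3) in auto)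
  finally show ?thesis .
qed

lemma opt_attained:
  assumes "struc_wf A" "struc_wf C"
  obtains h where "h \<in> univ A \<rightarrow> univ C" "val A C h = opt A C"
proof -
  have "opt A C \<in> val A C ` (univ A \<rightarrow>\<^sub>E univ C)" unfolding opt_def
  proof (rule Max_in)
    show "finite (val A C ` (univ A \<rightarrow>\<^sub>E univ C))"
      using struc_wfD(1)[OF assms(1)] struc_wfD(1)[OF assms(2)] by (intro finite_imageI finite_PiE) auto
    show "val A C ` (univ A \<rightarrow>\<^sub>E univ C) \<noteq> {}" using struc_wfD(2)[OF assms(2)] by (simp add: PiE_eq_empty_iff)
  qed
  then obtain h where "h \<in> univ A \<rightarrow>\<^sub>E univ C" "opt A C = val A C h" by (rule imageE)
  then show ?thesis using that[of h] by auto
qed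

lemma val_nonneg: "struc_wf A \<Longrightarrow> struc_wf C \<Longrightarrow> val A C h \<ge> 0"
  unfolding val_def by (intro sum_nonneg mult_nonneg_nonneg struc_wfD(4))

lemma opt_nonneg: "struc_wf A \<Longrightarrow> struc_wf C \<Longrightarrow> opt A C \<ge> 0"
  using opt_attained[of A C] val_nonneg[of A C] by metis

lemma d_opt_le_iff:
  assumes "struc_wf A" "struc_wf B" "\<epsilon> \<ge> 0"
  shows "d_opt A B \<le> ereal \<epsilon> \<longleftrightarrow> (\<forall>C :: nat struc. struc_wf C \<longrightarrow> sigma C = sigma A \<longrightarrow>
    opt A C \<le> exp \<epsilon> * opt B C \<and> opt B C \<le> exp \<epsilon> * opt A C)"
  unfolding d_opt_def using assms by (auto simp: SUP_le_iff log_gap_le_iff opt_nonneg)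

lemma d_opt_triangle:
  assumes wf: "struc_wf A" "struc_wf B" "struc_wf B'" and s: "sigma B = sigma A"
    and e: "\<epsilon> \<ge> 0" "\<epsilon>' \<ge> 0" and d: "d_opt A B \<le> ereal \<epsilon>" "d_opt B B' \<le> ereal \<epsilon>'"
  shows "d_opt A B' \<le> ereal (\<epsilon> + \<epsilon>')"
proof -
  have "opt A C \<le> exp (\<epsilon> + \<epsilon>') * opt B' C \<and> opt B' C \<le> exp (\<epsilon> + \<epsilon>') * opt A C"
    if C: "struc_wf C" "sigma C = sigma A" for C :: "nat struc"
  proof -
    have 1: "opt A C \<le> exp \<epsilon> * opt B C" "opt B C \<le> exp \<epsilon> * opt A C"
      using d(1) C d_opt_le_iff[OF wf(1,2) e(1)] by auto
    have 2: "opt B C \<le> exp \<epsilon>' * opt B' C" "opt B' C \<le> exp \<epsilon>' * opt B C"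
      using d(2) C s d_opt_le_iff[OF wf(2,3) e(2)] by auto
    have "opt A C \<le> exp \<epsilon> * (exp \<epsilon>' * opt B' C)"
      by (rule order_trans[OF 1(1)]) (use 2 in simp)
    moreover have "opt B' C \<le> exp \<epsilon>' * (exp \<epsilon> * opt A C)"
      by (rule order_trans[OF 2(2)]) (use 1 in simp)
    ultimately show ?thesis by (simp add: exp_add mult_ac)
  qed
  then show ?thesis using d_opt_le_iff[OF wf(1,3)] e by auto
qed

text \<open>Both constructions below only lower the optimum, so that the loss by the factor
  \<open>exp (- \<epsilon>)\<close> is all there is to control.\<close>

lemma d_opt_leI:
  assumes "struc_wf A" "struc_wf B" "\<epsilon> \<ge> 0"
    and "\<And>C :: nat struc. struc_wf C \<Longrightarrow> sigma C = sigma A \<Longrightarrow> opt B C \<le> opt A C \<and> exp (- \<epsilon>) * opt A C \<le> opt B C"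
  shows "d_opt A B \<le> ereal \<epsilon>"
proof -
  have "opt A C \<le> exp \<epsilon> * opt B C \<and> opt B C \<le> exp \<epsilon> * opt A C"
    if C: "struc_wf C" "sigma C = sigma A" for C :: "nat struc"
  proof
    have *: "exp (- \<epsilon>) * opt A C \<le> opt B C" "opt B C \<le> opt A C" using assms(4)[OF C] by auto
    have "opt A C = exp \<epsilon> * (exp (- \<epsilon>) * opt A C)" by (simp add: exp_minus field_simps)
    also have "\<dots> \<le> exp \<epsilon> * opt B C" using * by (intro mult_left_mono) auto
    finally show "opt A C \<le> exp \<epsilon> * opt B C" .
    have "1 * opt A C \<le> exp \<epsilon> * opt A C"
      using assms(3) by (intro mult_right_mono opt_nonneg assms C) auto
    then show "opt B C \<le> exp \<epsilon> * opt A C" using * by linarith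
  qed
  then show ?thesis using d_opt_le_iff[OF assms(1-3)] by blast
qed

section \<open>Approximation of a single structure and pliability of a class\<close>

definition approximable ::
  "(nat set \<Rightarrow> (nat \<Rightarrow> nat \<Rightarrow> bool) \<Rightarrow> nat) \<Rightarrow> nat \<Rightarrow> real \<Rightarrow> 'a struc \<Rightarrow> bool" where
  "approximable p k \<epsilon> A \<longleftrightarrow> (\<exists>B :: nat struc.
      struc_wf B \<and> sigma B = sigma A \<and> p (univ B) (gaif_adj B) \<le> k \<and> d_opt A B \<le> ereal \<epsilon>)"

lemma pliable_iff: "pliable p \<A> \<longleftrightarrow> (\<forall>\<epsilon>>0. \<exists>k. \<forall>A\<in>\<A>. approximable p k \<epsilon> A)"
  unfolding pliable_def approximable_def ..

lemma pliable_mono: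
  assumes "pliable p \<A>" "\<And>B :: nat struc. struc_wf B \<Longrightarrow> q (univ B) (gaif_adj B) \<le> p (univ B) (gaif_adj B) + c"
  shows "pliable q \<A>"
proof -
  have "approximable q (k + c) \<epsilon> A" if ap: "approximable p k \<epsilon> A" for k \<epsilon> and A :: "'a struc"
  proof -
    obtain B :: "nat struc" where B: "struc_wf B" "sigma B = sigma A"
      "p (univ B) (gaif_adj B) \<le> k" "d_opt A B \<le> ereal \<epsilon>" using ap unfolding approximable_def by blast
    have "q (univ B) (gaif_adj B) \<le> k + c" using assms(2)[OF B(1)] B(3) by linarith
    then show ?thesis unfolding approximable_def using B by (intro exI[of _ B]) simp
  qed
  then show ?thesis using assms(1) unfolding pliable_iff by blast
qed

text \<open>Half of \<open>\<epsilon>\<close> goes to each approximation. The intermediate structure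
  keeps the signature of a member of \<open>\<A>\<close>, so that signature bounds are still
  available in the second step.\<close>

lemma pliable_trans:
  assumes wf: "\<forall>A\<in>\<A>. struc_wf A" and p: "pliable p \<A>"
    and step: "\<And>\<epsilon> k. \<epsilon> > 0 \<Longrightarrow> \<exists>k'. \<forall>B :: nat struc. struc_wf B \<and> sigma B \<in> sigma ` \<A> \<and>
      p (univ B) (gaif_adj B) \<le> k \<longrightarrow> approximable q k' \<epsilon> B"
  shows "pliable q \<A>"
  unfolding pliable_iff
proof (intro allI impI)
  fix \<epsilon> :: real assume e: "\<epsilon> > 0"
  then have e2: "\<epsilon> / 2 > 0" by simp
  obtain k where k: "\<forall>A\<in>\<A>. approximable p k (\<epsilon> / 2) A" using p e2 unfolding pliable_iff by blast
  obtain k' where k': "\<forall>B :: nat struc. struc_wf B \<and> sigma B \<in> sigma ` \<A> \<and>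
      p (univ B) (gaif_adj B) \<le> k \<longrightarrow> approximable q k' (\<epsilon> / 2) B" using step[OF e2] by blast
  have "approximable q k' \<epsilon> A" if A: "A \<in> \<A>" for A
  proof -
    obtain B :: "nat struc" where B: "struc_wf B" "sigma B = sigma A"
      "p (univ B) (gaif_adj B) \<le> k" "d_opt A B \<le> ereal (\<epsilon> / 2)"
      using bspec[OF k A] unfolding approximable_def by (elim exE conjE)
    have "sigma B \<in> sigma ` \<A>" using A B(2) by simp
    then have "approximable q k' (\<epsilon> / 2) B" using spec[OF k', of B] B(1,3) by simp
    then obtain B' :: "nat struc" where B': "struc_wf B'" "sigma B' = sigma B"
      "q (univ B') (gaif_adj B') \<le> k'" "d_opt B B' \<le> ereal (\<epsilon> / 2)"
      unfolding approximable_def by (elim exE conjE)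
    have "d_opt A B' \<le> ereal (\<epsilon> / 2 + \<epsilon> / 2)"
      using wf A B B' e by (intro d_opt_triangle[of A B B']) auto
    then show ?thesis unfolding approximable_def using B B' by (intro exI[of _ B']) simp
  qed
  then show "\<exists>k. \<forall>A\<in>\<A>. approximable q k \<epsilon> A" by blast
qed

lemma symp_gaif_adj: "symp (gaif_adj A)"
  by (rule sympI) (auto simp: gaif_adj_def)

lemma td_le_image:
  assumes inj: "inj_on f V" and td: "td_le E k V" and V: "finite V"
    and E: "\<And>u v. u \<in> V \<Longrightarrow> v \<in> V \<Longrightarrow> E' (f u) (f v) \<Longrightarrow> E u v"
  shows "td_le E' k (f ` V)"
proof -
  obtain le where le: "forest_order V E k le" using td td_le_def by blast
  note ord = forest_orderD[OF le]
  define le' where "le' = (\<lambda>a b. \<exists>u v. a = f u \<and> b = f v \<and> le u v)"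
  have le': "le' (f u) (f v) \<longleftrightarrow> le u v" if "u \<in> V" "v \<in> V" for u v
    using that inj ord(1,2) unfolding le'_def by (metis inj_onD)
  have V': "a \<in> f ` V \<and> b \<in> f ` V" if "le' a b" for a b using that ord(1,2) by (auto simp: le'_def)
  have "forest_order (f ` V) E' k le'" unfolding forest_order_def
  proof (intro conjI allI ballI impI)
    fix a b assume "le' a b" then show "a \<in> f ` V" "b \<in> f ` V" using V' by blast+
  next
    fix a assume "a \<in> f ` V" then show "le' a a" using le' ord(3) by blast
  next
    fix a b assume ab: "le' a b \<and> le' b a"
    then obtain u v where "u \<in> V" "v \<in> V" "a = f u" "b = f v" using V' by blast
    then show "a = b" using ab le' ord(4)[of u v] by simp
  next
    fix a b c assume abc: "le' a b \<and> le' b c"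
    then obtain u v w where "u \<in> V" "v \<in> V" "w \<in> V" "a = f u" "b = f v" "c = f w" using V' by blast
    then show "le' a c" using abc le' ord(5)[of u v w] by simp
  next
    fix c a b assume abc: "le' a c \<and> le' b c"
    then obtain u v w where "u \<in> V" "v \<in> V" "w \<in> V" "a = f u" "b = f v" "c = f w" using V' by blast
    then show "le' a b \<or> le' b a" using abc le' ord(6)[of u w v] by simp
  next
    fix a b assume "a \<in> f ` V" "b \<in> f ` V" "E' a b"
    then obtain u v where "u \<in> V" "v \<in> V" "a = f u" "b = f v" by blast
    then show "le' a b \<or> le' b a" using \<open>E' a b\<close> le' ord(7)[of u v] E by simp
  next
    fix a assume "a \<in> f ` V"
    then obtain v where v: "v \<in> V" "a = f v" by blast
    have "{b. le' b a} \<subseteq> f ` {u. le u v}"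
    proof
      fix b assume b: "b \<in> {b. le' b a}"
      then obtain u where "u \<in> V" "b = f u" using V' by blast
      then show "b \<in> f ` {u. le u v}" using b v le' by auto
    qed
    moreover have fin: "finite {u. le u v}" by (rule finite_subset[OF _ V]) (use ord(1) in auto)
    ultimately have "card {b. le' b a} \<le> card {u. le u v}"
      by (meson card_image_le card_mono finite_imageI le_trans)
    then show "card {b. le' b a} \<le> k" using ord(8)[OF v(1)] by linarith
  qed
  then show ?thesis using td_le_def by blast
qed

section \<open>Weighted copies of a structure\<close>

text \<open>Every copy keeps all vertices of \<open>A\<close>, but copy \<open>i\<close> carries
  only the tuples that avoid \<open>X i\<close>, with weight divided by \<open>n\<close>. A nonempty
  tuple belongs to at most one copy; the empty tuple belongs to all of them, and the sum gives it
  back its full weight.\<close>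

definition copies :: "nat \<Rightarrow> (nat \<Rightarrow> nat set) \<Rightarrow> nat struc \<Rightarrow> nat struc" where
  "copies n X A = \<lparr>univ = prod_encode ` ({..<n} \<times> univ A), sigma = sigma A,
     interp = (\<lambda>f y. \<Sum>i<n. if set y \<subseteq> (\<lambda>v. prod_encode (i, v)) ` (univ A - X i)
       then interp A f (map (\<lambda>b. snd (prod_decode b)) y) / real n else 0)\<rparr>"

lemma copies_simps: "univ (copies n X A) = prod_encode ` ({..<n} \<times> univ A)" "sigma (copies n X A) = sigma A"
  "interp (copies n X A) f y = (\<Sum>i<n. if set y \<subseteq> (\<lambda>v. prod_encode (i, v)) ` (univ A - X i)
       then interp A f (map (\<lambda>b. snd (prod_decode b)) y) / real n else 0)"
  by (simp_all add: copies_def)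

lemma interp_copies_pos:
  assumes A: "struc_wf A" and "interp (copies n X A) f y \<noteq> 0"
  obtains i x where "i < n" "y = map (\<lambda>v. prod_encode (i, v)) x" "set x \<subseteq> univ A - X i" "interp A f x > 0"
proof -
  define F where "F = (\<lambda>i. if set y \<subseteq> (\<lambda>v. prod_encode (i, v)) ` (univ A - X i)
       then interp A f (map (\<lambda>b. snd (prod_decode b)) y) / real n else 0)"
  have "sum F {..<n} \<noteq> 0" using assms(2) by (simp add: copies_simps F_def)
  then obtain i where "i \<in> {..<n}" "F i \<noteq> 0" by (rule sum.not_neutral_contains_not_neutral)
  then have i: "i < n" "F i \<noteq> 0" by auto
  let ?x = "map (\<lambda>b. snd (prod_decode b)) y"
  have y: "set y \<subseteq> (\<lambda>v. prod_encode (i, v)) ` (univ A - X i)" and ne: "interp A f ?x \<noteq> 0"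
    using i(2) by (auto simp: F_def split: if_splits)
  have "y = map (\<lambda>v. prod_encode (i, v)) ?x" using y by (induction y) auto
  moreover have "set ?x \<subseteq> univ A - X i" using y by auto
  moreover have "interp A f ?x > 0" using ne struc_wfD(4)[OF A, of f ?x] by simp
  ultimately show ?thesis using that i(1) by blast
qed

lemma copies_wf:
  assumes A: "struc_wf A" and n: "n > 0"
  shows "struc_wf (copies n X A)"
  unfolding struc_wf_def
proof (intro conjI allI impI)
  show "finite (univ (copies n X A))" "univ (copies n X A) \<noteq> {}" "finite (dom (sigma (copies n X A)))"
    using struc_wfD(1-3)[OF A] n by (auto simp: copies_simps)
  fix f y
  show "interp (copies n X A) f y \<ge> 0" unfolding copies_simps
    using struc_wfD(4)[OF A] by (intro sum_nonneg) auto
  show "interp (copies n X A) f y \<in> \<rat>" unfolding copies_simps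
    using struc_wfD(5)[OF A] by (intro Rats_sum) auto
  assume ne: "interp (copies n X A) f y \<noteq> 0"
  obtain i x where *: "i < n" "y = map (\<lambda>v. prod_encode (i, v)) x" "set x \<subseteq> univ A - X i" "interp A f x > 0"
    by (rule interp_copies_pos[OF A ne])
  show "f \<in> dom (sigma (copies n X A))" "y \<in> tuples (univ (copies n X A)) (the (sigma (copies n X A) f))"
    using struc_wfD(6,7)[OF A, of f x] * by (auto simp: copies_simps tuples_def)
qed

lemma gaif_adj_copies:
  assumes A: "struc_wf A" and "gaif_adj (copies n X A) a b"
  obtains i u v where "i < n" "a = prod_encode (i, u)" "b = prod_encode (i, v)"
    "u \<in> univ A - X i" "v \<in> univ A - X i" "gaif_adj A u v"
proof -
  obtain f y where y: "interp (copies n X A) f y > 0" "a \<in> set y" "b \<in> set y" "a \<noteq> b"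
    using assms(2) unfolding gaif_adj_def by blast
  then have ne: "interp (copies n X A) f y \<noteq> 0" by simp
  obtain i x where *: "i < n" "y = map (\<lambda>v. prod_encode (i, v)) x" "set x \<subseteq> univ A - X i" "interp A f x > 0"
    by (rule interp_copies_pos[OF A ne])
  obtain u v where uv: "u \<in> set x" "v \<in> set x" "a = prod_encode (i, u)" "b = prod_encode (i, v)"
    using y * by auto
  have "f \<in> dom (sigma A)" "x \<in> tuples (univ A) (the (sigma A f))" using struc_wfD(6,7)[OF A, of f x] * by auto
  then have "gaif_adj A u v" unfolding gaif_adj_def using uv y(4) *(4) by blast
  then show ?thesis using that[of i u v] uv * by blast
qed

text \<open>Deleted vertices stay in the domain as isolated vertices, hence the 1 in the maximum.
  The label used in the proof separates each of them from the rest of its copy.\<close>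

lemma td_le_copies:
  assumes A: "struc_wf A" and td: "\<And>i. i < n \<Longrightarrow> td_le (gaif_adj A) d (univ A - X i)"
  shows "td_le (gaif_adj (copies n X A)) (max d 1) (univ (copies n X A))"
proof (rule td_le_parts[where part = "\<lambda>b. case prod_decode b of (i, v) \<Rightarrow> (i, if v \<in> X i then Some v else None)"])
  fix q :: "nat \<times> nat option"
  obtain i c where q: "q = (i, c)" by force
  let ?P = "{b \<in> univ (copies n X A). (case prod_decode b of (i, v) \<Rightarrow> (i, if v \<in> X i then Some v else None)) = q}"
  show "td_le (gaif_adj (copies n X A)) (max d 1) ?P"
  proof (cases c)
    case (Some v)
    have sub: "?P \<subseteq> {prod_encode (i, v)}" using Some q by (auto simp: copies_simps split: if_splits)
    have "td_le (gaif_adj (copies n X A)) (card {prod_encode (i, v)}) {prod_encode (i, v)}"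
      by (rule td_le_card) simp
    then have "td_le (gaif_adj (copies n X A)) (card {prod_encode (i, v)}) ?P"
      by (rule td_le_subset[OF _ sub]) simp
    then show ?thesis by (rule td_le_mono) simp
  next
    case None
    show ?thesis
    proof (cases "i < n")
      case False
      then have "?P = {}" using q by (auto simp: copies_simps split: if_splits)
      then show ?thesis by (simp only: td_le_empty)
    next
      case True
      let ?g = "\<lambda>v. prod_encode (i, v)"
      have "td_le (gaif_adj (copies n X A)) d (?g ` (univ A - X i))"
      proof (rule td_le_image[OF _ td[OF True]])
        show "inj_on ?g (univ A - X i)" by (auto simp: inj_on_def)
        show "finite (univ A - X i)" using struc_wfD(1)[OF A] by simp
        fix u v assume "gaif_adj (copies n X A) (?g u) (?g v)"
        then show "gaif_adj A u v" by (rule gaif_adj_copies[OF A]) auto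
      qed
      moreover have "?P = ?g ` (univ A - X i)" using None q True by (auto simp: copies_simps split: if_splits)
      ultimately show ?thesis using td_le_mono[of _ d _ "max d 1"] by simp
    qed
  qed
next
  fix a b assume "gaif_adj (copies n X A) a b"
  then show "(case prod_decode a of (i, v) \<Rightarrow> (i, if v \<in> X i then Some v else None)) =
     (case prod_decode b of (i, v) \<Rightarrow> (i, if v \<in> X i then Some v else None))"
    by (rule gaif_adj_copies[OF A]) auto
qed

lemma val_copies:
  fixes C :: "nat struc"
  assumes A: "struc_wf A" and n: "n > 0"
  shows "val (copies n X A) C h = (\<Sum>i<n. \<Sum>f\<in>dom (sigma A). \<Sum>x\<in>tuples (univ A - X i) (the (sigma A f)).
     interp A f x * interp C f (map (\<lambda>v. h (prod_encode (i, v))) x)) / real n"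
proof -
  let ?g = "\<lambda>i v. prod_encode (i, v)" and ?dec = "\<lambda>b. snd (prod_decode b)" and ?ar = "\<lambda>f. the (sigma A f)"
  let ?U = "univ (copies n X A)"
  have fin: "finite ?U" using struc_wfD(1)[OF copies_wf[OF A n]] .
  have inner: "(\<Sum>y\<in>tuples ?U (?ar f). (if set y \<subseteq> ?g i ` (univ A - X i)
       then interp A f (map ?dec y) / real n else 0) * interp C f (map h y)) =
     (\<Sum>x\<in>tuples (univ A - X i) (?ar f). interp A f x * interp C f (map (\<lambda>v. h (?g i v)) x)) / real n"
    if i: "i < n" for f i
  proof -
    have "(\<Sum>y\<in>tuples ?U (?ar f). (if set y \<subseteq> ?g i ` (univ A - X i)
       then interp A f (map ?dec y) / real n else 0) * interp C f (map h y)) =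
      (\<Sum>y\<in>{y \<in> tuples ?U (?ar f). set y \<subseteq> ?g i ` (univ A - X i)}. interp A f (map ?dec y) / real n * interp C f (map h y))"
      by (rule sum.mono_neutral_cong_right) (use tuples_finite[OF fin] in auto)
    also have "{y \<in> tuples ?U (?ar f). set y \<subseteq> ?g i ` (univ A - X i)} = map (?g i) ` tuples (univ A - X i) (?ar f)"
    proof (intro equalityI subsetI)
      fix y assume y: "y \<in> {y \<in> tuples ?U (?ar f). set y \<subseteq> ?g i ` (univ A - X i)}"
      then have s: "set y \<subseteq> ?g i ` (univ A - X i)" by simp
      then have "y = map (?g i) (map ?dec y)" by (induction y) auto
      moreover have "map ?dec y \<in> tuples (univ A - X i) (?ar f)" using y s by (auto simp: tuples_def)
      ultimately show "y \<in> map (?g i) ` tuples (univ A - X i) (?ar f)" by (rule image_eqI)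
    next
      fix y assume "y \<in> map (?g i) ` tuples (univ A - X i) (?ar f)"
      then obtain x where x: "y = map (?g i) x" "set x \<subseteq> univ A - X i" "length x = ?ar f" by (auto simp: tuples_def)
      then have "set y \<subseteq> ?g i ` (univ A - X i)" by auto
      moreover from this have "set y \<subseteq> ?U" using i by (auto simp: copies_simps)
      ultimately show "y \<in> {y \<in> tuples ?U (?ar f). set y \<subseteq> ?g i ` (univ A - X i)}"
        using x(1,3) by (simp add: tuples_def)
    qed
    also have "(\<Sum>y\<in>map (?g i) ` tuples (univ A - X i) (?ar f). interp A f (map ?dec y) / real n * interp C f (map h y)) =
      (\<Sum>x\<in>tuples (univ A - X i) (?ar f). interp A f x / real n * interp C f (map (\<lambda>v. h (?g i v)) x))"
      by (subst sum.reindex) (auto simp: inj_on_def comp_def intro!: sum.cong inj_mapI dest: inj_mapD)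
    finally show ?thesis by (simp add: sum_divide_distrib)
  qed
  have "val (copies n X A) C h = (\<Sum>f\<in>dom (sigma A). \<Sum>y\<in>tuples ?U (?ar f). \<Sum>i<n.
     (if set y \<subseteq> ?g i ` (univ A - X i) then interp A f (map ?dec y) / real n else 0) * interp C f (map h y))"
    unfolding val_def copies_simps(2,3) by (simp add: sum_distrib_right)
  also have "\<dots> = (\<Sum>f\<in>dom (sigma A). \<Sum>i<n. \<Sum>y\<in>tuples ?U (?ar f).
     (if set y \<subseteq> ?g i ` (univ A - X i) then interp A f (map ?dec y) / real n else 0) * interp C f (map h y))"
    by (intro sum.cong refl sum.swap)
  also have "\<dots> = (\<Sum>f\<in>dom (sigma A). \<Sum>i<n.
     (\<Sum>x\<in>tuples (univ A - X i) (?ar f). interp A f x * interp C f (map (\<lambda>v. h (?g i v)) x)) / real n)"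
    by (intro sum.cong refl inner) simp
  also have "\<dots> = (\<Sum>i<n. \<Sum>f\<in>dom (sigma A).
     (\<Sum>x\<in>tuples (univ A - X i) (?ar f). interp A f x * interp C f (map (\<lambda>v. h (?g i v)) x)) / real n)"
    by (rule sum.swap)
  finally show ?thesis by (simp add: sum_divide_distrib)
qed

text \<open>The value is an average over the copies; on copy \<open>i\<close> the map gives a map of
  \<open>A\<close>, whose value also counts the nonnegative contributions of the deleted
  tuples.\<close>

lemma opt_copies_le:
  fixes C :: "nat struc"
  assumes A: "struc_wf A" and C: "struc_wf C" and n: "n > 0"
  shows "opt (copies n X A) C \<le> opt A C"
proof -
  obtain h where h: "h \<in> univ (copies n X A) \<rightarrow> univ C" "val (copies n X A) C h = opt (copies n X A) C"
    by (rule opt_attained[OF copies_wf[OF A n] C])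
  have "(\<Sum>f\<in>dom (sigma A). \<Sum>x\<in>tuples (univ A - X i) (the (sigma A f)).
     interp A f x * interp C f (map (\<lambda>v. h (prod_encode (i, v))) x)) \<le> opt A C" if i: "i < n" for i
  proof -
    have "(\<Sum>f\<in>dom (sigma A). \<Sum>x\<in>tuples (univ A - X i) (the (sigma A f)).
     interp A f x * interp C f (map (\<lambda>v. h (prod_encode (i, v))) x)) \<le> val A C (\<lambda>v. h (prod_encode (i, v)))"
      unfolding val_def
      by (intro sum_mono sum_mono2 tuples_finite struc_wfD(1)[OF A] mult_nonneg_nonneg struc_wfD(4) A C)
        (auto simp: tuples_def)
    also have "\<dots> \<le> opt A C" by (rule val_le_opt[OF A C]) (use h i in \<open>auto simp: copies_simps\<close>)
    finally show ?thesis .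
  qed
  then have "(\<Sum>i<n. \<Sum>f\<in>dom (sigma A). \<Sum>x\<in>tuples (univ A - X i) (the (sigma A f)).
     interp A f x * interp C f (map (\<lambda>v. h (prod_encode (i, v))) x)) \<le> (\<Sum>i<n. opt A C)"
    by (intro sum_mono) simp
  then have "val (copies n X A) C h \<le> (\<Sum>i<n. opt A C) / real n"
    unfolding val_copies[OF A n] by (rule divide_right_mono) simp
  then show ?thesis using h n by simp
qed

text \<open>An optimal map of \<open>A\<close> is used on every copy. By a union bound over its at
  most \<open>k\<close> distinct entries, a tuple survives in at least
  \<open>(1 - k * \<eta>) * n\<close> of the copies.\<close>

lemma opt_copies_ge:
  fixes C :: "nat struc"
  assumes A: "struc_wf A" and C: "struc_wf C" and n: "n > 0" and \<eta>: "\<eta> \<ge> 0"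
    and X: "\<And>v. v \<in> univ A \<Longrightarrow> real (card {i. i < n \<and> v \<in> X i}) \<le> \<eta> * real n"
    and k: "\<And>f x. interp A f x > 0 \<Longrightarrow> card (set x) \<le> k"
  shows "(1 - real k * \<eta>) * opt A C \<le> opt (copies n X A) C"
proof -
  obtain h where h: "h \<in> univ A \<rightarrow> univ C" "val A C h = opt A C"
    by (rule opt_attained[OF A C])
  define H where "H = (\<lambda>b. h (snd (prod_decode b)))"
  let ?ar = "\<lambda>f. the (sigma A f)"
  let ?t = "\<lambda>f x. interp A f x * interp C f (map h x)"
  have finV: "finite (univ A)" using struc_wfD(1)[OF A] .
  have cnt: "real n * (1 - real k * \<eta>) \<le> real (card {i. i < n \<and> set x \<inter> X i = {}})"
    if x: "interp A f x > 0" for f x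
  proof -
    have sx: "set x \<subseteq> univ A" using struc_wfD(7)[OF A, of f x] x by (auto simp: tuples_def)
    have eq: "{..<n} = {i. i < n \<and> set x \<inter> X i = {}} \<union> (\<Union>v\<in>set x. {i. i < n \<and> v \<in> X i})" by auto
    have "card {..<n} \<le> card {i. i < n \<and> set x \<inter> X i = {}} + card (\<Union>v\<in>set x. {i. i < n \<and> v \<in> X i})"
      unfolding eq by (rule card_Un_le)
    moreover have "card (\<Union>v\<in>set x. {i. i < n \<and> v \<in> X i}) \<le> (\<Sum>v\<in>set x. card {i. i < n \<and> v \<in> X i})"
      by (rule card_UN_le) simp
    ultimately have "n \<le> card {i. i < n \<and> set x \<inter> X i = {}} + (\<Sum>v\<in>set x. card {i. i < n \<and> v \<in> X i})"
      unfolding card_lessThan by linarith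
    then have "real n \<le> real (card {i. i < n \<and> set x \<inter> X i = {}} + (\<Sum>v\<in>set x. card {i. i < n \<and> v \<in> X i}))"
      by (rule of_nat_mono)
    then have "real n \<le> real (card {i. i < n \<and> set x \<inter> X i = {}}) + (\<Sum>v\<in>set x. real (card {i. i < n \<and> v \<in> X i}))"
      by simp
    moreover have "(\<Sum>v\<in>set x. real (card {i. i < n \<and> v \<in> X i})) \<le> real (card (set x)) * (\<eta> * real n)"
      using X sx by (intro sum_bounded_above) auto
    moreover have "real (card (set x)) * (\<eta> * real n) \<le> real k * (\<eta> * real n)"
      using k[OF x] \<eta> by (intro mult_right_mono) auto
    ultimately show ?thesis by (simp add: algebra_simps)
  qed
  have t0: "?t f x \<ge> 0" for f x by (intro mult_nonneg_nonneg struc_wfD(4) A C)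
  have "(1 - real k * \<eta>) * opt A C * real n = (\<Sum>f\<in>dom (sigma A). \<Sum>x\<in>tuples (univ A) (?ar f). real n * (1 - real k * \<eta>) * ?t f x)"
    unfolding h(2)[symmetric] val_def by (simp add: sum_distrib_left mult_ac)
  also have "\<dots> \<le> (\<Sum>f\<in>dom (sigma A). \<Sum>x\<in>tuples (univ A) (?ar f). real (card {i. i < n \<and> set x \<inter> X i = {}}) * ?t f x)"
  proof (intro sum_mono)
    fix f x
    show "real n * (1 - real k * \<eta>) * ?t f x \<le> real (card {i. i < n \<and> set x \<inter> X i = {}}) * ?t f x"
    proof (cases "interp A f x > 0")
      case True then show ?thesis using cnt[OF True] t0[of f x] by (intro mult_right_mono) auto
    next
      case False
      then have "interp A f x = 0" using struc_wfD(4)[OF A, of f x] by simp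
      then show ?thesis by simp
    qed
  qed
  also have "\<dots> = (\<Sum>f\<in>dom (sigma A). \<Sum>x\<in>tuples (univ A) (?ar f). \<Sum>i<n. if set x \<inter> X i = {} then ?t f x else 0)"
  proof (intro sum.cong refl)
    fix f x
    have "(\<Sum>i<n. if set x \<inter> X i = {} then ?t f x else 0) = (\<Sum>i\<in>{i. i < n \<and> set x \<inter> X i = {}}. ?t f x)"
      by (rule sum.mono_neutral_cong_right) auto
    then show "real (card {i. i < n \<and> set x \<inter> X i = {}}) * ?t f x = (\<Sum>i<n. if set x \<inter> X i = {} then ?t f x else 0)"
      by simp
  qed
  also have "\<dots> = (\<Sum>f\<in>dom (sigma A). \<Sum>i<n. \<Sum>x\<in>tuples (univ A) (?ar f). if set x \<inter> X i = {} then ?t f x else 0)"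
    by (intro sum.cong refl sum.swap)
  also have "\<dots> = (\<Sum>i<n. \<Sum>f\<in>dom (sigma A). \<Sum>x\<in>tuples (univ A) (?ar f). if set x \<inter> X i = {} then ?t f x else 0)"
    by (rule sum.swap)
  also have "\<dots> = (\<Sum>i<n. \<Sum>f\<in>dom (sigma A). \<Sum>x\<in>tuples (univ A - X i) (?ar f). ?t f x)"
    by (intro sum.cong refl sum.mono_neutral_cong_right tuples_finite finV) (auto simp: tuples_def)
  also have "\<dots> = val (copies n X A) C H * real n"
    unfolding val_copies[OF A n] H_def using n by (simp add: comp_def)
  finally have "(1 - real k * \<eta>) * opt A C \<le> val (copies n X A) C H" using n by simp
  also have "\<dots> \<le> opt (copies n X A) C"
    by (rule val_le_opt[OF copies_wf[OF A n] C]) (use h in \<open>auto simp: H_def copies_simps\<close>)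
  finally show ?thesis .
qed

lemma clique_model_clique:
  assumes "finite S" "S \<subseteq> V" "\<And>u v. u \<in> S \<Longrightarrow> v \<in> S \<Longrightarrow> u \<noteq> v \<Longrightarrow> E u v"
  shows "clique_model E (card S) V {}"
proof -
  obtain g where "bij_betw g {0..<card S} S" using ex_bij_betw_nat_finite[OF assms(1)] by blast
  then have g: "inj_on g {..<card S}" "\<And>i. i < card S \<Longrightarrow> g i \<in> S"
    by (auto simp: bij_betw_def atLeast0LessThan)
  show ?thesis unfolding clique_model_def
  proof (intro exI[of _ "\<lambda>i. {g i}"] conjI allI impI)
    fix i assume "i < card S"
    then show "{g i} \<subseteq> V" "connected_set E {g i}" "\<forall>N\<in>{}. {g i} \<inter> N \<noteq> {}"
      using g(2) assms(2) by (auto simp: connected_set_def)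
    fix j assume "j < card S" "i \<noteq> j"
    then have "g i \<noteq> g j" using g(1) \<open>i < card S\<close> by (auto dest: inj_onD)
    then show "{g i} \<inter> {g j} = {}" "\<exists>u\<in>{g i}. \<exists>w\<in>{g j}. E u w"
      using g(2) \<open>i < card S\<close> \<open>j < card S\<close> assms(3) by auto
  qed
qed

theorem hadwiger_bounded_td_approx:
  assumes \<epsilon>: "\<epsilon> > 0"
  shows "\<exists>d. \<forall>A :: nat struc. struc_wf A \<and> hadwiger (univ A) (gaif_adj A) \<le> k \<longrightarrow>
    approximable treedepth d \<epsilon> A"
proof -
  \<comment> \<open>Chosen so that \<open>1 - k * \<eta> \<ge> exp (- \<epsilon>)\<close>; the
    successor avoids dividing by zero for \<open>k = 0\<close>.\<close>
  define \<eta> where "\<eta> = (1 - exp (- \<epsilon>)) / real (Suc k)"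
  have "exp (- \<epsilon>) < 1" using \<epsilon> by simp
  then have \<eta>: "\<eta> > 0" by (simp add: \<eta>_def)
  have k\<eta>: "real k * \<eta> \<le> 1 - exp (- \<epsilon>)"
  proof -
    have "real k * \<eta> \<le> real (Suc k) * \<eta>" using \<eta> by (intro mult_right_mono) auto
    then show ?thesis by (simp add: \<eta>_def)
  qed
  obtain d where d: "\<And>(E :: nat \<Rightarrow> nat \<Rightarrow> bool) U. symp E \<Longrightarrow> finite U \<Longrightarrow> \<not> clique_model E (Suc k) U {} \<Longrightarrow> frag E \<eta> d U"
    using minor_free_frag[OF \<eta>, of "Suc k"] by blast
  have "approximable treedepth (max d 1) \<epsilon> A"
    if A: "struc_wf A" and had: "hadwiger (univ A) (gaif_adj A) \<le> k" for A :: "nat struc"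
  proof -
    have V: "finite (univ A)" using struc_wfD(1)[OF A] .
    have "frag (gaif_adj A) \<eta> d (univ A)"
      by (rule d[OF symp_gaif_adj V no_clique_model[OF V]]) (use had in simp)
    then obtain n X where n: "n > 0" and td: "\<And>i. i < n \<Longrightarrow> td_le (gaif_adj A) d (univ A - X i)"
      and X: "\<And>v. v \<in> univ A \<Longrightarrow> real (card {i. i < n \<and> v \<in> X i}) \<le> \<eta> * real n"
      unfolding frag_def by blast
    \<comment> \<open>The entries of a tuple of positive weight are pairwise adjacent, and
      singletons as branch sets turn this clique into a model.\<close>
    have small: "card (set x) \<le> k" if x: "interp A f x > 0" for f x
    proof -
      have fx: "f \<in> dom (sigma A)" "x \<in> tuples (univ A) (the (sigma A f))"
        using struc_wfD(6,7)[OF A, of f x] x by auto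
      have "clique_model (gaif_adj A) (card (set x)) (univ A) {}"
      proof (rule clique_model_clique)
        fix u v assume "u \<in> set x" "v \<in> set x" "u \<noteq> v"
        then show "gaif_adj A u v" unfolding gaif_adj_def using fx x by blast
      qed (use fx in \<open>auto simp: tuples_def\<close>)
      then have "\<not> hadwiger (univ A) (gaif_adj A) < card (set x)" using no_clique_model[OF V] by blast
      then show ?thesis using had by simp
    qed
    have wf: "struc_wf (copies n X A)" by (rule copies_wf[OF A n])
    have "treedepth (univ (copies n X A)) (gaif_adj (copies n X A)) \<le> max d 1"
      by (rule iffD2[OF treedepth_le_iff[OF struc_wfD(1)[OF wf]] td_le_copies[OF A td]])
    moreover have "d_opt A (copies n X A) \<le> ereal \<epsilon>"
    proof (rule d_opt_leI[OF A wf])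
      fix C :: "nat struc" assume C: "struc_wf C" "sigma C = sigma A"
      have "exp (- \<epsilon>) * opt A C \<le> (1 - real k * \<eta>) * opt A C"
        using k\<eta> opt_nonneg[OF A C(1)] by (intro mult_right_mono) auto
      also have "\<dots> \<le> opt (copies n X A) C" using \<eta> by (intro opt_copies_ge[OF A C(1) n _ X small]) auto
      finally show "opt (copies n X A) C \<le> opt A C \<and> exp (- \<epsilon>) * opt A C \<le> opt (copies n X A) C"
        using opt_copies_le[OF A C(1) n] by simp
    qed (use \<epsilon> in simp)
    ultimately show ?thesis unfolding approximable_def
      using wf by (intro exI[of _ "copies n X A"]) (simp add: copies_simps)
  qed
  then show ?thesis by blast
qed

section \<open>Folding structures of bounded treedepth\<close>

definition target :: "nat set \<Rightarrow> (nat \<Rightarrow> nat list \<Rightarrow> real) \<Rightarrow> bool" where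
  "target D g \<longleftrightarrow> finite D \<and> D \<noteq> {} \<and> (\<forall>f y. g f y \<ge> 0)"

definition pattern_max :: "nat set \<Rightarrow> (nat \<Rightarrow> nat list \<Rightarrow> real) \<Rightarrow> nat \<Rightarrow> nat list \<Rightarrow> real" where
  "pattern_max D g f cs = Max {g f (map \<theta> cs) |\<theta>. range \<theta> \<subseteq> D}"

lemma finite_patterns:
  assumes "target D g" shows "finite {g f (map \<theta> cs) |\<theta>. range \<theta> \<subseteq> D}"
proof -
  have "{g f (map \<theta> cs) |\<theta>. range \<theta> \<subseteq> D} \<subseteq> g f ` tuples D (length cs)"
    by (auto simp: tuples_def image_subset_iff)
  then show ?thesis by (rule finite_subset) (use assms in \<open>auto simp: target_def intro: tuples_finite\<close>)
qed

lemma pattern_max_ge: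
  assumes "target D g" "range \<theta> \<subseteq> D" shows "g f (map \<theta> cs) \<le> pattern_max D g f cs"
  unfolding pattern_max_def by (rule Max_ge[OF finite_patterns[OF assms(1)]]) (use assms in auto)

lemma pattern_max_attained:
  assumes "target D g" obtains \<theta> where "range \<theta> \<subseteq> D" "pattern_max D g f cs = g f (map \<theta> cs)"
proof -
  obtain d where "d \<in> D" using assms by (auto simp: target_def)
  then have "g f (map (\<lambda>_. d) cs) \<in> {g f (map \<theta> cs) |\<theta>. range \<theta> \<subseteq> D}" by auto
  then have "pattern_max D g f cs \<in> {g f (map \<theta> cs) |\<theta>. range \<theta> \<subseteq> D}"
    unfolding pattern_max_def by (intro Max_in[OF finite_patterns[OF assms]]) blast
  then show ?thesis using that by auto
qed

lemma pattern_max_nonneg: "target D g \<Longrightarrow> pattern_max D g f cs \<ge> 0"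
  using pattern_max_attained[of D g f cs] by (metis target_def)

text \<open>When the entries have distinct colours, the value of \<open>h\<close> at an entry is a
  function of its colour.\<close>

lemma pattern_max_proper:
  assumes "target D g" "range h \<subseteq> D" "inj_on col (set x)"
  shows "g f (map h x) \<le> pattern_max D g f (map col x)"
proof -
  define \<theta> where "\<theta> = (\<lambda>c. h (the_inv_into (set x) col c))"
  have "map h x = map \<theta> (map col x)" using assms(3) by (auto simp: \<theta>_def the_inv_into_f_f)
  moreover have "range \<theta> \<subseteq> D" using assms(2) by (auto simp: \<theta>_def image_subset_iff)
  ultimately show ?thesis using pattern_max_ge[OF assms(1)] by metis
qed

text \<open>Rounding down to a multiple of \<open>a / M\<close>. For \<open>a = 0\<close> also
  \<open>u = 0\<close>, and all bounds hold because division by zero yields zero.\<close>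

lemma floor_rounding:
  fixes u a :: real and M :: nat
  assumes "0 \<le> u" "u \<le> a" "M > 0"
  defines "n \<equiv> nat \<lfloor>real M * u / a\<rfloor>"
  shows "a * real n / real M \<le> u" "u \<le> a * real n / real M + a / real M" "n \<le> M" "u = 0 \<Longrightarrow> n = 0"
proof -
  have y0: "real M * u / a \<ge> 0" using assms by simp
  have rn: "real n = of_int \<lfloor>real M * u / a\<rfloor>" using y0 by (simp add: n_def)
  have "real n \<le> real M * u / a" "real M * u / a \<le> real n + 1" unfolding rn by linarith+
  then have *: "a > 0 \<Longrightarrow> a * real n \<le> real M * u" "a > 0 \<Longrightarrow> real M * u \<le> a * real n + a"
    by (simp_all add: field_simps)
  show "u = 0 \<Longrightarrow> n = 0" by (simp add: n_def)
  consider "a > 0" | "a = 0" "u = 0" using assms(1,2) by linarith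
  then show "a * real n / real M \<le> u" "u \<le> a * real n / real M + a / real M"
    using * assms(3) by (cases; simp add: field_simps)+
  have "real M * u / a \<le> real M"
  proof (cases "a = 0")
    case False
    then have "u / a \<le> 1" using assms by (simp add: divide_le_eq_1)
    then have "real M * (u / a) \<le> real M * 1" by (intro mult_left_mono) auto
    then show ?thesis by simp
  qed simp
  then have "real n \<le> real M" using \<open>real n \<le> real M * u / a\<close> by linarith
  then show "n \<le> M" by simp
qed

text \<open>The number of lists of length at most \<open>r\<close> over \<open>n\<close>
  letters.\<close>

definition list_bound :: "nat \<Rightarrow> nat \<Rightarrow> nat" where
  "list_bound n r = (\<Sum>i\<le>r. n ^ i)"

text \<open>Colours stand for depths in the elimination forest. Weights live on pairs of symbol and
  tuple, called slots, rather than in structures, so that they can be split and added freely while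
  the vertex set stays fixed.\<close>

locale slots =
  fixes U :: "nat set" and Fs :: "nat set" and ar :: "nat \<Rightarrow> nat" and col :: "nat \<Rightarrow> nat" and m r c :: nat
  assumes U: "finite U" and Fs: "finite Fs" "card Fs \<le> m" and ar: "\<And>f. f \<in> Fs \<Longrightarrow> ar f \<le> r"
    and col: "\<And>v. v \<in> U \<Longrightarrow> col v < c"
begin

section \<open>Weights, their values and their approximation\<close>

definition slot :: "(nat \<times> nat list) set" where "slot = (SIGMA f:Fs. tuples U (ar f))"

definition wval :: "(nat \<Rightarrow> nat list \<Rightarrow> real) \<Rightarrow> (nat \<times> nat list \<Rightarrow> real) \<Rightarrow> (nat \<Rightarrow> nat) \<Rightarrow> real" where
  "wval g w h = (\<Sum>e\<in>slot. w e * g (fst e) (map h (snd e)))"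

text \<open>For weights in the sense below, a majorant of \<open>wval g w h\<close> that does not
  depend on \<open>h\<close>. It is the yardstick for additive errors and, by
  \<open>weight_bound_le\<close>, at most a constant times the optimum.\<close>

definition weight_bound :: "nat set \<Rightarrow> (nat \<Rightarrow> nat list \<Rightarrow> real) \<Rightarrow> (nat \<times> nat list \<Rightarrow> real) \<Rightarrow> real" where
  "weight_bound D g w = (\<Sum>e\<in>slot. w e * pattern_max D g (fst e) (map col (snd e)))"

text \<open>The entries of a tuple will be comparable in the forest, so their depths differ; this is
  where injectivity of \<open>col\<close> comes from.\<close>

definition weights :: "(nat \<times> nat list \<Rightarrow> real) \<Rightarrow> bool" where
  "weights w \<longleftrightarrow> (\<forall>e. w e \<ge> 0 \<and> w e \<in> \<rat> \<and> (w e \<noteq> 0 \<longrightarrow> e \<in> slot \<and> inj_on col (set (snd e))))"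

definition supported :: "(nat \<times> nat list \<Rightarrow> real) \<Rightarrow> nat set \<Rightarrow> nat set \<Rightarrow> bool" where
  "supported w V K \<longleftrightarrow> (\<forall>e. w e \<noteq> 0 \<longrightarrow> set (snd e) \<subseteq> V \<union> K \<and> set (snd e) \<inter> V \<noteq> {})"

text \<open>Agreement on \<open>K\<close> is required so that maps found for different subtrees over
  the same \<open>K\<close> can be glued together.\<close>

definition dominated ::
  "nat set \<Rightarrow> nat set \<Rightarrow> (nat \<Rightarrow> nat list \<Rightarrow> real) \<Rightarrow> real \<Rightarrow> (nat \<times> nat list \<Rightarrow> real) \<Rightarrow> (nat \<times> nat list \<Rightarrow> real) \<Rightarrow> bool" where
  "dominated K D g b w w' \<longleftrightarrow> (\<forall>h. range h \<subseteq> D \<longrightarrow>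
     (\<exists>h'. range h' \<subseteq> D \<and> (\<forall>a\<in>K. h' a = h a) \<and> wval g w h \<le> wval g w' h' + b))"

text \<open>Here \<open>K\<close> is a set of pinned vertices, and the error is measured additively, which makes it
  compatible with disjoint unions; it is compared with the optimum only at the very end.\<close>

definition approx :: "real \<Rightarrow> nat set \<Rightarrow> (nat \<times> nat list \<Rightarrow> real) \<Rightarrow> (nat \<times> nat list \<Rightarrow> real) \<Rightarrow> bool" where
  "approx \<delta> K w w' \<longleftrightarrow> (\<forall>D g. target D g \<longrightarrow> dominated K D g (\<delta> * weight_bound D g w) w w' \<and>
     dominated K D g 0 w' w \<and> weight_bound D g w' \<le> weight_bound D g w)"

lemma finite_slot: "finite slot"
  unfolding slot_def using Fs U by (auto intro: tuples_finite)

lemma weightsD: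
  assumes "weights w"
  shows "w e \<ge> 0" "w e \<in> \<rat>" "w e \<noteq> 0 \<Longrightarrow> e \<in> slot" "w e \<noteq> 0 \<Longrightarrow> inj_on col (set (snd e))"
  using assms unfolding weights_def by blast+

lemma supportedD:
  assumes "supported w V K" "w e \<noteq> 0"
  shows "set (snd e) \<subseteq> V \<union> K" "set (snd e) \<inter> V \<noteq> {}"
  using assms unfolding supported_def by blast+

lemma dominatedI:
  assumes "\<And>h. range h \<subseteq> D \<Longrightarrow> \<exists>h'. range h' \<subseteq> D \<and> (\<forall>a\<in>K. h' a = h a) \<and> wval g w h \<le> wval g w' h' + b"
  shows "dominated K D g b w w'"
  unfolding dominated_def using assms by simp

lemma dominatedD:
  assumes "dominated K D g b w w'" "range h \<subseteq> D"
  shows "\<exists>h'. range h' \<subseteq> D \<and> (\<forall>a\<in>K. h' a = h a) \<and> wval g w h \<le> wval g w' h' + b"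
  using assms unfolding dominated_def by simp

lemma dominated_pointwise:
  assumes "\<And>h. range h \<subseteq> D \<Longrightarrow> wval g w h \<le> wval g w' h + b"
  shows "dominated K D g b w w'"
  by (rule dominatedI) (use assms in blast)

lemma dominated_trans:
  assumes 1: "dominated K D g b w w'" and 2: "dominated K D g b' w' w''"
  shows "dominated K D g (b + b') w w''"
proof (rule dominatedI)
  fix h :: "nat \<Rightarrow> nat" assume "range h \<subseteq> D"
  then obtain h' where h': "range h' \<subseteq> D" "\<forall>a\<in>K. h' a = h a" "wval g w h \<le> wval g w' h' + b"
    using dominatedD[OF 1] by blast
  then obtain h'' where "range h'' \<subseteq> D" "\<forall>a\<in>K. h'' a = h' a" "wval g w' h' \<le> wval g w'' h'' + b'"
    using dominatedD[OF 2] by blast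
  then show "\<exists>h'. range h' \<subseteq> D \<and> (\<forall>a\<in>K. h' a = h a) \<and> wval g w h \<le> wval g w'' h' + (b + b')"
    using h' by (intro exI[of _ h'']) simp
qed

lemma dominated_mono:
  assumes "dominated K' D g b w w'" "K \<subseteq> K'" "b \<le> b'"
  shows "dominated K D g b' w w'"
proof (rule dominatedI)
  fix h :: "nat \<Rightarrow> nat" assume "range h \<subseteq> D"
  then obtain h' where "range h' \<subseteq> D" "\<forall>a\<in>K'. h' a = h a" "wval g w h \<le> wval g w' h' + b"
    using dominatedD[OF assms(1)] by blast
  then show "\<exists>h'. range h' \<subseteq> D \<and> (\<forall>a\<in>K. h' a = h a) \<and> wval g w h \<le> wval g w' h' + b'"
    using assms(2,3) by (intro exI[of _ h']) auto
qed

lemma approxI: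
  assumes "\<And>D g. target D g \<Longrightarrow> dominated K D g (\<delta> * weight_bound D g w) w w'"
    and "\<And>D g. target D g \<Longrightarrow> dominated K D g 0 w' w"
    and "\<And>D g. target D g \<Longrightarrow> weight_bound D g w' \<le> weight_bound D g w"
  shows "approx \<delta> K w w'"
  unfolding approx_def using assms by simp

lemma approxD:
  assumes "approx \<delta> K w w'" "target D g"
  shows "dominated K D g (\<delta> * weight_bound D g w) w w'" "dominated K D g 0 w' w"
    "weight_bound D g w' \<le> weight_bound D g w"
  using assms unfolding approx_def by simp_all

lemma weight_bound_nonneg: "weights w \<Longrightarrow> target D g \<Longrightarrow> weight_bound D g w \<ge> 0"
  unfolding weight_bound_def by (intro sum_nonneg mult_nonneg_nonneg weightsD(1) pattern_max_nonneg)

lemma approx_mono: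
  assumes a: "approx \<delta> K' w w'" and "\<delta> \<le> \<delta>'" "K \<subseteq> K'" "weights w"
  shows "approx \<delta>' K w w'"
proof (rule approxI)
  fix D g assume D: "target D g"
  have "\<delta> * weight_bound D g w \<le> \<delta>' * weight_bound D g w"
    by (rule mult_right_mono[OF assms(2) weight_bound_nonneg[OF assms(4) D]])
  then show "dominated K D g (\<delta>' * weight_bound D g w) w w'"
    by (rule dominated_mono[OF approxD(1)[OF a D] assms(3)])
  show "dominated K D g 0 w' w" by (rule dominated_mono[OF approxD(2)[OF a D] assms(3)]) simp
qed (rule approxD(3)[OF a])

lemma approx_refl: "approx 0 K w w"
  by (rule approxI) (auto intro: dominated_pointwise)

text \<open>The second error is relative to the bound of \<open>w'\<close>, which the last clause of
  \<open>approx\<close> keeps below that of \<open>w\<close>; hence the errors simply add.\<close>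

lemma approx_trans:
  assumes 1: "approx \<delta> K w w'" and 2: "approx \<delta>' K w' w''" and \<delta>': "\<delta>' \<ge> 0"
  shows "approx (\<delta> + \<delta>') K w w''"
proof (rule approxI)
  fix D g assume D: "target D g"
  have "\<delta>' * weight_bound D g w' \<le> \<delta>' * weight_bound D g w"
    by (rule mult_left_mono[OF approxD(3)[OF 1 D] \<delta>'])
  then show "dominated K D g ((\<delta> + \<delta>') * weight_bound D g w) w w''"
    by (intro dominated_mono[OF dominated_trans[OF approxD(1)[OF 1 D] approxD(1)[OF 2 D]]]) (auto simp: distrib_right)
  show "dominated K D g 0 w'' w" using dominated_trans[OF approxD(2)[OF 2 D] approxD(2)[OF 1 D]] by simp
  show "weight_bound D g w'' \<le> weight_bound D g w" using approxD(3)[OF 1 D] approxD(3)[OF 2 D] by linarith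
qed

lemma wval_cong:
  assumes "\<And>e. w e \<noteq> 0 \<Longrightarrow> set (snd e) \<subseteq> S" "\<And>a. a \<in> S \<Longrightarrow> h a = h' a"
  shows "wval g w h = wval g w h'"
  unfolding wval_def
proof (rule sum.cong)
  fix e
  show "w e * g (fst e) (map h (snd e)) = w e * g (fst e) (map h' (snd e))"
  proof (cases "w e = 0")
    case False
    have "h x = h' x" if "x \<in> set (snd e)" for x using assms(1)[OF False] assms(2) that by blast
    then have "map h (snd e) = map h' (snd e)" by simp
    then show ?thesis by (simp only:)
  qed simp
qed simp

lemma wval_sum: "wval g (\<lambda>e. \<Sum>i\<in>I. w i e) h = (\<Sum>i\<in>I. wval g (w i) h)"
  unfolding wval_def by (subst sum.swap) (simp add: sum_distrib_right)

lemma weight_bound_sum: "weight_bound D g (\<lambda>e. \<Sum>i\<in>I. w i e) = (\<Sum>i\<in>I. weight_bound D g (w i))"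
  unfolding weight_bound_def by (subst sum.swap) (simp add: sum_distrib_right)

lemma wval_add: "wval g (\<lambda>e. w e + w' e) h = wval g w h + wval g w' h"
  unfolding wval_def by (simp add: distrib_right sum.distrib)

lemma weight_bound_add: "weight_bound D g (\<lambda>e. w e + w' e) = weight_bound D g w + weight_bound D g w'"
  unfolding weight_bound_def by (simp add: distrib_right sum.distrib)

text \<open>Tuples inside \<open>K\<close> have the same value under \<open>h\<close> and
  \<open>h'\<close>, which agree there.\<close>

lemma dominated_add_pinned:
  assumes d: "dominated K D g b w w'" and w0: "\<And>e. w0 e \<noteq> 0 \<Longrightarrow> set (snd e) \<subseteq> K"
  shows "dominated K D g b (\<lambda>e. w e + w0 e) (\<lambda>e. w' e + w0 e)"
proof (rule dominatedI)
  fix h :: "nat \<Rightarrow> nat" assume "range h \<subseteq> D"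
  then obtain h' where h': "range h' \<subseteq> D" "\<forall>a\<in>K. h' a = h a" "wval g w h \<le> wval g w' h' + b"
    using dominatedD[OF d] by blast
  have "wval g w0 h' = wval g w0 h" by (rule wval_cong[OF w0]) (use h'(2) in auto)
  then show "\<exists>h'. range h' \<subseteq> D \<and> (\<forall>a\<in>K. h' a = h a) \<and>
      wval g (\<lambda>e. w e + w0 e) h \<le> wval g (\<lambda>e. w' e + w0 e) h' + b"
    using h' unfolding wval_add by (intro exI[of _ h']) simp
qed

lemma approx_add_pinned:
  assumes a: "approx \<delta> K w w'" and w0: "weights w0" "\<And>e. w0 e \<noteq> 0 \<Longrightarrow> set (snd e) \<subseteq> K" and \<delta>: "\<delta> \<ge> 0"
  shows "approx \<delta> K (\<lambda>e. w e + w0 e) (\<lambda>e. w' e + w0 e)"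
proof (rule approxI)
  fix D g assume D: "target D g"
  have "\<delta> * weight_bound D g w0 \<ge> 0" using \<delta> weight_bound_nonneg[OF w0(1) D] by simp
  then show "dominated K D g (\<delta> * weight_bound D g (\<lambda>e. w e + w0 e)) (\<lambda>e. w e + w0 e) (\<lambda>e. w' e + w0 e)"
    by (intro dominated_mono[OF dominated_add_pinned[OF approxD(1)[OF a D] w0(2)]])
      (auto simp: weight_bound_add distrib_left)
  show "dominated K D g 0 (\<lambda>e. w' e + w0 e) (\<lambda>e. w e + w0 e)"
    by (rule dominated_add_pinned[OF approxD(2)[OF a D] w0(2)])
  show "weight_bound D g (\<lambda>e. w' e + w0 e) \<le> weight_bound D g (\<lambda>e. w e + w0 e)"
    unfolding weight_bound_add using approxD(3)[OF a D] by simp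
qed

section \<open>Gluing maps over disjoint vertex sets\<close>

definition glue :: "'i set \<Rightarrow> ('i \<Rightarrow> nat set) \<Rightarrow> ('i \<Rightarrow> nat \<Rightarrow> nat) \<Rightarrow> (nat \<Rightarrow> nat) \<Rightarrow> nat \<Rightarrow> nat" where
  "glue I V hs h u = (if \<exists>i\<in>I. u \<in> V i then hs (SOME i. i \<in> I \<and> u \<in> V i) u else h u)"

lemma glue_in:
  assumes "i \<in> I" "u \<in> V i" "\<And>i j. i \<in> I \<Longrightarrow> j \<in> I \<Longrightarrow> i \<noteq> j \<Longrightarrow> V i \<inter> V j = {}"
  shows "glue I V hs h u = hs i u"
proof -
  have "(SOME i. i \<in> I \<and> u \<in> V i) = i" using assms by (intro some_equality) auto
  then show ?thesis using assms unfolding glue_def by auto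
qed

lemma glue_out: "(\<And>i. i \<in> I \<Longrightarrow> u \<notin> V i) \<Longrightarrow> glue I V hs h u = h u"
  unfolding glue_def by auto

lemma glue_range:
  assumes "\<And>i. i \<in> I \<Longrightarrow> range (hs i) \<subseteq> D" "range h \<subseteq> D" shows "range (glue I V hs h) \<subseteq> D"
proof
  fix y assume "y \<in> range (glue I V hs h)"
  then obtain u where y: "y = glue I V hs h u" by blast
  show "y \<in> D"
  proof (cases "\<exists>i\<in>I. u \<in> V i")
    case True
    then have "(SOME i. i \<in> I \<and> u \<in> V i) \<in> I" by (metis (mono_tags, lifting) someI_ex)
    then show ?thesis using assms(1) True unfolding y glue_def by (auto simp: image_subset_iff)
  next
    case False then show ?thesis using assms(2) unfolding y glue_def by (auto simp: image_subset_iff)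
  qed
qed

text \<open>The maps for the single indices agree with \<open>h\<close> on \<open>K\<close> and are
  used on the disjoint sets \<open>V i\<close>, so together they form one map; the losses
  add.\<close>

lemma dominated_sum:
  assumes dis: "\<And>i j. i \<in> I \<Longrightarrow> j \<in> I \<Longrightarrow> i \<noteq> j \<Longrightarrow> V i \<inter> V j = {}" and VK: "\<And>i. i \<in> I \<Longrightarrow> V i \<inter> K = {}"
    and s: "\<And>i. i \<in> I \<Longrightarrow> supported (w' i) (V i) K"
    and d: "\<And>i. i \<in> I \<Longrightarrow> dominated K D g (b i) (w i) (w' i)"
  shows "dominated K D g (\<Sum>i\<in>I. b i) (\<lambda>e. \<Sum>i\<in>I. w i e) (\<lambda>e. \<Sum>i\<in>I. w' i e)"
proof (rule dominatedI)
  fix h :: "nat \<Rightarrow> nat" assume h: "range h \<subseteq> D"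
  have "\<forall>i\<in>I. \<exists>h'. range h' \<subseteq> D \<and> (\<forall>a\<in>K. h' a = h a) \<and> wval g (w i) h \<le> wval g (w' i) h' + b i"
    using dominatedD[OF d h] by blast
  from bchoice[OF this] obtain hs where hs: "\<forall>i\<in>I. range (hs i) \<subseteq> D \<and> (\<forall>a\<in>K. hs i a = h a) \<and>
      wval g (w i) h \<le> wval g (w' i) (hs i) + b i" ..
  let ?h = "glue I V hs h"
  have out: "?h u = h u" if "u \<in> K" for u using VK that by (intro glue_out) blast
  have "wval g (w i) h \<le> wval g (w' i) ?h + b i" if i: "i \<in> I" for i
  proof -
    have "wval g (w' i) ?h = wval g (w' i) (hs i)"
    proof (rule wval_cong[OF supportedD(1)[OF s[OF i]]])
      fix u assume "u \<in> V i \<union> K"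
      then show "?h u = hs i u"
      proof
        assume "u \<in> V i" then show ?thesis by (intro glue_in[OF i _ dis]) auto
      next
        assume "u \<in> K" then show ?thesis using out hs i by simp
      qed
    qed
    then show ?thesis using hs i by simp
  qed
  then have "(\<Sum>i\<in>I. wval g (w i) h) \<le> (\<Sum>i\<in>I. wval g (w' i) ?h + b i)" by (rule sum_mono)
  moreover have "range ?h \<subseteq> D" by (rule glue_range) (use hs h in auto)
  ultimately show "\<exists>h'. range h' \<subseteq> D \<and> (\<forall>a\<in>K. h' a = h a) \<and>
      wval g (\<lambda>e. \<Sum>i\<in>I. w i e) h \<le> wval g (\<lambda>e. \<Sum>i\<in>I. w' i e) h' + (\<Sum>i\<in>I. b i)"
    unfolding wval_sum using out by (intro exI[of _ ?h]) (simp add: sum.distrib)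
qed

lemma approx_sum:
  assumes dis: "\<And>i j. i \<in> I \<Longrightarrow> j \<in> I \<Longrightarrow> i \<noteq> j \<Longrightarrow> V i \<inter> V j = {}" and VK: "\<And>i. i \<in> I \<Longrightarrow> V i \<inter> K = {}"
    and s: "\<And>i. i \<in> I \<Longrightarrow> supported (w i) (V i) K" "\<And>i. i \<in> I \<Longrightarrow> supported (w' i) (V i) K"
    and a: "\<And>i. i \<in> I \<Longrightarrow> approx \<delta> K (w i) (w' i)"
  shows "approx \<delta> K (\<lambda>e. \<Sum>i\<in>I. w i e) (\<lambda>e. \<Sum>i\<in>I. w' i e)"
proof (rule approxI)
  fix D g assume D: "target D g"
  show "dominated K D g (\<delta> * weight_bound D g (\<lambda>e. \<Sum>i\<in>I. w i e)) (\<lambda>e. \<Sum>i\<in>I. w i e) (\<lambda>e. \<Sum>i\<in>I. w' i e)"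
    unfolding weight_bound_sum sum_distrib_left by (rule dominated_sum[OF dis VK s(2) approxD(1)[OF a D]])
  show "dominated K D g 0 (\<lambda>e. \<Sum>i\<in>I. w' i e) (\<lambda>e. \<Sum>i\<in>I. w i e)"
    using dominated_sum[OF dis VK s(1) approxD(2)[OF a D]] by simp
  show "weight_bound D g (\<lambda>e. \<Sum>i\<in>I. w' i e) \<le> weight_bound D g (\<lambda>e. \<Sum>i\<in>I. w i e)"
    unfolding weight_bound_sum by (intro sum_mono approxD(3)[OF a D])
qed

end

lemma (in slots) card_slots_on:
  assumes "finite S" "card S \<le> n"
  shows "finite (SIGMA f:Fs. tuples S (ar f))" "card (SIGMA f:Fs. tuples S (ar f)) \<le> m * list_bound n r"
proof -
  show "finite (SIGMA f:Fs. tuples S (ar f))" using Fs(1) tuples_finite[OF assms(1)] by (rule finite_SigmaI)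
  have "card (tuples S (ar f)) \<le> list_bound n r" if "f \<in> Fs" for f
  proof -
    have "tuples S (ar f) \<subseteq> {xs. set xs \<subseteq> S \<and> length xs \<le> r}" using ar[OF that] by (auto simp: tuples_def)
    then have "card (tuples S (ar f)) \<le> card {xs. set xs \<subseteq> S \<and> length xs \<le> r}"
      by (rule card_mono[OF finite_lists_length_le[OF assms(1)]])
    also have "\<dots> = (\<Sum>i\<le>r. card S ^ i)" by (rule card_lists_length_le[OF assms(1)])
    also have "\<dots> \<le> list_bound n r" unfolding list_bound_def by (intro sum_mono power_mono assms(2)) simp
    finally show ?thesis .
  qed
  then have "(\<Sum>f\<in>Fs. card (tuples S (ar f))) \<le> card Fs * list_bound n r"
    using sum_bounded_above[of Fs "\<lambda>f. card (tuples S (ar f))"] by simp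
  also have "\<dots> \<le> m * list_bound n r" using Fs(2) by (rule mult_le_mono1)
  finally show "card (SIGMA f:Fs. tuples S (ar f)) \<le> m * list_bound n r"
    using Fs(1) tuples_finite[OF assms(1)] by (simp add: card_SigmaI)
qed

text \<open>Sibling subtrees: \<open>V i\<close> is the vertex set left of the \<open>i\<close>-th
  one after its own folding, \<open>K\<close> the path above which all of them hang,
  \<open>w i\<close> the weights of the \<open>i\<close>-th one, \<open>s\<close> a bound on its
  size, and \<open>M\<close> the fineness of the rounding.\<close>

locale family = slots +
  fixes I :: "nat set" and V :: "nat \<Rightarrow> nat set" and K :: "nat set"
    and w :: "nat \<Rightarrow> nat \<times> nat list \<Rightarrow> real" and s M :: nat
  assumes I: "finite I" and V: "\<And>i. i \<in> I \<Longrightarrow> V i \<subseteq> U" "\<And>i. i \<in> I \<Longrightarrow> card (V i) \<le> s"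
    and dis: "\<And>i j. i \<in> I \<Longrightarrow> j \<in> I \<Longrightarrow> i \<noteq> j \<Longrightarrow> V i \<inter> V j = {}"
    and VK: "\<And>i. i \<in> I \<Longrightarrow> V i \<inter> K = {}" and K: "K \<subseteq> U" "card K \<le> c"
    and w: "\<And>i. i \<in> I \<Longrightarrow> weights (w i)" "\<And>i. i \<in> I \<Longrightarrow> supported (w i) (V i) K"
    and M: "M > 0"
begin

definition pt :: "nat \<times> nat list \<Rightarrow> nat \<times> nat list" where "pt e = (fst e, map col (snd e))"
definition total :: "nat \<times> nat list \<Rightarrow> real" where "total e = (\<Sum>i\<in>I. w i e)"
definition W :: "nat \<times> nat list \<Rightarrow> real" where "W p = (\<Sum>e\<in>{e \<in> slot. pt e = p}. total e)"
text \<open>The share of sibling \<open>i\<close> at slot \<open>e\<close> is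
  \<open>w i e / W (pt e)\<close>, its fraction of the total weight of the pattern;
  \<open>a i\<close> collects all shares of \<open>i\<close>.\<close>

definition a :: "nat \<Rightarrow> real" where "a i = (\<Sum>e\<in>slot. w i e / W (pt e))"
text \<open>Shares are measured in units of \<open>a i / M\<close>, which leaves integers from 0 to
  \<open>M\<close>. Then \<open>a i * z i e\<close> approximates \<open>w i e\<close>, and siblings
  whose integers correspond differ only by the factor \<open>a i\<close>.\<close>

definition n :: "nat \<Rightarrow> nat \<times> nat list \<Rightarrow> nat" where "n i e = nat \<lfloor>real M * (w i e / W (pt e)) / a i\<rfloor>"
definition z :: "nat \<Rightarrow> nat \<times> nat list \<Rightarrow> real" where "z i e = real (n i e) * W (pt e) / real M"

lemma total_nonneg: "total e \<ge> 0"
  unfolding total_def by (intro sum_nonneg weightsD(1) w(1))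

lemma W_nonneg: "W p \<ge> 0"
  unfolding W_def by (intro sum_nonneg total_nonneg)

lemma W_ge:
  assumes "i \<in> I" shows "w i e \<le> W (pt e)"
proof (cases "e \<in> slot")
  case True
  have "w i e \<le> total e" unfolding total_def
    by (rule member_le_sum) (use assms I weightsD(1)[OF w(1)] in auto)
  also have "\<dots> \<le> W (pt e)" unfolding W_def
    by (rule member_le_sum) (use True finite_slot total_nonneg in auto)
  finally show ?thesis .
next
  case False
  then have "w i e = 0" using weightsD(3)[OF w(1)[OF assms]] by blast
  then show ?thesis using W_nonneg by simp
qed

lemma share_eq: "i \<in> I \<Longrightarrow> w i e / W (pt e) * W (pt e) = w i e"
  using W_ge[of i e] weightsD(1)[OF w(1), of i e] by (cases "W (pt e) = 0") auto

lemma share_nonneg: "i \<in> I \<Longrightarrow> w i e / W (pt e) \<ge> 0"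
  using weightsD(1)[OF w(1)] W_nonneg by simp

lemma a_nonneg: "i \<in> I \<Longrightarrow> a i \<ge> 0"
  unfolding a_def by (intro sum_nonneg share_nonneg)

lemma share_le:
  assumes "i \<in> I" shows "w i e / W (pt e) \<le> a i"
proof (cases "e \<in> slot")
  case True
  show ?thesis unfolding a_def
    by (rule member_le_sum) (use True finite_slot share_nonneg[OF assms] in auto)
next
  case False
  then have "w i e = 0" using weightsD(3)[OF w(1)[OF assms]] by blast
  then show ?thesis using a_nonneg[OF assms] by simp
qed

lemma rounded:
  assumes "i \<in> I"
  shows "a i * z i e \<le> w i e" "w i e \<le> a i * z i e + a i * W (pt e) / real M" "n i e \<le> M"
    "n i e \<noteq> 0 \<Longrightarrow> w i e \<noteq> 0"
proof -
  let ?u = "w i e / W (pt e)"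
  note f = floor_rounding[OF share_nonneg[OF assms, of e] share_le[OF assms, of e] M, folded n_def]
  have "a i * real (n i e) / real M * W (pt e) \<le> ?u * W (pt e)"
    by (rule mult_right_mono[OF f(1) W_nonneg])
  then show "a i * z i e \<le> w i e" unfolding share_eq[OF assms] z_def by (simp add: mult_ac)
  have "?u * W (pt e) \<le> (a i * real (n i e) / real M + a i / real M) * W (pt e)"
    by (rule mult_right_mono[OF f(2) W_nonneg])
  then show "w i e \<le> a i * z i e + a i * W (pt e) / real M"
    unfolding share_eq[OF assms] z_def by (simp add: algebra_simps)
  show "n i e \<le> M" by (rule f(3))
  show "n i e \<noteq> 0 \<Longrightarrow> w i e \<noteq> 0" using f(4) by auto
qed

text \<open>For each pattern the shares of all siblings sum to 1, or to 0 if the pattern has no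
  weight, so the total is at most the number of patterns.\<close>

lemma sum_a_le: "(\<Sum>i\<in>I. a i) \<le> real (m * list_bound c r)"
proof -
  let ?P = "SIGMA f:Fs. tuples {..<c} (ar f)"
  have P: "finite ?P" "card ?P \<le> m * list_bound c r" using card_slots_on[of "{..<c}" c] by auto
  have ptP: "pt ` slot \<subseteq> ?P" by (auto simp: pt_def slot_def tuples_def intro!: col)
  have "(\<Sum>i\<in>I. a i) = (\<Sum>e\<in>slot. total e / W (pt e))"
    unfolding a_def total_def by (subst sum.swap) (simp add: sum_divide_distrib)
  also have "\<dots> = (\<Sum>p\<in>?P. \<Sum>e\<in>{e \<in> slot. pt e = p}. total e / W (pt e))"
    by (rule sum.group[OF finite_slot P(1) ptP, symmetric])
  also have "\<dots> = (\<Sum>p\<in>?P. W p / W p)"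
  proof (intro sum.cong refl)
    fix p
    have "(\<Sum>e\<in>{e \<in> slot. pt e = p}. total e / W (pt e)) = (\<Sum>e\<in>{e \<in> slot. pt e = p}. total e / W p)"
      by (intro sum.cong) auto
    also have "\<dots> = (\<Sum>e\<in>{e \<in> slot. pt e = p}. total e) / W p" by (rule sum_divide_distrib[symmetric])
    also have "\<dots> = W p / W p" by (simp only: W_def)
    finally show "(\<Sum>e\<in>{e \<in> slot. pt e = p}. total e / W (pt e)) = W p / W p" .
  qed
  also have "\<dots> \<le> (\<Sum>p\<in>?P. 1)" by (intro sum_mono) (simp add: divide_le_eq_1)
  also have "\<dots> = real (card ?P)" by simp
  also have "\<dots> \<le> real (m * list_bound c r)" using P(2) by (rule of_nat_mono)
  finally show ?thesis .
qed

lemma pattern_weight_le: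
  assumes D: "target D g" and e: "e \<in> slot"
  shows "W (pt e) * pattern_max D g (fst e) (map col (snd e)) \<le> weight_bound D g total"
proof -
  have "W (pt e) * pattern_max D g (fst e) (map col (snd e)) =
      (\<Sum>e'\<in>{e' \<in> slot. pt e' = pt e}. total e' * pattern_max D g (fst e') (map col (snd e')))"
    unfolding W_def sum_distrib_right by (intro sum.cong) (auto simp: pt_def)
  also have "\<dots> \<le> weight_bound D g total" unfolding weight_bound_def
    by (intro sum_mono2 finite_slot mult_nonneg_nonneg total_nonneg pattern_max_nonneg D) auto
  finally show ?thesis .
qed

lemma finite_V: "i \<in> I \<Longrightarrow> finite (V i)" using V(1) U finite_subset by blast

lemma finite_K: "finite K" using K(1) U finite_subset by blast

lemma VK_card: assumes "i \<in> I" shows "finite (V i \<union> K)" "card (V i \<union> K) \<le> s + c"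
  using finite_V[OF assms] finite_K card_Un_le[of "V i" K] V(2)[OF assms] K(2) by auto

abbreviation "loss \<equiv> real (m * list_bound (s + c) r) * real (m * list_bound c r) / real M"

text \<open>The map is kept. Sibling \<open>i\<close> loses at most \<open>a i / M\<close> times the
  weight bound in each slot over \<open>V i \<union> K\<close>; the first factor of
  \<open>loss\<close> counts these slots, the second bounds the sum of the \<open>a i\<close>.
  Rounding down makes the converse lossless.\<close>

lemma approx_rounded: "approx loss K total (\<lambda>e. \<Sum>i\<in>I. a i * z i e)"
proof (rule approxI)
  fix D g assume D: "target D g"
  show "dominated K D g (loss * weight_bound D g total) total (\<lambda>e. \<Sum>i\<in>I. a i * z i e)"
  proof (rule dominated_pointwise)
    fix h :: "nat \<Rightarrow> nat" assume h: "range h \<subseteq> D"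
    let ?E = "weight_bound D g total"
    let ?N = "real (m * list_bound (s + c) r)"
    have E0: "?E \<ge> 0" unfolding weight_bound_def
      by (intro sum_nonneg mult_nonneg_nonneg total_nonneg pattern_max_nonneg D)
    have g0: "g f y \<ge> 0" for f y using D by (simp add: target_def)
    have "wval g (w i) h \<le> wval g (\<lambda>e. a i * z i e) h + a i * (?N * ?E / real M)" if i: "i \<in> I" for i
    proof -
      let ?S = "SIGMA f:Fs. tuples (V i \<union> K) (ar f)"
      have S: "finite ?S" "card ?S \<le> m * list_bound (s + c) r" using card_slots_on[OF VK_card[OF i]] by auto
      have Ss: "?S \<subseteq> slot" using V(1)[OF i] K(1) by (auto simp: slot_def tuples_def)
      have t: "w i e * g (fst e) (map h (snd e)) \<le> a i * z i e * g (fst e) (map h (snd e)) +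
          (if e \<in> ?S then a i * (?E / real M) else 0)" if e: "e \<in> slot" for e
      proof (cases "w i e = 0")
        case True
        then have "n i e = 0" using rounded(4)[OF i, of e] by blast
        then show ?thesis using True a_nonneg[OF i] E0 by (simp add: z_def)
      next
        case False
        then have eS: "e \<in> ?S" using supportedD(1)[OF w(2)[OF i] False] e by (auto simp: slot_def tuples_def)
        have inj: "inj_on col (set (snd e))" using weightsD(4)[OF w(1)[OF i] False] .
        have "w i e * g (fst e) (map h (snd e)) \<le> (a i * z i e + a i * W (pt e) / real M) * g (fst e) (map h (snd e))"
          by (rule mult_right_mono[OF rounded(2)[OF i] g0])
        also have "\<dots> = a i * z i e * g (fst e) (map h (snd e)) + a i / real M * (W (pt e) * g (fst e) (map h (snd e)))"
          by (simp add: algebra_simps)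
        also have "W (pt e) * g (fst e) (map h (snd e)) \<le> W (pt e) * pattern_max D g (fst e) (map col (snd e))"
          by (rule mult_left_mono[OF pattern_max_proper[OF D h inj] W_nonneg])
        also have "\<dots> \<le> ?E" by (rule pattern_weight_le[OF D e])
        finally show ?thesis using eS a_nonneg[OF i] by (simp add: mult_left_mono divide_right_mono)
      qed
      have "wval g (w i) h \<le> (\<Sum>e\<in>slot. a i * z i e * g (fst e) (map h (snd e)) + (if e \<in> ?S then a i * (?E / real M) else 0))"
        unfolding wval_def by (rule sum_mono[OF t])
      also have "\<dots> = wval g (\<lambda>e. a i * z i e) h + real (card ?S) * (a i * (?E / real M))"
        using finite_slot Ss by (simp add: wval_def sum.distrib sum.If_cases inf_absorb2)
      also have "\<dots> \<le> wval g (\<lambda>e. a i * z i e) h + ?N * (a i * (?E / real M))"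
        using S(2) a_nonneg[OF i] E0 by (intro add_left_mono mult_right_mono of_nat_mono) auto
      finally show ?thesis by (simp add: mult_ac)
    qed
    then have "(\<Sum>i\<in>I. wval g (w i) h) \<le> (\<Sum>i\<in>I. wval g (\<lambda>e. a i * z i e) h + a i * (?N * ?E / real M))"
      by (rule sum_mono)
    also have "\<dots> = (\<Sum>i\<in>I. wval g (\<lambda>e. a i * z i e) h) + (\<Sum>i\<in>I. a i) * (?N * ?E / real M)"
      by (simp only: sum.distrib sum_distrib_right)
    also have "\<dots> \<le> (\<Sum>i\<in>I. wval g (\<lambda>e. a i * z i e) h) + real (m * list_bound c r) * (?N * ?E / real M)"
      using E0 by (intro add_left_mono mult_right_mono sum_a_le) auto
    finally show "wval g total h \<le> wval g (\<lambda>e. \<Sum>i\<in>I. a i * z i e) h + loss * ?E"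
      unfolding total_def wval_sum by (simp add: mult_ac)
  qed
  show "dominated K D g 0 (\<lambda>e. \<Sum>i\<in>I. a i * z i e) total"
    unfolding wval_def total_def
    by (intro dominated_pointwise add_increasing2) (use D in \<open>auto simp: target_def wval_def intro!: sum_mono mult_right_mono rounded(1)\<close>)
  show "weight_bound D g (\<lambda>e. \<Sum>i\<in>I. a i * z i e) \<le> weight_bound D g total"
    unfolding weight_bound_def total_def
    by (intro sum_mono mult_right_mono rounded(1) pattern_max_nonneg D)
qed

text \<open>Siblings with the same rounded shape carry proportional weights, so that merging them onto
  one representative does not change the optimum.\<close>

lemma approx_folded:
  assumes rep: "\<And>i. i \<in> I \<Longrightarrow> rep i \<in> I"
    and bij: "\<And>i. i \<in> I \<Longrightarrow> bij_betw (\<phi> i) (V i \<union> K) (V (rep i) \<union> K)"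
    and \<phi>K: "\<And>i u. i \<in> I \<Longrightarrow> u \<in> K \<Longrightarrow> \<phi> i u = u"
    and \<phi>col: "\<And>i u. i \<in> I \<Longrightarrow> u \<in> V i \<union> K \<Longrightarrow> col (\<phi> i u) = col u"
    and \<phi>n: "\<And>i f x. i \<in> I \<Longrightarrow> f \<in> Fs \<Longrightarrow> x \<in> tuples (V i \<union> K) (ar f) \<Longrightarrow> n i (f, x) = n (rep i) (f, map (\<phi> i) x)"
  shows "approx 0 K (\<lambda>e. \<Sum>i\<in>I. a i * z i e) (\<lambda>e. \<Sum>i\<in>I. a i * z (rep i) e)"
proof -
  let ?S = "\<lambda>i. SIGMA f:Fs. tuples (V i \<union> K) (ar f)"
  have Ss: "?S i \<subseteq> slot" if "i \<in> I" for i using V(1)[OF that] K(1) by (auto simp: slot_def tuples_def)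
  have z0: "z i e = 0" if "i \<in> I" "e \<in> slot - ?S i" for i e
  proof -
    have "w i e = 0"
    proof (rule ccontr)
      assume "w i e \<noteq> 0"
      then show False using supportedD(1)[OF w(2)[OF that(1)], of e] that(2) by (auto simp: slot_def tuples_def)
    qed
    then show ?thesis using rounded(4)[OF that(1), of e] by (auto simp: z_def)
  qed
  \<comment> \<open>\<open>\<phi> i\<close> induces a bijection of slots that preserves the rounded
    integers and the patterns, so sums weighted by \<open>z i\<close> become sums weighted by
    \<open>z (rep i)\<close>.\<close>
  have transport: "(\<Sum>e\<in>slot. z i e * G (fst e) (map (\<phi> i) (snd e))) = (\<Sum>e\<in>slot. z (rep i) e * G (fst e) (snd e))"
    if i: "i \<in> I" for G :: "nat \<Rightarrow> nat list \<Rightarrow> real" and i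
  proof -
    have b: "bij_betw (\<lambda>e. (fst e, map (\<phi> i) (snd e))) (?S i) (?S (rep i))"
    proof (rule bij_betw_byWitness[where f' = "\<lambda>e. (fst e, map (the_inv_into (V i \<union> K) (\<phi> i)) (snd e))"])
      have inj: "inj_on (\<phi> i) (V i \<union> K)" and im: "\<phi> i ` (V i \<union> K) = V (rep i) \<union> K"
        using bij[OF i] by (auto simp: bij_betw_def)
      show "\<forall>e\<in>?S i. (fst (fst e, map (\<phi> i) (snd e)),
          map (the_inv_into (V i \<union> K) (\<phi> i)) (snd (fst e, map (\<phi> i) (snd e)))) = e"
      proof
        fix e assume "e \<in> ?S i"
        then have "set (snd e) \<subseteq> V i \<union> K" by (auto simp: tuples_def)
        then have "map (the_inv_into (V i \<union> K) (\<phi> i)) (map (\<phi> i) (snd e)) = snd e"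
          unfolding map_map by (intro map_idI) (auto simp: the_inv_into_f_f[OF inj])
        then show "(fst (fst e, map (\<phi> i) (snd e)),
          map (the_inv_into (V i \<union> K) (\<phi> i)) (snd (fst e, map (\<phi> i) (snd e)))) = e" by simp
      qed
      show "\<forall>e\<in>?S (rep i). (fst (fst e, map (the_inv_into (V i \<union> K) (\<phi> i)) (snd e)),
          map (\<phi> i) (snd (fst e, map (the_inv_into (V i \<union> K) (\<phi> i)) (snd e)))) = e"
      proof
        fix e assume "e \<in> ?S (rep i)"
        then have "set (snd e) \<subseteq> \<phi> i ` (V i \<union> K)" unfolding im by (auto simp: tuples_def)
        then have "map (\<phi> i) (map (the_inv_into (V i \<union> K) (\<phi> i)) (snd e)) = snd e"
          unfolding map_map by (intro map_idI) (auto simp: f_the_inv_into_f[OF inj])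
        then show "(fst (fst e, map (the_inv_into (V i \<union> K) (\<phi> i)) (snd e)),
          map (\<phi> i) (snd (fst e, map (the_inv_into (V i \<union> K) (\<phi> i)) (snd e)))) = e" by simp
      qed
      show "(\<lambda>e. (fst e, map (\<phi> i) (snd e))) ` ?S i \<subseteq> ?S (rep i)"
      proof (rule image_subsetI)
        fix e assume e: "e \<in> ?S i"
        then have x: "set (snd e) \<subseteq> V i \<union> K" "length (snd e) = ar (fst e)" "fst e \<in> Fs" by (auto simp: tuples_def)
        then have "\<phi> i ` set (snd e) \<subseteq> V (rep i) \<union> K" using im by blast
        then show "(fst e, map (\<phi> i) (snd e)) \<in> ?S (rep i)" using x by (simp add: tuples_def)
      qed
      show "(\<lambda>e. (fst e, map (the_inv_into (V i \<union> K) (\<phi> i)) (snd e))) ` ?S (rep i) \<subseteq> ?S i"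
      proof (rule image_subsetI)
        fix e assume e: "e \<in> ?S (rep i)"
        then have x: "set (snd e) \<subseteq> V (rep i) \<union> K" "length (snd e) = ar (fst e)" "fst e \<in> Fs" by (auto simp: tuples_def)
        have "the_inv_into (V i \<union> K) (\<phi> i) u \<in> V i \<union> K" if "u \<in> V (rep i) \<union> K" for u
          by (rule the_inv_into_into[OF inj]) (use that im in auto)
        then have "the_inv_into (V i \<union> K) (\<phi> i) ` set (snd e) \<subseteq> V i \<union> K" using x(1) by blast
        then show "(fst e, map (the_inv_into (V i \<union> K) (\<phi> i)) (snd e)) \<in> ?S i" using x by (simp add: tuples_def)
      qed
    qed
    have zz: "z i e = z (rep i) (fst e, map (\<phi> i) (snd e))" if e: "e \<in> ?S i" for e
    proof -
      have x: "fst e \<in> Fs" "snd e \<in> tuples (V i \<union> K) (ar (fst e))" using e by auto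
      have "map col (map (\<phi> i) (snd e)) = map col (snd e)"
        using x(2) \<phi>col[OF i] by (simp add: tuples_def subset_iff)
      then have "pt (fst e, map (\<phi> i) (snd e)) = pt e" by (simp add: pt_def)
      then show ?thesis using \<phi>n[OF i x] unfolding z_def by simp
    qed
    have "(\<Sum>e\<in>slot. z i e * G (fst e) (map (\<phi> i) (snd e))) = (\<Sum>e\<in>?S i. z i e * G (fst e) (map (\<phi> i) (snd e)))"
      by (rule sum.mono_neutral_right[OF finite_slot Ss[OF i]]) (use z0[OF i] in auto)
    also have "\<dots> = (\<Sum>e\<in>?S i. z (rep i) (fst e, map (\<phi> i) (snd e)) * G (fst (fst e, map (\<phi> i) (snd e))) (snd (fst e, map (\<phi> i) (snd e))))"
      using zz by (intro sum.cong) auto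
    also have "\<dots> = (\<Sum>e\<in>?S (rep i). z (rep i) e * G (fst e) (snd e))"
      by (rule sum.reindex_bij_betw[OF b, of "\<lambda>e. z (rep i) e * G (fst e) (snd e)"])
    also have "\<dots> = (\<Sum>e\<in>slot. z (rep i) e * G (fst e) (snd e))"
      by (rule sum.mono_neutral_left[OF finite_slot Ss[OF rep[OF i]]]) (use z0[OF rep[OF i]] in auto)
    finally show ?thesis .
  qed
  have zsupp: "set (snd e) \<subseteq> V i \<union> K" if "i \<in> I" "z i e \<noteq> 0" for i e
  proof -
    have "w i e \<noteq> 0" using rounded(4)[OF that(1), of e] that(2) by (auto simp: z_def)
    then show ?thesis by (rule supportedD(1)[OF w(2)[OF that(1)]])
  qed
  have fwd: "wval g (z i) (\<lambda>u. h (\<phi> i u)) = wval g (z (rep i)) h" if "i \<in> I" for g h i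
    using transport[OF that, of "\<lambda>f x. g f (map h x)"] unfolding wval_def by (simp add: comp_def)
  show ?thesis
  proof (rule approxI)
    fix D g
    show "dominated K D g (0 * weight_bound D g (\<lambda>e. \<Sum>i\<in>I. a i * z i e))
      (\<lambda>e. \<Sum>i\<in>I. a i * z i e) (\<lambda>e. \<Sum>i\<in>I. a i * z (rep i) e)"
    proof (rule dominatedI)
      fix h :: "nat \<Rightarrow> nat" assume h: "range h \<subseteq> D"
      \<comment> \<open>Within each class of siblings with the same representative, the member
        \<open>b\<close> on which \<open>h\<close> does best is selected; the representative copies
        its values, and the other members can only gain.\<close>
      have "\<exists>b\<in>{i \<in> I. rep i = j}. \<forall>i\<in>{i \<in> I. rep i = j}. wval g (z i) h \<le> wval g (z b) h" if "j \<in> rep ` I" for j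
      proof -
        let ?R = "{i \<in> I. rep i = j}"
        have "finite ?R" "?R \<noteq> {}" using I that by auto
        then have "Max ((\<lambda>i. wval g (z i) h) ` ?R) \<in> (\<lambda>i. wval g (z i) h) ` ?R" by (intro Max_in) auto
        then obtain b where b: "Max ((\<lambda>i. wval g (z i) h) ` ?R) = wval g (z b) h" "b \<in> ?R" by (rule imageE)
        have "wval g (z i) h \<le> wval g (z b) h" if "i \<in> ?R" for i
          unfolding b(1)[symmetric] by (rule Max_ge) (use that \<open>finite ?R\<close> in auto)
        then show ?thesis using b(2) by blast
      qed
      then have "\<forall>j\<in>rep ` I. \<exists>b. b \<in> I \<and> rep b = j \<and> (\<forall>i\<in>I. rep i = j \<longrightarrow> wval g (z i) h \<le> wval g (z b) h)"
        by fastforce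
      from bchoice[OF this] obtain b where b: "\<forall>j\<in>rep ` I. b j \<in> I \<and> rep (b j) = j \<and>
          (\<forall>i\<in>I. rep i = j \<longrightarrow> wval g (z i) h \<le> wval g (z (b j)) h)" ..
      define hs where "hs = (\<lambda>j u. h (the_inv_into (V (b j) \<union> K) (\<phi> (b j)) u))"
      let ?h = "glue (rep ` I) V hs h"
      have le: "wval g (z i) h \<le> wval g (z (rep i)) ?h" if i: "i \<in> I" for i
      proof -
        let ?j = "rep i"
        let ?b = "b ?j"
        have bI: "?b \<in> I" "rep ?b = ?j" using b i by auto
        have inj: "inj_on (\<phi> ?b) (V ?b \<union> K)" and im: "\<phi> ?b ` (V ?b \<union> K) = V ?j \<union> K"
          using bij[OF bI(1)] bI(2) by (auto simp: bij_betw_def)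
        have "wval g (z i) h \<le> wval g (z ?b) h" using b i by auto
        also have "\<dots> = wval g (z ?b) (\<lambda>u. ?h (\<phi> ?b u))"
        proof (rule wval_cong[of _ "V ?b \<union> K"])
          fix u assume u: "u \<in> V ?b \<union> K"
          show "h u = ?h (\<phi> ?b u)"
          proof (cases "\<phi> ?b u \<in> V ?j")
            case True
            have "?h (\<phi> ?b u) = hs ?j (\<phi> ?b u)"
              by (rule glue_in[where i = ?j and V = V]) (use True i rep dis in auto)
            then show ?thesis using the_inv_into_f_f[OF inj u] by (simp add: hs_def)
          next
            case False
            then have "\<phi> ?b u \<in> K" using im u by blast
            then have "\<phi> ?b (\<phi> ?b u) = \<phi> ?b u" using \<phi>K[OF bI(1)] by simp
            then have "\<phi> ?b u = u" using inj u \<open>\<phi> ?b u \<in> K\<close> by (meson UnCI inj_onD)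
            moreover have "?h (\<phi> ?b u) = h (\<phi> ?b u)"
              using \<open>\<phi> ?b u \<in> K\<close> VK rep by (intro glue_out) blast
            ultimately show ?thesis by simp
          qed
        qed (use zsupp[OF bI(1)] in auto)
        also have "\<dots> = wval g (z ?j) ?h" using fwd[OF bI(1)] bI(2) by simp
        finally show ?thesis .
      qed
      have "(\<Sum>i\<in>I. a i * wval g (z i) h) \<le> (\<Sum>i\<in>I. a i * wval g (z (rep i)) ?h)"
        by (intro sum_mono mult_left_mono le a_nonneg)
      then have "wval g (\<lambda>e. \<Sum>i\<in>I. a i * z i e) h \<le> wval g (\<lambda>e. \<Sum>i\<in>I. a i * z (rep i) e) ?h"
        unfolding wval_sum by (simp add: wval_def sum_distrib_left mult.assoc)
      moreover have "range ?h \<subseteq> D" by (rule glue_range) (use h in \<open>auto simp: hs_def\<close>)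
      moreover have "\<forall>u\<in>K. ?h u = h u" using VK rep by (intro ballI glue_out) blast
      ultimately show "\<exists>h'. range h' \<subseteq> D \<and> (\<forall>a\<in>K. h' a = h a) \<and>
          wval g (\<lambda>e. \<Sum>i\<in>I. a i * z i e) h \<le> wval g (\<lambda>e. \<Sum>i\<in>I. a i * z (rep i) e) h' + 0 * weight_bound D g (\<lambda>e. \<Sum>i\<in>I. a i * z i e)"
        by (intro exI[of _ ?h]) simp
    qed
    show "dominated K D g 0 (\<lambda>e. \<Sum>i\<in>I. a i * z (rep i) e) (\<lambda>e. \<Sum>i\<in>I. a i * z i e)"
    proof (rule dominatedI)
      fix h :: "nat \<Rightarrow> nat" assume h: "range h \<subseteq> D"
      \<comment> \<open>Conversely, every sibling follows the values of \<open>h\<close> on its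
        representative.\<close>
      let ?h = "glue I V (\<lambda>i u. h (\<phi> i u)) h"
      have eq: "wval g (z i) ?h = wval g (z (rep i)) h" if i: "i \<in> I" for i
      proof -
        have "wval g (z i) ?h = wval g (z i) (\<lambda>u. h (\<phi> i u))"
        proof (rule wval_cong[of _ "V i \<union> K"])
          fix u assume "u \<in> V i \<union> K"
          then show "?h u = h (\<phi> i u)"
          proof
            assume "u \<in> V i" then show ?thesis by (intro glue_in[OF i _ dis]) auto
          next
            assume u: "u \<in> K"
            then have "?h u = h u" using VK by (intro glue_out) blast
            then show ?thesis using \<phi>K[OF i u] by simp
          qed
        qed (use zsupp[OF i] in auto)
        then show ?thesis using fwd[OF i] by simp
      qed
      have "wval g (\<lambda>e. \<Sum>i\<in>I. a i * z (rep i) e) h = (\<Sum>i\<in>I. a i * wval g (z (rep i)) h)"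
        unfolding wval_sum by (simp add: wval_def sum_distrib_left mult.assoc)
      also have "\<dots> = (\<Sum>i\<in>I. a i * wval g (z i) ?h)" using eq by simp
      also have "\<dots> = wval g (\<lambda>e. \<Sum>i\<in>I. a i * z i e) ?h"
        unfolding wval_sum by (simp add: wval_def sum_distrib_left mult.assoc)
      finally have "wval g (\<lambda>e. \<Sum>i\<in>I. a i * z (rep i) e) h \<le> wval g (\<lambda>e. \<Sum>i\<in>I. a i * z i e) ?h" by simp
      moreover have "range ?h \<subseteq> D" by (rule glue_range) (use h in auto)
      moreover have "\<forall>u\<in>K. ?h u = h u" using VK by (intro ballI glue_out) blast
      ultimately show "\<exists>h'. range h' \<subseteq> D \<and> (\<forall>a\<in>K. h' a = h a) \<and>
          wval g (\<lambda>e. \<Sum>i\<in>I. a i * z (rep i) e) h \<le> wval g (\<lambda>e. \<Sum>i\<in>I. a i * z i e) h' + 0"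
        by (intro exI[of _ ?h]) simp
    qed
    have eq: "weight_bound D g (z i) = weight_bound D g (z (rep i))" if i: "i \<in> I" for i
    proof -
      have "weight_bound D g (z i) = (\<Sum>e\<in>slot. z i e * pattern_max D g (fst e) (map col (map (\<phi> i) (snd e))))"
        unfolding weight_bound_def
      proof (rule sum.cong)
        fix e
        show "z i e * pattern_max D g (fst e) (map col (snd e)) = z i e * pattern_max D g (fst e) (map col (map (\<phi> i) (snd e)))"
        proof (cases "z i e = 0")
          case False
          have "map col (map (\<phi> i) (snd e)) = map col (snd e)"
            using zsupp[OF i False] \<phi>col[OF i] by (simp add: subset_iff)
          then show ?thesis by (simp only:)
        qed simp
      qed simp
      also have "\<dots> = weight_bound D g (z (rep i))"
        unfolding weight_bound_def by (rule transport[OF i, of "\<lambda>f x. pattern_max D g f (map col x)"])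
      finally show ?thesis .
    qed
    have "weight_bound D g (\<lambda>e. \<Sum>i\<in>I. a i * z (rep i) e) = (\<Sum>i\<in>I. a i * weight_bound D g (z (rep i)))"
      unfolding weight_bound_sum by (simp add: weight_bound_def sum_distrib_left mult.assoc)
    also have "\<dots> = (\<Sum>i\<in>I. a i * weight_bound D g (z i))" using eq by simp
    also have "\<dots> = weight_bound D g (\<lambda>e. \<Sum>i\<in>I. a i * z i e)"
      unfolding weight_bound_sum by (simp add: weight_bound_def sum_distrib_left mult.assoc)
    finally show "weight_bound D g (\<lambda>e. \<Sum>i\<in>I. a i * z (rep i) e) \<le> weight_bound D g (\<lambda>e. \<Sum>i\<in>I. a i * z i e)" by simp
  qed
qed

end

section \<open>Merging siblings of equal shape\<close>

context slots
begin

lemma weights_if: "weights w \<Longrightarrow> weights (\<lambda>e. if P e then w e else 0)"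
  unfolding weights_def by simp

lemma weights_add: "weights w \<Longrightarrow> weights w' \<Longrightarrow> weights (\<lambda>e. w e + w' e)"
  unfolding weights_def by (metis Rats_add add_nonneg_nonneg add_0)

lemma weights_sum:
  assumes "\<And>i. i \<in> I \<Longrightarrow> weights (w i)"
  shows "weights (\<lambda>e. \<Sum>i\<in>I. w i e)"
  unfolding weights_def
proof (intro allI conjI)
  fix e
  show "(\<Sum>i\<in>I. w i e) \<ge> 0" by (intro sum_nonneg weightsD(1) assms)
  show "(\<Sum>i\<in>I. w i e) \<in> \<rat>" by (intro Rats_sum weightsD(2) assms)
  show "(\<Sum>i\<in>I. w i e) \<noteq> 0 \<longrightarrow> e \<in> slot \<and> inj_on col (set (snd e))"
  proof
    assume "(\<Sum>i\<in>I. w i e) \<noteq> 0"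
    then obtain i where "i \<in> I" "w i e \<noteq> 0" by (rule sum.not_neutral_contains_not_neutral)
    then show "e \<in> slot \<and> inj_on col (set (snd e))" using weightsD(3,4)[OF assms] by blast
  qed
qed

end

context family
begin

lemma z_support: "i \<in> I \<Longrightarrow> z i e \<noteq> 0 \<Longrightarrow> w i e \<noteq> 0"
  using rounded(4)[of i e] by (auto simp: z_def)

lemma z_weights:
  assumes "i \<in> I" shows "weights (z i)"
  unfolding weights_def
proof (intro allI conjI impI)
  fix e
  show "z i e \<ge> 0" using W_nonneg by (simp add: z_def)
  have "W p \<in> \<rat>" for p unfolding W_def total_def by (intro Rats_sum weightsD(2) w(1))
  then show "z i e \<in> \<rat>" unfolding z_def by (intro Rats_divide Rats_mult) auto
  assume "z i e \<noteq> 0"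
  then have "w i e \<noteq> 0" by (rule z_support[OF assms])
  then show "e \<in> slot" "inj_on col (set (snd e))" using weightsD(3,4)[OF w(1)[OF assms]] by blast+
qed

lemma a_rat: "i \<in> I \<Longrightarrow> a i \<in> \<rat>"
  unfolding a_def W_def total_def by (intro Rats_sum Rats_divide weightsD(2) w(1))

text \<open>Counts shapes: an integer up to \<open>M\<close> for each slot over \<open>s + c\<close>
  labels, and for each label one of \<open>c\<close> colours or its absence.\<close>

definition shape_bound :: nat where
  "shape_bound = (M + 1) ^ (m * list_bound (s + c) r) * (c + 1) ^ (s + c)"

text \<open>Siblings are compared through labels for their vertices: a shape records the rounded
  integers and the colours in terms of labels, and one sibling is kept for each shape that
  occurs.\<close>

lemma merge:
  "\<exists>J w'. J \<subseteq> I \<and> card J \<le> shape_bound \<and> weights w' \<and> supported w' (\<Union>j\<in>J. V j) K \<and> approx loss K total w'"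
proof -
  obtain \<kappa> where \<kappa>: "bij_betw \<kappa> K {0..<card K}" using ex_bij_betw_finite_nat[OF finite_K] by blast
  have "\<forall>i\<in>I. \<exists>\<psi>. bij_betw \<psi> (V i) {0..<card (V i)}" using ex_bij_betw_finite_nat[OF finite_V] by blast
  from bchoice[OF this] obtain \<psi> where \<psi>: "\<forall>i\<in>I. bij_betw (\<psi> i) (V i) {0..<card (V i)}" ..
  \<comment> \<open>\<open>V i\<close> gets labels below \<open>s\<close> and \<open>K\<close>
    labels from \<open>s\<close> on, the same ones for all siblings, so that relabelling fixes
    \<open>K\<close>.\<close>
  define code where "code = (\<lambda>i u. if u \<in> K then s + \<kappa> u else \<psi> i u)"
  define dec where "dec = (\<lambda>i. the_inv_into (V i \<union> K) (code i))"
  have \<kappa>c: "\<kappa> u < c" if "u \<in> K" for u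
  proof -
    have "\<kappa> u \<in> {0..<card K}" using bij_betwE[OF \<kappa>] that by blast
    then show ?thesis using K(2) by simp
  qed
  have \<psi>s: "\<psi> i u < s" if "i \<in> I" "u \<in> V i" for i u
  proof -
    have "\<psi> i u \<in> {0..<card (V i)}" using bij_betwE[OF bspec[OF \<psi> that(1)]] that(2) by blast
    then show ?thesis using V(2)[OF that(1)] by simp
  qed
  have code_inj: "inj_on (code i) (V i \<union> K)" if i: "i \<in> I" for i
  proof (rule inj_onI)
    fix u v assume uv: "u \<in> V i \<union> K" "v \<in> V i \<union> K" "code i u = code i v"
    have i\<kappa>: "inj_on \<kappa> K" and i\<psi>: "inj_on (\<psi> i) (V i)" using bij_betw_imp_inj_on[OF \<kappa>] bij_betw_imp_inj_on[OF bspec[OF \<psi> i]] by blast+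
    consider "u \<in> K" "v \<in> K" | "u \<in> K" "v \<notin> K" | "u \<notin> K" "v \<in> K" | "u \<notin> K" "v \<notin> K" by blast
    then show "u = v"
    proof cases
      case 1 then show ?thesis using uv(3) inj_onD[OF i\<kappa>] by (simp add: code_def)
    next
      case 2 then show ?thesis using uv \<psi>s[OF i, of v] by (simp add: code_def)
    next
      case 3 then show ?thesis using uv \<psi>s[OF i, of u] by (simp add: code_def)
    next
      case 4 then show ?thesis using uv inj_onD[OF i\<psi>] by (simp add: code_def)
    qed
  qed
  have code_lt: "code i u < s + c" if "i \<in> I" "u \<in> V i \<union> K" for i u
    using \<kappa>c[of u] \<psi>s[OF that(1), of u] that(2) by (auto simp: code_def)
  have dec_code: "dec i (code i u) = u" if "i \<in> I" "u \<in> V i \<union> K" for i u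
    unfolding dec_def by (rule the_inv_into_f_f[OF code_inj[OF that(1)] that(2)])
  define Sl where "Sl = (SIGMA f:Fs. tuples {..<s + c} (ar f))"
  define sh1 where "sh1 = (\<lambda>i. restrict (\<lambda>e. n i (fst e, map (dec i) (snd e))) Sl)"
  define sh2 where "sh2 = (\<lambda>i. restrict (\<lambda>l. if l \<in> code i ` (V i \<union> K) then Suc (col (dec i l)) else 0) {..<s + c})"
  define shape where "shape = (\<lambda>i. (sh1 i, sh2 i))"
  define rep where "rep = (\<lambda>i. SOME j. j \<in> I \<and> shape j = shape i)"
  have rep: "rep i \<in> I \<and> shape (rep i) = shape i" if "i \<in> I" for i
    unfolding rep_def by (rule someI[of "\<lambda>j. j \<in> I \<and> shape j = shape i" i]) (use that in simp)
  have repI: "rep i \<in> I" and rep1: "sh1 (rep i) = sh1 i" and rep2: "sh2 (rep i) = sh2 i" if "i \<in> I" for i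
    using rep[OF that] by (simp_all add: shape_def)
  have Sl: "finite Sl" "card Sl \<le> m * list_bound (s + c) r"
    unfolding Sl_def using card_slots_on[of "{..<s + c}" "s + c"] by auto
  have shape_in: "shape ` I \<subseteq> (Sl \<rightarrow>\<^sub>E {..M}) \<times> ({..<s + c} \<rightarrow>\<^sub>E {..c})"
  proof (rule image_subsetI)
    fix i assume i: "i \<in> I"
    have "sh1 i \<in> Sl \<rightarrow>\<^sub>E {..M}" unfolding sh1_def using rounded(3)[OF i] by auto
    moreover have "sh2 i l \<in> {..c}" if "l \<in> {..<s + c}" for l
    proof (cases "l \<in> code i ` (V i \<union> K)")
      case True
      then obtain u where "u \<in> V i \<union> K" "l = code i u" by blast
      then have "dec i l \<in> U" using dec_code[OF i] V(1)[OF i] K(1) by auto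
      then show ?thesis using col[of "dec i l"] that True by (simp add: sh2_def)
    next
      case False then show ?thesis using that by (simp add: sh2_def)
    qed
    then have "sh2 i \<in> {..<s + c} \<rightarrow>\<^sub>E {..c}" by (intro PiE_I) (auto simp: sh2_def)
    ultimately show "shape i \<in> (Sl \<rightarrow>\<^sub>E {..M}) \<times> ({..<s + c} \<rightarrow>\<^sub>E {..c})" by (simp add: shape_def)
  qed
  have "card (shape ` I) \<le> card ((Sl \<rightarrow>\<^sub>E {..M}) \<times> ({..<s + c} \<rightarrow>\<^sub>E {..c}))"
    by (rule card_mono[OF _ shape_in]) (use Sl(1) in \<open>auto intro!: finite_cartesian_product finite_PiE\<close>)
  also have "\<dots> = (M + 1) ^ card Sl * (c + 1) ^ (s + c)"
    using Sl(1) by (simp add: card_cartesian_product card_PiE)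
  also have "\<dots> \<le> shape_bound" unfolding shape_bound_def
    by (intro mult_le_mono1 power_increasing Sl(2)) simp
  finally have cs: "card (shape ` I) \<le> shape_bound" .
  \<comment> \<open>The choice depends only on the shape, so there are at most as many
    representatives as shapes.\<close>
  have repJ: "rep ` I = (\<lambda>\<sigma>. SOME j. j \<in> I \<and> shape j = \<sigma>) ` (shape ` I)" by (auto simp: rep_def)
  have cardJ: "card (rep ` I) \<le> shape_bound"
    unfolding repJ by (rule le_trans[OF card_image_le cs]) (use I in simp)
  define \<phi> where "\<phi> = (\<lambda>i u. dec (rep i) (code i u))"
  have im_iff: "l \<in> code i ` (V i \<union> K) \<longleftrightarrow> l < s + c \<and> sh2 i l \<noteq> 0" if "i \<in> I" for i l
    using code_lt[OF that] by (auto simp: sh2_def)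
  have im_eq: "code i ` (V i \<union> K) = code (rep i) ` (V (rep i) \<union> K)" if i: "i \<in> I" for i
    by (rule set_eqI) (simp only: im_iff[OF i] im_iff[OF repI[OF i]] rep2[OF i])
  have \<phi>_in: "\<phi> i u \<in> V (rep i) \<union> K" "code (rep i) (\<phi> i u) = code i u" if i: "i \<in> I" and u: "u \<in> V i \<union> K" for i u
  proof -
    have "code i u \<in> code (rep i) ` (V (rep i) \<union> K)" unfolding im_eq[OF i, symmetric] using u by (rule imageI)
    then obtain v where v: "v \<in> V (rep i) \<union> K" "code i u = code (rep i) v" by (rule imageE)
    then have "\<phi> i u = v" using dec_code[OF repI[OF i] v(1)] by (simp add: \<phi>_def)
    then show "\<phi> i u \<in> V (rep i) \<union> K" "code (rep i) (\<phi> i u) = code i u" using v by simp_all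
  qed
  have bij: "bij_betw (\<phi> i) (V i \<union> K) (V (rep i) \<union> K)" if i: "i \<in> I" for i
    unfolding bij_betw_def
  proof
    show "inj_on (\<phi> i) (V i \<union> K)"
    proof (rule inj_onI)
      fix u v assume uv: "u \<in> V i \<union> K" "v \<in> V i \<union> K" "\<phi> i u = \<phi> i v"
      then have "code i u = code i v" using \<phi>_in(2)[OF i uv(1)] \<phi>_in(2)[OF i uv(2)] by simp
      then show "u = v" using uv inj_onD[OF code_inj[OF i]] by blast
    qed
    show "\<phi> i ` (V i \<union> K) = V (rep i) \<union> K"
    proof (intro equalityI subsetI)
      fix v assume v: "v \<in> V (rep i) \<union> K"
      then have "code (rep i) v \<in> code i ` (V i \<union> K)" unfolding im_eq[OF i] by (rule imageI)
      then obtain u where u: "code (rep i) v = code i u" "u \<in> V i \<union> K" by (rule imageE)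
      then have "\<phi> i u = v" using dec_code[OF repI[OF i] v] by (simp add: \<phi>_def)
      then show "v \<in> \<phi> i ` (V i \<union> K)" using u by blast
    next
      fix v assume "v \<in> \<phi> i ` (V i \<union> K)"
      then obtain u where "v = \<phi> i u" "u \<in> V i \<union> K" by (rule imageE)
      then show "v \<in> V (rep i) \<union> K" using \<phi>_in(1)[OF i] by simp
    qed
  qed
  have \<phi>K: "\<phi> i u = u" if "i \<in> I" "u \<in> K" for i u
  proof -
    have "code i u = code (rep i) u" using that by (simp add: code_def)
    then show ?thesis using dec_code[OF repI[OF that(1)], of u] that(2) by (simp add: \<phi>_def)
  qed
  have \<phi>col: "col (\<phi> i u) = col u" if i: "i \<in> I" and u: "u \<in> V i \<union> K" for i u
  proof -
    let ?l = "code i u"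
    have 1: "?l \<in> code i ` (V i \<union> K)" using u by (rule imageI)
    then have 2: "?l \<in> code (rep i) ` (V (rep i) \<union> K)" unfolding im_eq[OF i] .
    have "Suc (col (dec (rep i) ?l)) = sh2 (rep i) ?l" using 2 code_lt[OF i u] by (simp add: sh2_def)
    also have "\<dots> = Suc (col (dec i ?l))" unfolding rep2[OF i] using 1 code_lt[OF i u] by (simp add: sh2_def)
    finally show ?thesis using dec_code[OF i u] by (simp add: \<phi>_def)
  qed
  have \<phi>n: "n i (f, x) = n (rep i) (f, map (\<phi> i) x)"
    if i: "i \<in> I" and f: "f \<in> Fs" and x: "x \<in> tuples (V i \<union> K) (ar f)" for i f x
  proof -
    let ?y = "map (code i) x"
    have x': "set x \<subseteq> V i \<union> K" "length x = ar f" using x by (auto simp: tuples_def)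
    then have "set ?y \<subseteq> {..<s + c}" using code_lt[OF i] by auto
    then have y: "(f, ?y) \<in> Sl" using f x' by (simp add: Sl_def tuples_def)
    have "map (dec i) ?y = x" unfolding map_map
      by (rule map_idI) (use x'(1) dec_code[OF i] in auto)
    then have "n i (f, x) = sh1 i (f, ?y)" using y by (simp add: sh1_def)
    also have "\<dots> = sh1 (rep i) (f, ?y)" using rep1[OF i] by simp
    also have "\<dots> = n (rep i) (f, map (\<phi> i) x)" using y by (simp add: sh1_def \<phi>_def comp_def)
    finally show ?thesis .
  qed
  define w' where "w' = (\<lambda>e. \<Sum>i\<in>I. a i * z (rep i) e)"
  have "approx 0 K (\<lambda>e. \<Sum>i\<in>I. a i * z i e) w'" unfolding w'_def
    by (rule approx_folded[OF repI bij \<phi>K \<phi>col \<phi>n])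
  from approx_trans[OF approx_rounded this] have ap: "approx loss K total w'" by simp
  have ww: "weights w'" unfolding w'_def
  proof (rule weights_sum)
    fix i assume i: "i \<in> I"
    have "weights (z (rep i))" by (rule z_weights[OF repI[OF i]])
    then show "weights (\<lambda>e. a i * z (rep i) e)"
      using a_nonneg[OF i] a_rat[OF i] unfolding weights_def by auto
  qed
  define Z where "Z = (\<Union>j\<in>rep ` I. V j)"
  have "supported w' Z K" unfolding supported_def
  proof (intro allI impI)
    fix e assume "w' e \<noteq> 0"
    then have "(\<Sum>i\<in>I. a i * z (rep i) e) \<noteq> 0" by (simp add: w'_def)
    then obtain i where i: "i \<in> I" "a i * z (rep i) e \<noteq> 0" by (rule sum.not_neutral_contains_not_neutral)
    have "w (rep i) e \<noteq> 0" by (rule z_support[OF repI[OF i(1)]]) (use i in auto)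
    then have "set (snd e) \<subseteq> V (rep i) \<union> K" "set (snd e) \<inter> V (rep i) \<noteq> {}"
      using supportedD[OF w(2)[OF repI[OF i(1)]]] by blast+
    moreover have "V (rep i) \<subseteq> Z" using i by (auto simp: Z_def)
    ultimately show "set (snd e) \<subseteq> Z \<union> K \<and> set (snd e) \<inter> Z \<noteq> {}" by blast
  qed
  moreover have "rep ` I \<subseteq> I" using repI by blast
  ultimately show ?thesis using ap ww cardJ unfolding Z_def
    by (intro exI[of _ "rep ` I"] exI[of _ w']) simp
qed

end

text \<open>Follows \<open>fold_above\<close>: \<open>t\<close> is the number of levels left,
  \<open>s\<close> bounds the size of one folded subtree with its root, \<open>M\<close> is the
  fineness that makes the loss at most \<open>\<delta>\<close>, and the result is the number of
  shapes times \<open>s\<close>.\<close>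

fun size_bound :: "nat \<Rightarrow> nat \<Rightarrow> nat \<Rightarrow> real \<Rightarrow> nat \<Rightarrow> nat" where
  "size_bound m r c \<delta> 0 = 0"
| "size_bound m r c \<delta> (Suc t) = (let s = Suc (size_bound m r c \<delta> t);
     M = Suc (nat \<lceil>real (m * list_bound (s + c) r) * real (m * list_bound c r) / \<delta>\<rceil>)
     in (M + 1) ^ (m * list_bound (s + c) r) * (c + 1) ^ (s + c) * s)"

section \<open>Folding along the elimination forest\<close>

context slots
begin

definition part :: "(nat \<times> nat list \<Rightarrow> real) \<Rightarrow> nat set \<Rightarrow> nat set \<Rightarrow> nat \<times> nat list \<Rightarrow> real" where
  "part w V K = (\<lambda>e. if set (snd e) \<subseteq> V \<union> K \<and> set (snd e) \<inter> V \<noteq> {} then w e else 0)"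

lemma supported_part: "supported (part w V K) V K"
  unfolding supported_def part_def by simp

text \<open>The pinned set \<open>K\<close> is a path from a root, and the vertices above \<open>K\<close> are folded bottom-up.\<close>

lemma fold_above:
  assumes fo: "forest_order U E k le" and c: "c = Suc k" and colU: "\<And>v. v \<in> U \<Longrightarrow> col v = card {u. le u v}"
    and ww: "weights w" and chain: "\<And>e u v. w e \<noteq> 0 \<Longrightarrow> u \<in> set (snd e) \<Longrightarrow> v \<in> set (snd e) \<Longrightarrow> le u v \<or> le v u"
    and \<delta>: "\<delta> > 0"
    and "K \<subseteq> U" "\<And>a u. a \<in> K \<Longrightarrow> le u a \<Longrightarrow> u \<in> K" "card K + t = k"
  shows "\<exists>V' w'. V' \<subseteq> {u \<in> U. u \<notin> K \<and> (\<forall>a\<in>K. le a u)} \<and> card V' \<le> size_bound m r c \<delta> t \<and> weights w' \<and>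
    supported w' V' K \<and> approx (real t * \<delta>) K (part w {u \<in> U. u \<notin> K \<and> (\<forall>a\<in>K. le a u)} K) w'"
  using assms(7-)
proof (induction t arbitrary: K)
  note ord = forest_orderD[OF fo]
  case 0
  let ?V = "{u \<in> U. u \<notin> K \<and> (\<forall>a\<in>K. le a u)}"
  have fK: "finite K" using 0(1) U finite_subset by blast
  \<comment> \<open>A vertex above all of \<open>K\<close> would have \<open>k + 1\<close> vertices
    in its down-set.\<close>
  have V0: "?V = {}"
  proof (rule ccontr)
    assume "?V \<noteq> {}"
    then obtain u where u: "u \<in> U" "u \<notin> K" "\<forall>a\<in>K. le a u" by blast
    have "insert u K \<subseteq> {a. le a u}" using u ord(3) by auto
    moreover have "finite {a. le a u}" by (rule finite_subset[OF _ U]) (use ord(1) in auto)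
    ultimately have "card (insert u K) \<le> card {a. le a u}" by (intro card_mono)
    also have "\<dots> \<le> k" by (rule ord(8)[OF u(1)])
    finally show False using u(2) fK 0(3) by simp
  qed
  have "part w ?V K = (\<lambda>_. 0)" unfolding V0 by (simp add: part_def)
  then have "approx (real 0 * \<delta>) K (part w ?V K) (\<lambda>_. 0)" using approx_refl by simp
  moreover have z: "weights (\<lambda>_. 0)" by (simp add: weights_def)
  moreover have "supported (\<lambda>_. 0) {} K" by (simp add: supported_def)
  ultimately show ?case using z by (intro exI[of _ "{}"] exI[of _ "\<lambda>_. 0"]) simp
next
  note ord = forest_orderD[OF fo]
  case (Suc t)
  define VV where "VV = (\<lambda>K. {u \<in> U. u \<notin> K \<and> (\<forall>a\<in>K. le a u)})"
  define Desc where "Desc = (\<lambda>x. {u. le x u})"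
  \<comment> \<open>The minimal vertices above \<open>K\<close> are the roots of the sibling
    subtrees.\<close>
  define I where "I = {x \<in> VV K. \<forall>u\<in>VV K. le u x \<longrightarrow> u = x}"
  have fK: "finite K" using Suc.prems(1) U finite_subset by blast
  have fI: "finite I" by (rule finite_subset[OF _ U]) (auto simp: I_def VV_def)
  have less: "card {w. le w u} < card {w. le w v}" if "le u v" "u \<noteq> v" for u v
    by (rule forest_order_card_less[OF fo U that])
  have ex_min: "\<exists>x\<in>I. le x v" if v: "v \<in> VV K" for v
  proof -
    have "v \<in> VV K \<and> le v v" using v ord(3) by (auto simp: VV_def)
    then obtain x where x: "x \<in> VV K \<and> le x v" "\<And>y. y \<in> VV K \<and> le y v \<Longrightarrow> card {w. le w x} \<le> card {w. le w y}"
      using ex_has_least_nat[of "\<lambda>x. x \<in> VV K \<and> le x v" v "\<lambda>x. card {w. le w x}"] by blast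
    have "u = x" if u: "u \<in> VV K" "le u x" for u
    proof (rule ccontr)
      assume "u \<noteq> x"
      then have "card {w. le w u} < card {w. le w x}" using less u by blast
      moreover have "le u v" using ord(5) u x(1) by blast
      ultimately show False using x(2)[of u] u by simp
    qed
    then show ?thesis using x(1) by (auto simp: I_def)
  qed
  have DescV: "Desc x \<subseteq> VV K" if x: "x \<in> I" for x
  proof
    fix u assume "u \<in> Desc x"
    then have u: "le x u" by (simp add: Desc_def)
    have "u \<notin> K" using Suc.prems(2)[of u x] u x by (auto simp: I_def VV_def)
    moreover have "le a u" if "a \<in> K" for a using ord(5)[of a x u] u x that by (auto simp: I_def VV_def)
    ultimately show "u \<in> VV K" using ord(2)[OF u] by (simp add: VV_def)
  qed
  have DescK: "Desc x \<inter> K = {}" if "x \<in> I" for x using DescV[OF that] by (auto simp: VV_def)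
  have xD: "x \<in> Desc x" if "x \<in> I" for x using ord(3) that by (auto simp: Desc_def I_def VV_def)
  have disD: "Desc x \<inter> Desc y = {}" if xy: "x \<in> I" "y \<in> I" "x \<noteq> y" for x y
  proof (rule ccontr)
    assume "Desc x \<inter> Desc y \<noteq> {}"
    then obtain u where "le x u" "le y u" by (auto simp: Desc_def)
    then have "le x y \<or> le y x" by (rule ord(6))
    then show False using xy by (auto simp: I_def)
  qed
  have VVx: "VV (insert x K) = Desc x - {x}" if x: "x \<in> I" for x
  proof (intro equalityI subsetI)
    fix u assume "u \<in> VV (insert x K)" then show "u \<in> Desc x - {x}" by (auto simp: VV_def Desc_def)
  next
    fix u assume u: "u \<in> Desc x - {x}"
    then have "u \<in> VV K" using DescV[OF x] by blast
    then show "u \<in> VV (insert x K)" using u by (auto simp: VV_def Desc_def)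
  qed
  have "\<exists>p. fst p \<subseteq> VV (insert x K) \<and> card (fst p) \<le> size_bound m r c \<delta> t \<and> weights (snd p) \<and>
      supported (snd p) (fst p) (insert x K) \<and>
      approx (real t * \<delta>) (insert x K) (part w (VV (insert x K)) (insert x K)) (snd p)" if x: "x \<in> I" for x
  proof -
    have xK: "x \<notin> K" "x \<in> U" using x by (auto simp: I_def VV_def)
    have "\<exists>V' w'. V' \<subseteq> VV (insert x K) \<and> card V' \<le> size_bound m r c \<delta> t \<and> weights w' \<and>
      supported w' V' (insert x K) \<and> approx (real t * \<delta>) (insert x K) (part w (VV (insert x K)) (insert x K)) w'"
      unfolding VV_def
    proof (rule Suc.IH)
      show "insert x K \<subseteq> U" using xK Suc.prems(1) by simp
      show "card (insert x K) + t = k" using xK fK Suc.prems(3) by simp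
      fix a u assume a: "a \<in> insert x K" "le u a"
      show "u \<in> insert x K"
      proof (rule ccontr)
        assume n: "u \<notin> insert x K"
        then have ux: "a = x" using a Suc.prems(2) by blast
        have "le b u" if b: "b \<in> K" for b
        proof -
          have "le b x" using x b by (auto simp: I_def VV_def)
          then have "le b u \<or> le u b" using ord(6)[of b x u] a ux by simp
          then show ?thesis using Suc.prems(2)[OF b, of u] n by blast
        qed
        then have "u \<in> VV K" using n ord(1)[OF a(2)] by (simp add: VV_def)
        then show False using x a ux n by (auto simp: I_def)
      qed
    qed
    then obtain V' w' where "V' \<subseteq> VV (insert x K) \<and> card V' \<le> size_bound m r c \<delta> t \<and> weights w' \<and>
      supported w' V' (insert x K) \<and> approx (real t * \<delta>) (insert x K) (part w (VV (insert x K)) (insert x K)) w'" by (elim exE)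
    then show ?thesis by (intro exI[of _ "(V', w')"]) simp
  qed
  then have "\<forall>x\<in>I. \<exists>p. fst p \<subseteq> VV (insert x K) \<and> card (fst p) \<le> size_bound m r c \<delta> t \<and> weights (snd p) \<and>
      supported (snd p) (fst p) (insert x K) \<and>
      approx (real t * \<delta>) (insert x K) (part w (VV (insert x K)) (insert x K)) (snd p)" by (rule ballI)
  from bchoice[OF this] obtain p where p: "\<forall>x\<in>I. fst (p x) \<subseteq> VV (insert x K) \<and> card (fst (p x)) \<le> size_bound m r c \<delta> t \<and>
      weights (snd (p x)) \<and> supported (snd (p x)) (fst (p x)) (insert x K) \<and>
      approx (real t * \<delta>) (insert x K) (part w (VV (insert x K)) (insert x K)) (snd (p x))" ..
  define V1 where "V1 = (\<lambda>x. fst (p x))"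
  define w1 where "w1 = (\<lambda>x. snd (p x))"
  have V1: "V1 x \<subseteq> Desc x - {x}" "card (V1 x) \<le> size_bound m r c \<delta> t"
    and w1: "weights (w1 x)" "supported (w1 x) (V1 x) (insert x K)"
    and ap1: "approx (real t * \<delta>) (insert x K) (part w (Desc x - {x}) (insert x K)) (w1 x)" if x: "x \<in> I" for x
    using bspec[OF p x] unfolding VVx[OF x] V1_def w1_def by simp_all
  \<comment> \<open>These tuples meet the subtree of \<open>x\<close> only in \<open>x\<close>. With
    \<open>x\<close> pinned their value is fixed, so they stay out of the recursive folding and are
    added back unchanged.\<close>
  define w0 where "w0 = (\<lambda>x e. if set (snd e) \<subseteq> insert x K \<and> x \<in> set (snd e) then w e else 0)"
  have w0: "weights (w0 x)" for x unfolding w0_def by (rule weights_if[OF ww])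
  define w2 where "w2 = (\<lambda>x e. w1 x e + w0 x e)"
  have split: "part w (Desc x) K = (\<lambda>e. part w (Desc x - {x}) (insert x K) e + w0 x e)" if x: "x \<in> I" for x
  proof
    fix e
    show "part w (Desc x) K e = part w (Desc x - {x}) (insert x K) e + w0 x e"
      unfolding part_def w0_def using DescK[OF x] xD[OF x] by auto
  qed
  have \<delta>t: "real t * \<delta> \<ge> 0" using \<delta> by simp
  have ap2: "approx (real t * \<delta>) K (part w (Desc x) K) (w2 x)" if x: "x \<in> I" for x
  proof -
    have "approx (real t * \<delta>) (insert x K) (part w (Desc x) K) (w2 x)" unfolding split[OF x] w2_def
      by (rule approx_add_pinned[OF ap1[OF x] w0 _ \<delta>t]) (auto simp: w0_def split: if_splits)
    \<comment> \<open>The pin at \<open>x\<close> is now released, so that whole subtrees including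
      their roots can be merged.\<close>
    then show ?thesis by (rule approx_mono) (auto intro: weights_if[OF ww] simp: part_def)
  qed
  have w2: "weights (w2 x)" if "x \<in> I" for x unfolding w2_def by (rule weights_add[OF w1(1)[OF that] w0])
  have s2: "supported (w2 x) (insert x (V1 x)) K" if x: "x \<in> I" for x
    unfolding supported_def
  proof (intro allI impI)
    fix e assume "w2 x e \<noteq> 0"
    then consider "w1 x e \<noteq> 0" | "w0 x e \<noteq> 0" unfolding w2_def by fastforce
    then show "set (snd e) \<subseteq> insert x (V1 x) \<union> K \<and> set (snd e) \<inter> insert x (V1 x) \<noteq> {}"
    proof cases
      case 1 then show ?thesis using supportedD[OF w1(2)[OF x] 1] by blast
    next
      case 2 then show ?thesis by (auto simp: w0_def split: if_splits)
    qed
  qed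
  have V1D: "insert x (V1 x) \<subseteq> Desc x" if "x \<in> I" for x using V1(1)[OF that] xD[OF that] by blast
  \<comment> \<open>A weighted tuple is a chain, so its entries above \<open>K\<close> lie over a
    single minimal vertex.\<close>
  have sum_eq: "part w (VV K) K = (\<lambda>e. \<Sum>x\<in>I. part w (Desc x) K e)"
  proof
    fix e :: "nat \<times> nat list"
    let ?S = "set (snd e)"
    show "part w (VV K) K e = (\<Sum>x\<in>I. part w (Desc x) K e)"
    proof (cases "w e \<noteq> 0 \<and> ?S \<subseteq> VV K \<union> K \<and> ?S \<inter> VV K \<noteq> {}")
      case False
      have "part w (Desc x) K e = 0" if x: "x \<in> I" for x
        using False DescV[OF x] unfolding part_def by auto
      then have "(\<Sum>x\<in>I. part w (Desc x) K e) = 0" by (intro sum.neutral) blast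
      moreover have "part w (VV K) K e = 0" using False unfolding part_def by auto
      ultimately show ?thesis by simp
    next
      case True
      then obtain v where v: "v \<in> ?S" "v \<in> VV K" by blast
      obtain x where x: "x \<in> I" "le x v" using ex_min[OF v(2)] by blast
      have "?S \<subseteq> Desc x \<union> K"
      proof
        fix u assume u: "u \<in> ?S"
        show "u \<in> Desc x \<union> K"
        proof (rule ccontr)
          assume n: "u \<notin> Desc x \<union> K"
          then have uV: "u \<in> VV K" using True u by blast
          have "le u v \<or> le v u" using chain[of e u v] True u v(1) by blast
          moreover have "\<not> le v u" using ord(5)[OF x(2)] n by (auto simp: Desc_def)
          ultimately have "le u v" by blast
          then have "le u x \<or> le x u" using ord(6) x(2) by blast
          then have "le u x" using n by (auto simp: Desc_def)
          then have "u = x" using x(1) uV by (auto simp: I_def)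
          then show False using n xD[OF x(1)] by blast
        qed
      qed
      then have px: "part w (Desc x) K e = w e" using v(1) x by (auto simp: part_def Desc_def)
      have p0: "part w (Desc y) K e = 0" if y: "y \<in> I - {x}" for y
      proof -
        have "v \<notin> Desc y \<union> K" using disD[of x y] x y v(2) by (auto simp: Desc_def VV_def)
        then show ?thesis using v(1) by (auto simp: part_def)
      qed
      have "(\<Sum>x\<in>I. part w (Desc x) K e) = part w (Desc x) K e + (\<Sum>y\<in>I - {x}. part w (Desc y) K e)"
        by (rule sum.remove[OF fI x(1)])
      also have "(\<Sum>y\<in>I - {x}. part w (Desc y) K e) = 0" using p0 by (intro sum.neutral) blast
      finally show ?thesis using px True by (simp add: part_def)
    qed
  qed
  have ap3: "approx (real t * \<delta>) K (part w (VV K) K) (\<lambda>e. \<Sum>x\<in>I. w2 x e)"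
    unfolding sum_eq
  proof (rule approx_sum[where V = Desc])
    fix x assume x: "x \<in> I"
    show "supported (w2 x) (Desc x) K" using s2[OF x] V1D[OF x] unfolding supported_def by blast
  qed (use disD DescK supported_part ap2 in auto)
  define s where "s = Suc (size_bound m r c \<delta> t)"
  define N where "N = real (m * list_bound (s + c) r) * real (m * list_bound c r)"
  define M where "M = Suc (nat \<lceil>N / \<delta>\<rceil>)"
  interpret F: family U Fs ar col m r c I "\<lambda>x. insert x (V1 x)" K w2 s M
  proof unfold_locales
    fix x assume x: "x \<in> I"
    show "insert x (V1 x) \<subseteq> U" using V1D[OF x] DescV[OF x] by (auto simp: VV_def)
    show "card (insert x (V1 x)) \<le> s"
      using V1(2)[OF x] card_insert_le_m1[of s "V1 x" x] by (simp add: s_def)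
    show "insert x (V1 x) \<inter> K = {}" using V1D[OF x] DescK[OF x] by blast
    show "weights (w2 x)" by (rule w2[OF x])
    show "supported (w2 x) (insert x (V1 x)) K" by (rule s2[OF x])
    fix y assume y: "y \<in> I" "x \<noteq> y"
    show "insert x (V1 x) \<inter> insert y (V1 y) = {}" using V1D[OF x] V1D[OF y(1)] disD[OF x y] by blast
  next
    show "K \<subseteq> U" by (rule Suc.prems(1))
    show "card K \<le> c" using Suc.prems(3) c by simp
    show "M > 0" by (simp add: M_def)
  qed (rule fI)
  obtain J w' where J: "J \<subseteq> I" "card J \<le> F.shape_bound" and w': "weights w'"
    "supported w' (\<Union>x\<in>J. insert x (V1 x)) K" and ap4: "approx F.loss K F.total w'"
    using F.merge by (elim exE conjE)
  have total: "F.total = (\<lambda>e. \<Sum>x\<in>I. w2 x e)" by (rule ext) (simp add: F.total_def)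
  have "N / \<delta> \<le> real M" unfolding M_def by linarith
  then have "N / real M \<le> \<delta>" using \<delta> by (simp add: M_def field_simps)
  then have "approx \<delta> K F.total w'" using ap4
    by (intro approx_mono[OF ap4]) (auto simp: N_def total intro: weights_sum w2)
  then have "approx (real t * \<delta> + \<delta>) K (part w (VV K) K) w'"
    using approx_trans[OF ap3, of \<delta> w'] \<delta> unfolding total by simp
  then have fin: "approx (real (Suc t) * \<delta>) K (part w (VV K) K) w'" by (simp add: algebra_simps)
  have "card (\<Union>x\<in>J. insert x (V1 x)) \<le> (\<Sum>x\<in>J. card (insert x (V1 x)))"
    by (rule card_UN_le) (use J(1) fI finite_subset in blast)
  also have "\<dots> \<le> card J * s"
    using sum_bounded_above[of J "\<lambda>x. card (insert x (V1 x))" s] F.V(2) J(1) by auto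
  also have "\<dots> \<le> F.shape_bound * s" using J(2) by (rule mult_le_mono1)
  also have "\<dots> = size_bound m r c \<delta> (Suc t)"
    unfolding F.shape_bound_def by (simp only: size_bound.simps Let_def M_def N_def s_def)
  finally have "card (\<Union>x\<in>J. insert x (V1 x)) \<le> size_bound m r c \<delta> (Suc t)" .
  moreover have "(\<Union>x\<in>J. insert x (V1 x)) \<subseteq> VV K" using J(1) V1D DescV by blast
  moreover have VK: "{u \<in> U. u \<notin> K \<and> (\<forall>a\<in>K. le a u)} = VV K" by (simp only: VV_def)
  ultimately show ?case unfolding VK using w' fin
    by (intro exI[of _ "\<Union>x\<in>J. insert x (V1 x)"] exI[of _ w'] conjI)
qed

lemma weight_bound_le:
  assumes D: "target D g" and w: "weights w" and B: "\<And>h. range h \<subseteq> D \<Longrightarrow> wval g w h \<le> B"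
  shows "weight_bound D g w \<le> real (m * list_bound c r) * B"
proof -
  let ?P = "SIGMA f:Fs. tuples {..<c} (ar f)"
  let ?pt = "\<lambda>e. (fst e, map col (snd e))"
  have P: "finite ?P" "card ?P \<le> m * list_bound c r" using card_slots_on[of "{..<c}" c] by auto
  have ptP: "?pt ` slot \<subseteq> ?P" by (auto simp: slot_def tuples_def intro!: col)
  have g0: "g f y \<ge> 0" for f y using D by (simp add: target_def)
  have "(\<Sum>e\<in>{e \<in> slot. ?pt e = p}. w e * pattern_max D g (fst e) (map col (snd e))) \<le> B" for p
  proof -
    \<comment> \<open>Composed with \<open>col\<close>, the best assignment of values to colours
      becomes a map of vertices; slots of other patterns only add nonnegative terms.\<close>
    obtain \<theta> where \<theta>: "range \<theta> \<subseteq> D" "pattern_max D g (fst p) (snd p) = g (fst p) (map \<theta> (snd p))"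
      by (rule pattern_max_attained[OF D])
    have "(\<Sum>e\<in>{e \<in> slot. ?pt e = p}. w e * pattern_max D g (fst e) (map col (snd e))) =
      (\<Sum>e\<in>{e \<in> slot. ?pt e = p}. w e * g (fst e) (map (\<lambda>u. \<theta> (col u)) (snd e)))"
      using \<theta>(2) by (intro sum.cong) (auto simp: comp_def)
    also have "\<dots> \<le> wval g w (\<lambda>u. \<theta> (col u))" unfolding wval_def
      by (intro sum_mono2 finite_slot mult_nonneg_nonneg weightsD(1)[OF w] g0) auto
    also have "\<dots> \<le> B" by (rule B) (use \<theta>(1) in auto)
    finally show ?thesis .
  qed
  then have "(\<Sum>p\<in>?P. \<Sum>e\<in>{e \<in> slot. ?pt e = p}. w e * pattern_max D g (fst e) (map col (snd e))) \<le> (\<Sum>p\<in>?P. B)"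
    by (intro sum_mono)
  moreover have "weight_bound D g w = (\<Sum>p\<in>?P. \<Sum>e\<in>{e \<in> slot. ?pt e = p}. w e * pattern_max D g (fst e) (map col (snd e)))"
    unfolding weight_bound_def by (rule sum.group[OF finite_slot P(1) ptP, symmetric])
  moreover have "(\<Sum>p\<in>?P. B) \<le> real (m * list_bound c r) * B"
  proof -
    \<comment> \<open>A constant map shows \<open>B \<ge> 0\<close>, so the number of patterns may
      be replaced by its bound.\<close>
    obtain d where "d \<in> D" using D by (auto simp: target_def)
    then have "0 \<le> wval g w (\<lambda>_. d)" "wval g w (\<lambda>_. d) \<le> B"
      using B[of "\<lambda>_. d"] unfolding wval_def by (auto intro!: sum_nonneg mult_nonneg_nonneg weightsD(1)[OF w] g0)
    then have "B \<ge> 0" by linarith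
    then show ?thesis using P(2) by (simp del: of_nat_mult) (intro mult_right_mono of_nat_mono, auto)
  qed
  ultimately show ?thesis by linarith
qed

end

theorem td_bounded_size_approx:
  assumes \<epsilon>: "\<epsilon> > 0"
  shows "\<exists>s. \<forall>A :: nat struc. struc_wf A \<and> card (dom (sigma A)) \<le> m \<and> (\<forall>f n. sigma A f = Some n \<longrightarrow> n \<le> r) \<and>
    td_le (gaif_adj A) k (univ A) \<longrightarrow> approximable gsize s \<epsilon> A"
proof -
  define P where "P = real (m * list_bound (Suc k) r)"
  \<comment> \<open>Each of the \<open>k\<close> levels loses \<open>\<delta>\<close>, relative to a
    weight bound of at most \<open>P\<close> times the optimum, so that the total relative loss is
    at most \<open>1 - exp (- \<epsilon>)\<close>. The increments by one avoid zero
    denominators.\<close>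
  define \<delta> where "\<delta> = (1 - exp (- \<epsilon>)) / (real (Suc k) * (P + 1))"
  have P0: "P \<ge> 0" by (simp add: P_def)
  have e1: "exp (- \<epsilon>) < 1" using \<epsilon> by simp
  have \<delta>: "\<delta> > 0" unfolding \<delta>_def using e1 P0 by (intro divide_pos_pos mult_pos_pos) auto
  have k\<delta>: "real k * \<delta> * P \<le> 1 - exp (- \<epsilon>)"
  proof -
    have "real k * \<delta> * P \<le> real (Suc k) * \<delta> * (P + 1)" using \<delta> P0 by (intro mult_mono) auto
    also have "\<dots> = \<delta> * (real (Suc k) * (P + 1))" by (simp only: mult_ac)
    also have "\<dots> = 1 - exp (- \<epsilon>)" unfolding \<delta>_def using P0
      by (intro nonzero_eq_divide_eq[THEN iffD1, OF _ refl]) auto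
    finally show ?thesis .
  qed
  have "approximable gsize (Suc (size_bound m r (Suc k) \<delta> k)) \<epsilon> A"
    if A: "struc_wf A" and m: "card (dom (sigma A)) \<le> m" and r: "\<forall>f n. sigma A f = Some n \<longrightarrow> n \<le> r"
      and td: "td_le (gaif_adj A) k (univ A)" for A :: "nat struc"
  proof -
    obtain le where fo: "forest_order (univ A) (gaif_adj A) k le" using td td_le_def by blast
    note ord = forest_orderD[OF fo]
    \<comment> \<open>Depths run from 1 to \<open>k\<close>, hence the \<open>Suc k\<close> colours
      in the interpretation of \<open>slots\<close>.\<close>
    define col where "col = (\<lambda>v. card {u. le u v})"
    define Fs where "Fs = dom (sigma A)"
    define ar where "ar = (\<lambda>f. the (sigma A f))"
    define U where "U = univ A"
    interpret slots U Fs ar col m r "Suc k"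
    proof unfold_locales
      show "finite U" "finite Fs" using struc_wfD(1,3)[OF A] by (simp_all add: U_def Fs_def)
      show "card Fs \<le> m" using m by (simp add: Fs_def)
      show "ar f \<le> r" if "f \<in> Fs" for f using that r by (auto simp: Fs_def ar_def)
      show "col v < Suc k" if "v \<in> U" for v using ord(8)[of v] that by (simp add: U_def col_def)
    qed
    define w where "w = (\<lambda>e :: nat \<times> nat list. interp A (fst e) (snd e))"
    have slotI: "e \<in> slot" if "w e \<noteq> 0" for e
    proof -
      have "fst e \<in> dom (sigma A)" "snd e \<in> tuples (univ A) (the (sigma A (fst e)))"
        using struc_wfD(6,7)[OF A, of "fst e" "snd e"] that by (auto simp: w_def)
      then have "fst e \<in> Fs" "snd e \<in> tuples U (ar (fst e))" by (simp_all add: Fs_def ar_def U_def)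
      then show ?thesis unfolding slot_def by (cases e) simp
    qed
    have chain: "le u v \<or> le v u" if e: "w e \<noteq> 0" and uv: "u \<in> set (snd e)" "v \<in> set (snd e)" for e u v
    proof (cases "u = v")
      case True
      then show ?thesis using ord(3)[of v] uv struc_wfD(7)[OF A, of "fst e" "snd e"] e
        by (auto simp: w_def tuples_def)
    next
      case False
      have *: "fst e \<in> dom (sigma A)" "snd e \<in> tuples (univ A) (the (sigma A (fst e)))"
        using struc_wfD(6,7)[OF A, of "fst e" "snd e"] e by (auto simp: w_def)
      moreover have "interp A (fst e) (snd e) > 0" using e struc_wfD(4)[OF A, of "fst e" "snd e"] by (simp add: w_def)
      ultimately have "gaif_adj A u v" unfolding gaif_adj_def using uv False by blast
      moreover have "u \<in> univ A" "v \<in> univ A" using * uv by (auto simp: tuples_def)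
      ultimately show ?thesis using ord(7) by blast
    qed
    have ww: "weights w" unfolding weights_def
    proof (intro allI conjI impI)
      fix e show "w e \<ge> 0" "w e \<in> \<rat>" using struc_wfD(4,5)[OF A] by (simp_all add: w_def)
      assume e: "w e \<noteq> 0"
      show "e \<in> slot" by (rule slotI[OF e])
      show "inj_on col (set (snd e))"
      proof (rule inj_onI, rule ccontr)
        fix u v assume uv: "u \<in> set (snd e)" "v \<in> set (snd e)" "col u = col v" "u \<noteq> v"
        have "le u v \<or> le v u" by (rule chain[OF e uv(1,2)])
        then show False using uv(3,4) forest_order_card_less[OF fo struc_wfD(1)[OF A]] unfolding col_def
          by (metis less_irrefl)
      qed
    qed
    obtain V' w' where V': "V' \<subseteq> U" "card V' \<le> size_bound m r (Suc k) \<delta> k"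
      and w': "weights w'" "supported w' V' {}" and ap: "approx (real k * \<delta>) {} (part w U {}) w'"
    proof -
      have "\<exists>V' w'. V' \<subseteq> {u \<in> U. u \<notin> {} \<and> (\<forall>a\<in>{}. le a u)} \<and> card V' \<le> size_bound m r (Suc k) \<delta> k \<and> weights w' \<and>
        supported w' V' {} \<and> approx (real k * \<delta>) {} (part w {u \<in> U. u \<notin> {} \<and> (\<forall>a\<in>{}. le a u)} {}) w'"
        by (rule fold_above[OF fo[folded U_def] refl _ ww chain \<delta>]) (auto simp: col_def)
      then show thesis using that by auto
    qed
    \<comment> \<open>Empty tuples meet no vertex set, so folding does not see them; their weights
      are carried over unchanged.\<close>
    define w0 where "w0 = (\<lambda>e :: nat \<times> nat list. if set (snd e) = {} then w e else 0)"
    define w1 where "w1 = (\<lambda>e. w' e + w0 e)"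
    have w0: "weights w0" unfolding w0_def by (rule weights_if[OF ww])
    have split: "w = (\<lambda>e. part w U {} e + w0 e)"
    proof
      fix e
      show "w e = part w U {} e + w0 e"
      proof (cases "w e = 0")
        case True then show ?thesis by (simp add: part_def w0_def)
      next
        case False
        then have "set (snd e) \<subseteq> U" using slotI[OF False] by (auto simp: slot_def tuples_def)
        then show ?thesis by (simp add: part_def w0_def Int_absorb2)
      qed
    qed
    have "approx (real k * \<delta>) {} (\<lambda>e. part w U {} e + w0 e) w1" unfolding w1_def
      by (rule approx_add_pinned[OF ap w0]) (use \<delta> in \<open>auto simp: w0_def split: if_splits\<close>)
    then have ap1: "approx (real k * \<delta>) {} w w1" unfolding split[symmetric] .
    have w1: "weights w1" unfolding w1_def by (rule weights_add[OF w'(1) w0])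
    have w1V: "set (snd e) \<subseteq> V'" if ne: "w1 e \<noteq> 0" for e
    proof -
      consider "w' e \<noteq> 0" | "w0 e \<noteq> 0" using ne unfolding w1_def by fastforce
      then show ?thesis
      proof cases
        case 1 then show ?thesis using supportedD(1)[OF w'(2) 1] by simp
      next
        case 2 then show ?thesis by (auto simp: w0_def split: if_splits)
      qed
    qed
    \<comment> \<open>\<open>V'\<close> is not known to be nonempty, but the domain of a structure
      has to be.\<close>
    obtain u0 where u0: "u0 \<in> U" using struc_wfD(2)[OF A] by (auto simp: U_def)
    define B :: "nat struc" where "B = \<lparr>univ = insert u0 V', sigma = sigma A, interp = (\<lambda>f x. w1 (f, x))\<rparr>"
    have BU: "univ B \<subseteq> U" using V'(1) u0 by (simp add: B_def)
    have sB: "sigma B = sigma A" by (simp add: B_def)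
    have wfB: "struc_wf B" unfolding struc_wf_def
    proof (intro conjI allI impI)
      show "finite (univ B)" using BU U finite_subset by blast
      show "univ B \<noteq> {}" by (simp add: B_def)
      show "finite (dom (sigma B))" using struc_wfD(3)[OF A] by (simp add: B_def)
      fix f x
      show "interp B f x \<ge> 0" "interp B f x \<in> \<rat>" using weightsD(1,2)[OF w1] by (simp_all add: B_def)
      assume "interp B f x \<noteq> 0"
      then have ne: "w1 (f, x) \<noteq> 0" by (simp add: B_def)
      have "(f, x) \<in> slot" by (rule weightsD(3)[OF w1 ne])
      then have "f \<in> Fs" "x \<in> tuples U (ar f)" by (simp_all add: slot_def)
      then show "f \<in> dom (sigma B)" "x \<in> tuples (univ B) (the (sigma B f))"
        using w1V[OF ne] by (auto simp: Fs_def ar_def B_def tuples_def)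
    qed
    have valA: "val A C h = wval (interp C) w h" for C :: "nat struc" and h
    proof -
      have "val A C h = (\<Sum>(f, x)\<in>slot. interp A f x * interp C f (map h x))"
        unfolding slot_def unfolding val_def Fs_def ar_def U_def
        by (rule sum.Sigma) (use struc_wfD(1,3)[OF A] tuples_finite in auto)
      then show ?thesis unfolding wval_def w_def by (simp add: case_prod_beta)
    qed
    have valB: "val B C h = wval (interp C) w1 h" for C :: "nat struc" and h
    proof -
      have "val B C h = (\<Sum>(f, x)\<in>(SIGMA f:Fs. tuples (univ B) (ar f)). interp B f x * interp C f (map h x))"
        unfolding val_def Fs_def ar_def sB
        by (rule sum.Sigma) (use struc_wfD(1,3)[OF wfB] tuples_finite sB in auto)
      also have "\<dots> = (\<Sum>e\<in>(SIGMA f:Fs. tuples (univ B) (ar f)). w1 e * interp C (fst e) (map h (snd e)))"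
        by (intro sum.cong) (auto simp: B_def)
      also have "\<dots> = wval (interp C) w1 h" unfolding wval_def
      proof (rule sum.mono_neutral_left[OF finite_slot])
        show "(SIGMA f:Fs. tuples (univ B) (ar f)) \<subseteq> slot" using BU by (auto simp: slot_def tuples_def)
        show "\<forall>e\<in>slot - (SIGMA f:Fs. tuples (univ B) (ar f)). w1 e * interp C (fst e) (map h (snd e)) = 0"
        proof
          fix e assume e: "e \<in> slot - (SIGMA f:Fs. tuples (univ B) (ar f))"
          have "w1 e = 0"
          proof (rule ccontr)
            assume "w1 e \<noteq> 0"
            then have "set (snd e) \<subseteq> univ B" using w1V[of e] by (auto simp: B_def)
            then show False using e by (auto simp: slot_def tuples_def)
          qed
          then show "w1 e * interp C (fst e) (map h (snd e)) = 0" by simp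
        qed
      qed
      finally show ?thesis .
    qed
    have "d_opt A B \<le> ereal \<epsilon>"
    proof (rule d_opt_leI[OF A wfB])
      fix C :: "nat struc" assume C: "struc_wf C" "sigma C = sigma A"
      have D: "target (univ C) (interp C)" using struc_wfD(1,2,4)[OF C(1)] by (simp add: target_def)
      obtain d where d: "d \<in> univ C" using struc_wfD(2)[OF C(1)] by blast
      have leA: "wval (interp C) w h \<le> opt A C" if "range h \<subseteq> univ C" for h
        unfolding valA[symmetric] by (rule val_le_opt[OF A C(1)]) (use that in auto)
      have leB: "wval (interp C) w1 h \<le> opt B C" if "range h \<subseteq> univ C" for h
        unfolding valB[symmetric] by (rule val_le_opt[OF wfB C(1)]) (use that in auto)
      have "opt B C \<le> opt A C"
      proof -
        obtain h where h: "h \<in> univ B \<rightarrow> univ C" "val B C h = opt B C" by (rule opt_attained[OF wfB C(1)])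
        \<comment> \<open>\<open>dominated\<close> speaks of total maps into the target domain, so
          \<open>h\<close> is extended by a fixed element.\<close>
        define h1 where "h1 = (\<lambda>u. if u \<in> univ B then h u else d)"
        have h1: "range h1 \<subseteq> univ C" using h(1) d by (auto simp: h1_def)
        have "val B C h1 = val B C h" by (rule val_cong) (simp add: h1_def)
        then have "opt B C = wval (interp C) w1 h1" using h(2) valB by simp
        also obtain h2 where "range h2 \<subseteq> univ C" "wval (interp C) w1 h1 \<le> wval (interp C) w h2 + 0"
          using dominatedD[OF approxD(2)[OF ap1 D] h1] by blast
        then have "wval (interp C) w1 h1 \<le> opt A C" using leA[of h2] by simp
        finally show ?thesis .
      qed
      moreover have "exp (- \<epsilon>) * opt A C \<le> opt B C"
      proof -
        obtain h where h: "h \<in> univ A \<rightarrow> univ C" "val A C h = opt A C" by (rule opt_attained[OF A C(1)])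
        define h1 where "h1 = (\<lambda>u. if u \<in> univ A then h u else d)"
        have h1: "range h1 \<subseteq> univ C" using h(1) d by (auto simp: h1_def)
        have "val A C h1 = val A C h" by (rule val_cong) (simp add: h1_def)
        then have oA: "opt A C = wval (interp C) w h1" using h(2) valA by simp
        obtain h2 where h2: "range h2 \<subseteq> univ C"
          "wval (interp C) w h1 \<le> wval (interp C) w1 h2 + real k * \<delta> * weight_bound (univ C) (interp C) w"
          using dominatedD[OF approxD(1)[OF ap1 D] h1] by blast
        have "weight_bound (univ C) (interp C) w \<le> P * opt A C"
          unfolding P_def by (rule weight_bound_le[OF D ww leA])
        then have "real k * \<delta> * weight_bound (univ C) (interp C) w \<le> real k * \<delta> * (P * opt A C)"
          using \<delta> by (intro mult_left_mono) auto
        also have "\<dots> = real k * \<delta> * P * opt A C" by simp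
        also have "\<dots> \<le> (1 - exp (- \<epsilon>)) * opt A C"
          by (rule mult_right_mono[OF k\<delta> opt_nonneg[OF A C(1)]])
        finally have "opt A C \<le> opt B C + (1 - exp (- \<epsilon>)) * opt A C"
          using h2 leB[OF h2(1)] oA by linarith
        then show ?thesis by (simp add: algebra_simps)
      qed
      ultimately show "opt B C \<le> opt A C \<and> exp (- \<epsilon>) * opt A C \<le> opt B C" ..
    qed (use \<epsilon> in simp)
    moreover have "gsize (univ B) (gaif_adj B) \<le> Suc (size_bound m r (Suc k) \<delta> k)"
      unfolding gsize_def B_def using V'(2) card_insert_le_m1[of "Suc (size_bound m r (Suc k) \<delta> k)" V' u0] by simp
    ultimately show ?thesis unfolding approximable_def using wfB sB by blast
  qed
  then show ?thesis by blast
qed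

section \<open>The equivalences\<close>

theorem theorem5:
  fixes \<A> :: "'a struc set"
  assumes "\<forall>A\<in>\<A>. struc_wf A"
  shows "(pliable treedepth \<A> \<longleftrightarrow> pliable treewidth \<A>) \<and>
         (pliable treewidth \<A> \<longleftrightarrow> pliable hadwiger \<A>) \<and>
         (bounded_signatures \<A> \<longrightarrow>
            (pliable treedepth \<A> \<longleftrightarrow> pliable gsize \<A>) \<and>
            (pliable treedepth \<A> \<longleftrightarrow> pliable gcc \<A>))"
proof -
  \<comment> \<open>The implications close two cycles that share \<open>treedepth\<close>, one
    through \<open>treewidth\<close> and \<open>hadwiger\<close>, the other through
    \<open>gsize\<close> and \<open>gcc\<close>; boundedness of the signatures enters in the step
    from \<open>treedepth\<close> to \<open>gsize\<close>.\<close>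
  have td_tw: "pliable treewidth \<A>" if "pliable treedepth \<A>"
  proof (rule pliable_mono[OF that])
    fix B :: "nat struc" assume "struc_wf B"
    then have V: "finite (univ B)" by (rule struc_wfD(1))
    show "treewidth (univ B) (gaif_adj B) \<le> treedepth (univ B) (gaif_adj B) + 0"
      unfolding add_0_right by (rule treewidth_le[OF V iffD1[OF treedepth_le_iff[OF V] order_refl]])
  qed
  have tw_had: "pliable hadwiger \<A>" if "pliable treewidth \<A>"
    by (rule pliable_mono[OF that hadwiger_le_treewidth[OF struc_wfD(1)]])
  have had_td: "pliable treedepth \<A>" if "pliable hadwiger \<A>"
  proof (rule pliable_trans[OF assms that])
    fix \<epsilon> :: real and k assume "\<epsilon> > 0"
    from hadwiger_bounded_td_approx[OF this, of k]
    show "\<exists>k'. \<forall>B :: nat struc. struc_wf B \<and> sigma B \<in> sigma ` \<A> \<and> hadwiger (univ B) (gaif_adj B) \<le> k \<longrightarrow>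
      approximable treedepth k' \<epsilon> B" by blast
  qed
  have td_size: "pliable gsize \<A>" if bs: "bounded_signatures \<A>" and td: "pliable treedepth \<A>"
  proof (rule pliable_trans[OF assms td])
    fix \<epsilon> :: real and k assume \<epsilon>: "\<epsilon> > 0"
    obtain m r where mr: "\<forall>A\<in>\<A>. card (dom (sigma A)) \<le> m \<and> (\<forall>f n. sigma A f = Some n \<longrightarrow> n \<le> r)"
      using bs unfolding bounded_signatures_def by blast
    from td_bounded_size_approx[OF \<epsilon>, of m r k] obtain s where
      s: "\<forall>A :: nat struc. struc_wf A \<and> card (dom (sigma A)) \<le> m \<and> (\<forall>f n. sigma A f = Some n \<longrightarrow> n \<le> r) \<and>
        td_le (gaif_adj A) k (univ A) \<longrightarrow> approximable gsize s \<epsilon> A" ..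
    have "approximable gsize s \<epsilon> B"
      if B: "struc_wf B" "sigma B \<in> sigma ` \<A>" "treedepth (univ B) (gaif_adj B) \<le> k" for B :: "nat struc"
    proof -
      obtain A where A: "A \<in> \<A>" "sigma B = sigma A" using B(2) by blast
      have "td_le (gaif_adj B) k (univ B)" by (rule iffD1[OF treedepth_le_iff[OF struc_wfD(1)[OF B(1)]] B(3)])
      then show ?thesis using spec[OF s, of B] B(1) bspec[OF mr A(1)] A(2) by simp
    qed
    then show "\<exists>k'. \<forall>B :: nat struc. struc_wf B \<and> sigma B \<in> sigma ` \<A> \<and> treedepth (univ B) (gaif_adj B) \<le> k \<longrightarrow>
      approximable gsize k' \<epsilon> B" by blast
  qed
  have size_cc: "pliable gcc \<A>" if "pliable gsize \<A>"
  proof (rule pliable_mono[OF that])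
    fix B :: "nat struc" assume "struc_wf B"
    then show "gcc (univ B) (gaif_adj B) \<le> gsize (univ B) (gaif_adj B) + 0"
      using gcc_le_gsize[OF struc_wfD(1,2)] by simp
  qed
  have cc_td: "pliable treedepth \<A>" if "pliable gcc \<A>"
  proof (rule pliable_mono[OF that])
    fix B :: "nat struc" assume "struc_wf B"
    then have V: "finite (univ B)" by (rule struc_wfD(1))
    show "treedepth (univ B) (gaif_adj B) \<le> gcc (univ B) (gaif_adj B) + 0"
      unfolding add_0_right by (rule iffD2[OF treedepth_le_iff[OF V] td_le_gcc[OF V symp_gaif_adj]])
  qed
  show ?thesis using td_tw tw_had had_td td_size size_cc cc_td by blast
qed

end
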